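(* Let $\chi$ be a primitive Dirichlet character that is non-principal, of conductor $N$, and let $$\xi(s,\chi)=\Big(\frac{\pi}{N}\Big)^{-\frac{s+\kappa}{2}}\Gamma\Big(\frac{s+\kappa}{2}\Big)L(s,\chi),$$ where $\kappa=0$ if $\chi(-1)=1$ and $\kappa=1$ if $\chi(-1)=-1$, and $L(s,\chi)$ is the Dirichlet $L$-function. For real $h$ and $0\le\theta<2\pi$ set $E_{h,\theta}(s,\chi)=e^{i\theta}\xi(s+h,\chi)$ and $$A_{h,\theta}(s,\chi)=\tfrac12\Big(E_{h,\theta}(s,\chi)+\overline{E_{h,\theta}(1-\bar s,\chi)}\Big),\qquad B_{h,\theta}(s,\chi)=-\tfrac1{2i}\Big(E_{h,\theta}(s,\chi)-\overline{E_{h,\theta}(1-\bar s,\chi)}\Big).$$ (1) For every real $h$ with $|h|\ge\tfrac12$ and every $0\le\theta<2\pi$, the entire functions $A_{h,\theta}(s,\chi)$ and $B_{h,\theta}(s,\chi)$ have all their zeros on the critical line $\Re(s)=\tfrac12$. These zeros are all simple zeros, and the zeros of $A_{h,\theta}(s,\chi)$ and $B_{h,\theta}(s,\chi)$ interlace. (2) Assume the Riemann hypothesis for $L(s,\chi)$. Then for every real $h$ with $0<|h|<\tfrac12$ and every $0\le\theta<2\pi$, the functions $A_{h,\theta}(s,\chi)$ and $B_{h,\theta}(s,\chi)$ have all their zeros on the critical line $\Re(s)=\tfrac12$. These zeros are all simple zeros, and the zeros of $A_{h,\theta}(s,\chi)$ and $B_{h,\theta}(s,\chi)$ interlace.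
   Context: The Riemann hypothesis for $L(s,\chi)$ states that all zeros of $L(s,\chi)$ in the strip $0<\Re(s)<1$ lie on $\Re(s)=\tfrac12$. Interlacing: for two entire functions $A,B$ with all zeros on $\Re(s)=\tfrac12$, the zeros interlace if there is a numbering of their zeros, $\tfrac12+i\gamma_n(A)$ and $\tfrac12+i\gamma_n(B)$ respectively, counted with multiplicity and with imaginary parts in increasing order, such that $\gamma_n(A)\le\gamma_n(B)\le\gamma_{n+1}(A)$ holds for all allowed indices $n$. *)

theory Defs
  imports "HOL-Complex_Analysis.Complex_Analysis"
begin

section \<open>Dirichlet characters\<close>

text \<open>A Dirichlet character modulo \<open>N\<close>, as a function on the integers. That \<open>chi 1 = 1\<close> follows
  from multiplicativity and \<open>chi 1 \<noteq> 0\<close>.\<close>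

definition dirichlet_character :: "nat \<Rightarrow> (int \<Rightarrow> complex) \<Rightarrow> bool" where
  "dirichlet_character N chi \<longleftrightarrow>
     N > 0 \<and>
     (\<forall>m n. chi (m * n) = chi m * chi n) \<and>
     (\<forall>m. chi (m + int N) = chi m) \<and>
     (\<forall>m. chi m \<noteq> 0 \<longleftrightarrow> coprime m (int N))"

definition principal_character :: "nat \<Rightarrow> int \<Rightarrow> complex" where
  "principal_character N m = (if coprime m (int N) then 1 else 0)"

definition induced_from :: "nat \<Rightarrow> (int \<Rightarrow> complex) \<Rightarrow> nat \<Rightarrow> bool" where
  "induced_from N chi d \<longleftrightarrow>
     d dvd N \<and>
     (\<exists>\<psi>. dirichlet_character d \<psi> \<and> (\<forall>m. coprime m (int N) \<longrightarrow> chi m = \<psi> m))"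

definition conductor :: "nat \<Rightarrow> (int \<Rightarrow> complex) \<Rightarrow> nat" where
  "conductor N chi = (LEAST d. induced_from N chi d)"

definition primitive_dirichlet_character :: "nat \<Rightarrow> (int \<Rightarrow> complex) \<Rightarrow> bool" where
  "primitive_dirichlet_character N chi \<longleftrightarrow> dirichlet_character N chi \<and> conductor N chi = N"

section \<open>The Dirichlet \<open>L\<close>-function and its completion\<close>

text \<open>\<open>L(s, chi)\<close> is the analytic continuation of the Dirichlet series from \<open>Re s > 1\<close>. The
  continuation to the punctured plane is unique there, and \<^const>\<open>remove_sings\<close> supplies the
  value at 1 (when \<open>chi\<close> is principal there is a pole, and the value is 0 by convention).\<close>

definition dirichlet_L :: "(int \<Rightarrow> complex) \<Rightarrow> complex \<Rightarrow> complex" where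
  "dirichlet_L chi = remove_sings (SOME f. f holomorphic_on (UNIV - {1}) \<and>
     (\<forall>s. Re s > 1 \<longrightarrow> f s = (\<Sum>n. chi (int (Suc n)) / of_nat (Suc n) powr s)))"

definition riemann_hypothesis_L :: "(int \<Rightarrow> complex) \<Rightarrow> bool" where
  "riemann_hypothesis_L chi \<longleftrightarrow>
     (\<forall>s. 0 < Re s \<and> Re s < 1 \<and> dirichlet_L chi s = 0 \<longrightarrow> Re s = 1/2)"

definition parity :: "(int \<Rightarrow> complex) \<Rightarrow> nat" where
  "parity chi = (if chi (-1) = 1 then 0 else 1)"

text \<open>The poles of the Gamma factor are cancelled by the trivial zeros of \<open>L\<close>. As \<^const>\<open>Gamma\<close>
  takes the value 0 at its poles, the bare product would be 0 there instead of the value of the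
  entire function meant.\<close>

definition xi :: "nat \<Rightarrow> (int \<Rightarrow> complex) \<Rightarrow> complex \<Rightarrow> complex" where
  "xi N chi = remove_sings (\<lambda>s.
     of_real (pi / real N) powr (- ((s + of_nat (parity chi)) / 2)) *
     Gamma ((s + of_nat (parity chi)) / 2) * dirichlet_L chi s)"

definition E_fun :: "nat \<Rightarrow> (int \<Rightarrow> complex) \<Rightarrow> real \<Rightarrow> real \<Rightarrow> complex \<Rightarrow> complex" where
  "E_fun N chi h \<theta> s = exp (\<i> * of_real \<theta>) * xi N chi (s + of_real h)"

definition A_fun :: "nat \<Rightarrow> (int \<Rightarrow> complex) \<Rightarrow> real \<Rightarrow> real \<Rightarrow> complex \<Rightarrow> complex" where
  "A_fun N chi h \<theta> s = 1 / 2 * (E_fun N chi h \<theta> s + cnj (E_fun N chi h \<theta> (1 - cnj s)))"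

definition B_fun :: "nat \<Rightarrow> (int \<Rightarrow> complex) \<Rightarrow> real \<Rightarrow> real \<Rightarrow> complex \<Rightarrow> complex" where
  "B_fun N chi h \<theta> s =
     - (1 / (2 * \<i>)) * (E_fun N chi h \<theta> s - cnj (E_fun N chi h \<theta> (1 - cnj s)))"

section \<open>Zeros on the critical line\<close>

definition zeros_on_critical_line :: "(complex \<Rightarrow> complex) \<Rightarrow> bool" where
  "zeros_on_critical_line f \<longleftrightarrow> (\<forall>s. f s = 0 \<longrightarrow> Re s = 1/2)"

definition all_zeros_simple :: "(complex \<Rightarrow> complex) \<Rightarrow> bool" where
  "all_zeros_simple f \<longleftrightarrow> (\<forall>s. f s = 0 \<longrightarrow> zorder f s = 1)"

text \<open>A numbering, with multiplicity and in increasing order, of the zeros \<open>1/2 + i \<gamma> n\<close>. The set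
  \<open>I\<close> of allowed indices is a set of consecutive integers, so that it may be finite, or infinite in
  one or both directions.\<close>

definition zero_numbering :: "(complex \<Rightarrow> complex) \<Rightarrow> int set \<Rightarrow> (int \<Rightarrow> real) \<Rightarrow> bool" where
  "zero_numbering f I \<gamma> \<longleftrightarrow>
     (\<forall>m\<in>I. \<forall>n\<in>I. {m..n} \<subseteq> I) \<and>
     mono_on I \<gamma> \<and>
     (\<forall>n\<in>I. f (Complex (1/2) (\<gamma> n)) = 0) \<and>
     (\<forall>t. f (Complex (1/2) t) = 0 \<longrightarrow>
        finite {n\<in>I. \<gamma> n = t} \<and> int (card {n\<in>I. \<gamma> n = t}) = zorder f (Complex (1/2) t))"

text \<open>The last two conditions match the two index sets. They are automatic if both are all of the
  integers; otherwise they exclude numberings with index sets shifted apart, for which the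
  inequalities would hold vacuously.\<close>

definition zeros_interlace :: "(complex \<Rightarrow> complex) \<Rightarrow> (complex \<Rightarrow> complex) \<Rightarrow> bool" where
  "zeros_interlace A B \<longleftrightarrow>
     (\<exists>I J \<alpha> \<beta>. zero_numbering A I \<alpha> \<and> zero_numbering B J \<beta> \<and>
        (\<forall>n. n \<in> I \<and> n \<in> J \<longrightarrow> \<alpha> n \<le> \<beta> n) \<and>
        (\<forall>n. n \<in> J \<and> n + 1 \<in> I \<longrightarrow> \<beta> n \<le> \<alpha> (n + 1)) \<and>
        (\<forall>n. n \<in> I \<and> n + 1 \<in> I \<longrightarrow> n \<in> J) \<and>
        (\<forall>n. n \<in> J \<and> n + 1 \<in> J \<longrightarrow> n + 1 \<in> I))"

end

theory Submission
  imports Defs "HOL-Number_Theory.Number_Theory" "HOL-Real_Asymp.Real_Asymp"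
begin

text \<open>Write \<open>E\<^sup>*(s)\<close> for the conjugate of \<open>E(1 - cnj s)\<close>. On the critical line \<open>A\<close> and \<open>- B\<close> are the
  real and imaginary part of \<open>E\<close>. If \<open>\<bar>E\<^sup>*\<bar> < \<bar>E\<bar>\<close> to the right of the line, then \<open>A\<close> and \<open>B\<close> do not vanish off
  the line, and Hopf's boundary lemma for \<open>E\<^sup>* / E\<close> shows that the phase of \<open>E\<close> on the line has positive
  derivative; hence the zeros are simple and alternate. The opposite inequality exchanges \<open>E\<close> and \<open>E\<^sup>*\<close>.

  By the functional equation \<open>\<bar>E\<^sup>*(s)\<bar> = \<bar>\<xi>(s - h)\<bar>\<close>, so for \<open>h > 0\<close> the inequality is
  \<open>\<bar>\<xi>(s - h)\<bar> < \<bar>\<xi>(s + h)\<bar>\<close> for \<open>Re s > 1/2\<close>. The quotient has modulus 1 on the line. It is holomorphic of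
  polynomial growth on the half-plane when \<open>L\<close> has no zeros in \<open>Re s > c\<close> and \<open>h > c - 1/2\<close> (with \<open>c = 1\<close>, or
  \<open>c = 1/2\<close> under the Riemann hypothesis), the lower bound for \<open>L\<close> coming from Harnack's inequality. So the
  Phragmen-Lindelof principle applies, and \<open>h = 1/2\<close> is a limiting case, in which moreover the
  nonvanishing of \<open>L\<close> on \<open>Re s = 1\<close> is needed for \<open>E\<close> to have no zeros on the critical line.

  The functional equation only has to be shown for real \<open>0 < s < 1\<close>: there \<open>\<Gamma>(s) L(s)\<close> is the Mellin
  transform of \<open>\<Sum> \<chi>(n) exp (- n t)\<close>, and the partial fractions of the cotangent turn the product of this
  series with the Gauss sum into \<open>\<Sum> cnj \<chi>(k) (1 / (t + i k \<delta>) + \<chi>(-1) / (t - i k \<delta>))\<close>, \<open>\<delta> = 2 pi / N\<close>. That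
  the constant in it has modulus 1 follows by applying it twice.\<close>

section \<open>Harnack's inequality\<close>

text \<open>The delicate point is the strict inequality at h = 1/2. There s + h reaches Re = 1 on
  the critical line itself, where Harnack gives no polynomial lower bound for L, so the inequality
  comes from h' > 1/2 by continuity and survives only as \<le>. Strictness returns through the
  maximum principle: equality at one interior point makes the quotient constant, hence |xi| periodic
  in the real direction with period 2 h, against the growth of Gamma. Gamma decays exponentially
  along vertical lines, so its values are compared only at equal ordinates, where their quotient is
  bounded; thus the growth of the whole quotient is governed by L.

  The interval 0 < s < 1 is where both sides of the partial fraction identity have convergent Mellin
  integrals; bounded sums of character values supply the dominating functions. Reflection then glues
  two half-planes into an entire function, and the given L and xi, defined by choice and by removal
  of singularities, are identified with what is built from the series.\<close>

lemma Harnack_half_plane: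
  assumes holp: "p holomorphic_on ball c R" and pos: "\<And>z. z \<in> ball c R \<Longrightarrow> Re (p z) > 0"
    and z: "z \<in> ball c R"
  shows "Re (p c) * (R - dist c z) \<le> Re (p z) * (R + dist c z)"
    and "Re (p z) * (R - dist c z) \<le> Re (p c) * (R + dist c z)"
proof -
  have R: "R > 0" using z by (metis dist_not_less_zero dual_order.strict_trans1 mem_ball not_le)
  define p0 where "p0 = p c"
  have p0: "Re p0 > 0" using pos[of c] R by (simp add: p0_def)
  \<comment> \<open>Cayley transform of the right half-plane onto the unit disc, sending
    \<open>p c\<close> to 0, with the ball rescaled to the unit disc; the Schwarz lemma applies to
    it.\<close>
  define q where "q = (\<lambda>w::complex. (p (c + R * w) - p0) / (p (c + R * w) + cnj p0))"
  have inb: "c + R * w \<in> ball c R" if "norm w < 1" for w :: complex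
    using that R by (simp add: dist_norm norm_mult)
  have den: "p (c + R * w) + cnj p0 \<noteq> 0" if "norm w < 1" for w :: complex
  proof -
    have "Re (p (c + R * w) + cnj p0) > 0" using pos[OF inb[OF that]] p0 by simp
    thus ?thesis by (metis less_irrefl zero_complex.simps(1))
  qed
  have less: "norm (a - p0) < norm (a + cnj p0)" if "Re a > 0" for a
  proof -
    have "(norm (a - p0))\<^sup>2 < (norm (a + cnj p0))\<^sup>2"
      unfolding cmod_power2 using mult_pos_pos[OF that p0] by (simp add: power2_eq_square algebra_simps)
    thus ?thesis by (rule power2_less_imp_less) simp
  qed
  have holq: "q holomorphic_on ball 0 1"
  proof -
    have "(\<lambda>w. p (c + R * w)) holomorphic_on ball 0 1"
      by (rule holomorphic_on_compose_gen[OF _ holp, unfolded o_def])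
         (use inb in \<open>auto intro!: holomorphic_intros\<close>)
    thus ?thesis unfolding q_def using den by (intro holomorphic_intros) auto
  qed
  have q1: "norm (q w) < 1" if "norm w < 1" for w
    unfolding q_def norm_divide using less[OF pos[OF inb[OF that]]] den[OF that] by simp
  have q0: "q 0 = 0" by (simp add: q_def p0_def)
  define w where "w = (z - c) / R"
  have nw: "norm w = dist c z / R" using R by (simp add: w_def norm_divide dist_norm norm_minus_commute)
  have w1: "norm w < 1" using z R by (simp add: nw)
  have zw: "c + R * w = z" using R by (simp add: w_def)
  have qw: "norm (q w) \<le> norm w" by (rule Schwarz_Lemma(1)[OF holq q0 q1 w1])
  define a where "a = p z"
  define r where "r = dist c z"
  have ra: "Re a > 0" using pos[OF z] by (simp add: a_def)
  have rR: "0 \<le> r" "r < R" using z by (auto simp: r_def)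
  have "norm (a - p0) / norm (a + cnj p0) \<le> r / R"
    using qw unfolding q_def zw nw norm_divide a_def r_def .
  moreover have "norm (a + cnj p0) > 0" using less[OF ra] by (metis norm_ge_zero order.strict_trans1)
  ultimately have "R * norm (a - p0) \<le> r * norm (a + cnj p0)" using R by (simp add: field_simps)
  hence "(R * norm (a - p0))\<^sup>2 \<le> (r * norm (a + cnj p0))\<^sup>2" using R by (intro power_mono) auto
  hence "R\<^sup>2 * ((Re a - Re p0)\<^sup>2 + (Im a - Im p0)\<^sup>2) \<le> r\<^sup>2 * ((Re a + Re p0)\<^sup>2 + (Im a - Im p0)\<^sup>2)"
    by (simp add: power_mult_distrib cmod_power2)
  moreover have "r\<^sup>2 * (Im a - Im p0)\<^sup>2 \<le> R\<^sup>2 * (Im a - Im p0)\<^sup>2"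
    using rR by (intro mult_right_mono power_mono) auto
  ultimately have "R\<^sup>2 * (Re a - Re p0)\<^sup>2 \<le> r\<^sup>2 * (Re a + Re p0)\<^sup>2" by (simp add: algebra_simps)
  hence "(R * (Re a - Re p0))\<^sup>2 \<le> (r * (Re a + Re p0))\<^sup>2" by (simp add: power_mult_distrib)
  hence "\<bar>R * (Re a - Re p0)\<bar> \<le> r * (Re a + Re p0)"
    using rR ra p0 by (metis abs_le_square_iff abs_of_nonneg add_nonneg_nonneg less_imp_le mult_nonneg_nonneg)
  thus "Re (p c) * (R - dist c z) \<le> Re (p z) * (R + dist c z)"
    and "Re (p z) * (R - dist c z) \<le> Re (p c) * (R + dist c z)"
    unfolding a_def[symmetric] p0_def[symmetric] r_def[symmetric] by (auto simp: algebra_simps)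
qed

text \<open>A boundary point lemma of Hopf type, by Harnack's inequality on a disc tangent to the line at
  the point \<open>w\<close>.\<close>

lemma Hopf_vertical_line:
  assumes der: "(f has_field_derivative D) (at w)" and fw: "norm (f w) = 1"
    and d: "d > 0" and holf: "f holomorphic_on ball (w + of_real d) d"
    and less: "\<And>z. z \<in> ball (w + of_real d) d \<Longrightarrow> norm (f z) < 1"
  shows "Re (cnj (f w) * D) < 0"
proof -
  define p where "p = (\<lambda>z. 1 - cnj (f w) * f z)"
  define c where "c = w + of_real d"
  have pos: "Re (p z) > 0" if "z \<in> ball c d" for z
  proof -
    have "Re (cnj (f w) * f z) \<le> norm (cnj (f w) * f z)" by (rule complex_Re_le_cmod)
    also have "\<dots> < 1" using less[of z] that fw by (simp add: norm_mult c_def)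
    finally show ?thesis by (simp add: p_def)
  qed
  have holp: "p holomorphic_on ball c d" unfolding p_def c_def using holf by (intro holomorphic_intros)
  \<comment> \<open>The slope given by Harnack: at distance x from \<open>w\<close> along the
    radius, R - dist equals x and R + dist is at most 2 d, so the real part of \<open>p\<close> is
    at least m x.\<close>
  define m where "m = Re (p c) / (2 * d)"
  have m: "m > 0" using pos[of c] d by (simp add: m_def)
  have dp: "((\<lambda>x. Re (p (w + of_real x))) has_real_derivative - Re (cnj (f w) * D)) (at 0)"
  proof -
    have "(p has_field_derivative (- (cnj (f w) * D))) (at (w + of_real 0))"
      unfolding p_def using der by (auto intro!: derivative_eq_intros)
    hence "((\<lambda>x::real. p (w + of_real x)) has_vector_derivative (- (cnj (f w) * D))) (at 0)"
      by (intro field_vector_diff_chain_at[where f="\<lambda>x::real. w + of_real x" and f'=1 and g=p, unfolded o_def, simplified])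
         (auto intro!: derivative_eq_intros)
    hence "((\<lambda>x::real. Re (p (w + of_real x))) has_vector_derivative Re (- (cnj (f w) * D))) (at 0)"
      by (rule bounded_linear.has_vector_derivative[OF bounded_linear_Re])
    thus ?thesis by (simp add: has_real_derivative_iff_has_vector_derivative)
  qed
  have p0: "p w = 0"
  proof -
    have "cnj (f w) * f w = 1" using fw by (simp add: complex_norm_square[symmetric] mult.commute)
    thus ?thesis by (simp add: p_def)
  qed
  have ev: "m \<le> Re (p (w + of_real x)) / x" if "0 < x" "x < d" for x :: real
  proof -
    have di: "dist c (w + of_real x) = d - x"
    proof -
      have "c - (w + of_real x) = of_real (d - x)" by (simp add: c_def)
      thus ?thesis using that by (simp only: dist_norm norm_of_real)
    qed
    have "Re (p c) * (d - (d - x)) \<le> Re (p (w + of_real x)) * (d + (d - x))"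
      using Harnack_half_plane(1)[OF holp pos, of "w + of_real x"] that by (simp add: di)
    also have "\<dots> \<le> Re (p (w + of_real x)) * (2 * d)"
      using that pos[of "w + of_real x"] di by (intro mult_left_mono) auto
    finally show ?thesis using that d by (simp add: m_def field_simps)
  qed
  have "((\<lambda>x. Re (p (w + of_real x)) / x) \<longlongrightarrow> - Re (cnj (f w) * D)) (at_right 0)"
    using dp p0 unfolding has_field_derivative_iff by (auto intro: filterlim_mono at_le)
  moreover have "eventually (\<lambda>x. m \<le> Re (p (w + of_real x)) / x) (at_right 0)"
    using d ev by (auto simp: eventually_at_right)
  ultimately have "m \<le> - Re (cnj (f w) * D)" by (intro tendsto_lowerbound) auto
  thus ?thesis using m by simp
qed

section \<open>Functions of Hermite--Biehler type\<close>

definition conj_refl :: "(complex \<Rightarrow> complex) \<Rightarrow> complex \<Rightarrow> complex" where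
  "conj_refl f s = cnj (f (1 - cnj s))"

lemma conj_refl_conj_refl [simp]: "conj_refl (conj_refl f) = f"
  by (simp add: conj_refl_def fun_eq_iff)

text \<open>Conjugation has no complex derivative, so the chain rule covers only 1 - w, whence the
  sign; the two conjugations are carried through the difference quotient.\<close>

lemma has_field_derivative_conj_refl:
  assumes "(f has_field_derivative D) (at (1 - cnj s))"
  shows "(conj_refl f has_field_derivative - cnj D) (at s)"
proof -
  have "((\<lambda>w::complex. 1 - w) has_field_derivative -1) (at (cnj s))"
    by (auto intro!: derivative_eq_intros)
  hence "((\<lambda>w. f (1 - w)) has_field_derivative - D) (at (cnj s))"
    using DERIV_chain2[where f=f and g="\<lambda>w. 1 - w" and x="cnj s" and Db="-1" and s=UNIV, OF assms] by simp
  hence "((\<lambda>h. (f (1 - (cnj s + h)) - f (1 - cnj s)) / h) \<longlongrightarrow> - D) (at 0)"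
    by (simp add: DERIV_def)
  hence "((\<lambda>h. (f (1 - (cnj s + cnj h)) - f (1 - cnj s)) / cnj h) \<longlongrightarrow> - D) (at 0)"
    by (rule filterlim_compose)
       (auto simp: filterlim_at eventually_at_filter intro!: tendsto_eq_intros)
  hence "((\<lambda>h. cnj ((f (1 - (cnj s + cnj h)) - f (1 - cnj s)) / cnj h)) \<longlongrightarrow> cnj (- D)) (at 0)"
    by (rule tendsto_cnj)
  thus ?thesis by (simp add: DERIV_def conj_refl_def)
qed

lemma holomorphic_conj_refl:
  assumes "f holomorphic_on S" "open S" "\<And>s. s \<in> T \<Longrightarrow> 1 - cnj s \<in> S"
  shows "conj_refl f holomorphic_on T"
  unfolding holomorphic_on_def field_differentiable_def
proof
  fix s assume "s \<in> T"
  hence "(f has_field_derivative deriv f (1 - cnj s)) (at (1 - cnj s))"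
    using assms by (intro holomorphic_derivI) auto
  from has_field_derivative_conj_refl[OF this]
  show "\<exists>f'. (conj_refl f has_field_derivative f') (at s within T)"
    using has_field_derivative_at_within by blast
qed

lemma conj_refl_line: "1 - cnj (Complex (1/2) t) = Complex (1/2) t"
  by (simp add: complex_eq_iff)

section \<open>Zeros on the line as values of a phase\<close>

lemma zorder_simple_zero:
  assumes "f holomorphic_on UNIV" "f z = 0" "(f has_field_derivative D) (at z)" "D \<noteq> 0"
  shows "zorder f z = 1"
proof (rule simple_zeroI)
  show "(\<lambda>w. if w = z then deriv f z else (f w - f z) / (w - z)) holomorphic_on UNIV"
    by (rule pole_lemma_open[OF assms(1)]) simp
qed (use assms DERIV_imp_deriv in auto)

text \<open>Numbering by the values of a strictly increasing phase: the allowed indices are the multiples of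
  \<open>pi\<close> (shifted by \<open>d\<close>) attained by the phase, and its inverse function is the numbering.\<close>

lemma zero_numbering_phase:
  fixes \<phi> :: "real \<Rightarrow> real"
  assumes cont: "continuous_on UNIV \<phi>" and mono: "strict_mono \<phi>"
    and zero: "\<And>t. f (Complex (1/2) t) = 0 \<longleftrightarrow> (\<exists>n::int. \<phi> t = pi * of_int n + d)"
    and simple: "all_zeros_simple f"
  defines "I \<equiv> {n::int. \<exists>t. \<phi> t = pi * of_int n + d}"
  shows "zero_numbering f I (\<lambda>n. THE t. \<phi> t = pi * of_int n + d)"
proof -
  define g where "g = (\<lambda>n::int. THE t. \<phi> t = pi * of_int n + d)"
  have inj: "\<phi> s = \<phi> t \<longleftrightarrow> s = t" for s t using strict_mono_eq[OF mono] .
  have g: "\<phi> (g n) = pi * of_int n + d" if n: "n \<in> I" for n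
  proof -
    obtain t where t: "\<phi> t = pi * of_int n + d" using n by (auto simp: I_def)
    show ?thesis unfolding g_def by (rule theI[of _ t]) (use t in simp, metis inj t)
  qed
  have I: "{m..n} \<subseteq> I" if mn: "m \<in> I" "n \<in> I" for m n
  proof
    fix k assume k: "k \<in> {m..n}"
    have "connected (range \<phi>)" using cont by (intro connected_continuous_image) auto
    moreover have "pi * of_int m + d \<in> range \<phi>" "pi * of_int n + d \<in> range \<phi>"
      using g[OF mn(1)] g[OF mn(2)] by (metis rangeI)+
    moreover have "pi * of_int m + d \<le> pi * of_int k + d" "pi * of_int k + d \<le> pi * of_int n + d"
      using k by auto
    ultimately have "pi * of_int k + d \<in> range \<phi>"
      by (meson connectedD_interval)
    thus "k \<in> I" by (auto simp: I_def)
  qed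
  have mono_g: "mono_on I g"
  proof (rule mono_onI)
    fix m n assume mn: "m \<in> I" "n \<in> I" "m \<le> n"
    hence "\<phi> (g m) \<le> \<phi> (g n)" using g by auto
    thus "g m \<le> g n" using strict_mono_less_eq[OF mono] by blast
  qed
  have count: "finite {n \<in> I. g n = t} \<and> int (card {n \<in> I. g n = t}) = zorder f (Complex (1/2) t)"
    if t0: "f (Complex (1/2) t) = 0" for t
  proof -
    obtain m :: int where m: "\<phi> t = pi * of_int m + d" using t0 zero by blast
    have "{n \<in> I. g n = t} = {m}"
    proof (intro equalityI subsetI)
      fix n assume "n \<in> {n \<in> I. g n = t}"
      thus "n \<in> {m}" using g[of n] m by auto
    next
      fix n assume "n \<in> {m}"
      hence n: "n = m" by simp
      have mI: "m \<in> I" using m by (auto simp: I_def)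
      have "\<phi> (g m) = \<phi> t" using g[OF mI] m by simp
      thus "n \<in> {n \<in> I. g n = t}" using mI inj n by simp
    qed
    thus ?thesis using simple t0 by (simp add: all_zeros_simple_def)
  qed
  show ?thesis
    unfolding zero_numbering_def g_def[symmetric]
    using I mono_g count g zero by blast
qed

text \<open>Multiples of pi alternate with their shifts by pi / 2. Shifting the cosine zeros down
  rather than up puts the n-th zero of \<open>A\<close> just before the n-th zero of
  \<open>B\<close>. The matching of the two index sets holds because the range of the phase is an
  interval.\<close>

lemma zeros_interlace_phase:
  fixes \<phi> :: "real \<Rightarrow> real"
  assumes cont: "continuous_on UNIV \<phi>" and mono: "strict_mono \<phi>"
    and zeroA: "\<And>t. A (Complex (1/2) t) = 0 \<longleftrightarrow> cos (\<phi> t) = 0"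
    and zeroB: "\<And>t. B (Complex (1/2) t) = 0 \<longleftrightarrow> sin (\<phi> t) = 0"
    and simple: "all_zeros_simple A" "all_zeros_simple B"
  shows "zeros_interlace A B"
proof -
  define I where "I = {n::int. \<exists>t. \<phi> t = pi * of_int n + (- (pi / 2))}"
  define J where "J = {n::int. \<exists>t. \<phi> t = pi * of_int n + 0}"
  define a where "a = (\<lambda>n::int. THE t. \<phi> t = pi * of_int n + (- (pi / 2)))"
  define b where "b = (\<lambda>n::int. THE t. \<phi> t = pi * of_int n + 0)"
  have inj: "\<phi> s = \<phi> t \<longleftrightarrow> s = t" for s t using strict_mono_eq[OF mono] .
  have cosA: "cos x = 0 \<longleftrightarrow> (\<exists>n::int. x = pi * of_int n + (- (pi / 2)))" for x
  proof
    assume "cos x = 0"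
    hence "sin (x + pi / 2) = 0" by (simp add: sin_add)
    then obtain n :: int where "x + pi / 2 = of_int n * pi" using sin_zero_iff_int2 by blast
    hence "x = pi * of_int n + (- (pi / 2))" by (simp add: algebra_simps)
    thus "\<exists>n::int. x = pi * of_int n + (- (pi / 2))" ..
  next
    assume "\<exists>n::int. x = pi * of_int n + (- (pi / 2))"
    then obtain n :: int where n: "x = pi * of_int n + (- (pi / 2))" ..
    have "x + pi / 2 = of_int n * pi" using n by simp
    hence "sin (x + pi / 2) = 0" using sin_zero_iff_int2 by blast
    thus "cos x = 0" by (simp add: sin_add)
  qed
  have sinB: "sin x = 0 \<longleftrightarrow> (\<exists>n::int. x = pi * of_int n + 0)" for x
    by (simp add: sin_zero_iff_int2 mult.commute)
  have A: "zero_numbering A I a"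
    unfolding I_def a_def by (rule zero_numbering_phase[OF cont mono _ simple(1)]) (simp only: zeroA cosA)
  have B: "zero_numbering B J b"
    unfolding J_def b_def by (rule zero_numbering_phase[OF cont mono _ simple(2)]) (simp only: zeroB sinB)
  have a: "\<phi> (a n) = pi * of_int n - pi / 2" if n: "n \<in> I" for n
  proof -
    obtain t where t: "\<phi> t = pi * of_int n + (- (pi / 2))" using n by (auto simp: I_def)
    have "\<phi> (a n) = pi * of_int n + (- (pi / 2))" unfolding a_def
      by (rule theI[of _ t]) (use t in simp, metis inj t)
    thus ?thesis by simp
  qed
  have b: "\<phi> (b n) = pi * of_int n" if n: "n \<in> J" for n
  proof -
    obtain t where t: "\<phi> t = pi * of_int n + 0" using n by (auto simp: J_def)
    have "\<phi> (b n) = pi * of_int n + 0" unfolding b_def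
      by (rule theI[of _ t]) (use t in simp, metis inj t)
    thus ?thesis by simp
  qed
  have conn: "connected (range \<phi>)" using cont by (intro connected_continuous_image) auto
  have le: "s \<le> t" if "\<phi> s \<le> \<phi> t" for s t using that strict_mono_less_eq[OF mono] by blast
  have 1: "a n \<le> b n" if "n \<in> I" "n \<in> J" for n
    by (rule le) (use a b that in simp)
  have 2: "b n \<le> a (n + 1)" if "n \<in> J" "n + 1 \<in> I" for n
    by (rule le) (use a b that in \<open>simp add: distrib_left\<close>)
  have 3: "n \<in> J" if "n \<in> I" "n + 1 \<in> I" for n
  proof -
    have "pi * of_int n - pi / 2 \<in> range \<phi>" "pi * of_int (n + 1) - pi / 2 \<in> range \<phi>"
      using a[OF that(1)] a[OF that(2)] by (metis rangeI)+
    hence "pi * of_int n \<in> range \<phi>"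
      by (rule connectedD_interval[OF conn]) (auto simp: algebra_simps)
    thus ?thesis by (auto simp: J_def)
  qed
  have 4: "n + 1 \<in> I" if "n \<in> J" "n + 1 \<in> J" for n
  proof -
    have "pi * of_int n \<in> range \<phi>" "pi * of_int (n + 1) \<in> range \<phi>"
      using b[OF that(1)] b[OF that(2)] by (metis rangeI)+
    hence "pi * of_int (n + 1) + (- (pi / 2)) \<in> range \<phi>"
      by (rule connectedD_interval[OF conn]) (auto simp: algebra_simps)
    then obtain t where "\<phi> t = pi * of_int (n + 1) + (- (pi / 2))" by (metis rangeE)
    thus ?thesis unfolding I_def by blast
  qed
  show ?thesis unfolding zeros_interlace_def
    by (intro exI[of _ I] exI[of _ J] exI[of _ a] exI[of _ b] conjI A B allI impI; (elim conjE)?)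
       (fact 1 2 3 4)+
qed

section \<open>The Hermite-Biehler theorem\<close>

text \<open>Together with \<open>odd_part\<close>, the functions A and B of an arbitrary
  \<open>E\<close>, with E = A - i B. The factors are such that both are fixed by
  \<open>conj_refl\<close>, hence real on the critical line.\<close>

definition even_part :: "(complex \<Rightarrow> complex) \<Rightarrow> complex \<Rightarrow> complex" where
  "even_part E s = 1 / 2 * (E s + conj_refl E s)"

definition odd_part :: "(complex \<Rightarrow> complex) \<Rightarrow> complex \<Rightarrow> complex" where
  "odd_part E s = - (1 / (2 * \<i>)) * (E s - conj_refl E s)"

text \<open>The phase is the imaginary part of a logarithm of \<open>E\<close> along the line,
  obtained by integrating the logarithmic derivative. The line runs in direction i, so the
  derivative Im (i E'/E) becomes Re (E'/E).\<close>

lemma phase_exists: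
  assumes holE: "E holomorphic_on UNIV" and nz: "\<And>t. E (Complex (1/2) t) \<noteq> 0"
  obtains \<phi> where "\<And>t. (\<phi> has_real_derivative
      Re (deriv E (Complex (1/2) t) / E (Complex (1/2) t))) (at t)"
    "\<And>t. E (Complex (1/2) t) = of_real (norm (E (Complex (1/2) t))) * cis (\<phi> t)"
proof -
  let ?r = "\<lambda>t. Complex (1/2) t"
  have dr: "(?r has_vector_derivative \<i>) (at t)" for t
  proof -
    have "?r = (\<lambda>t. 1/2 + of_real t * \<i>)" by (auto simp: complex_eq_iff fun_eq_iff)
    thus ?thesis by (auto intro!: derivative_eq_intros)
  qed
  have cr: "isCont ?r t" for t using dr has_vector_derivative_continuous by blast
  have dE: "((\<lambda>t. E (?r t)) has_vector_derivative \<i> * deriv E (?r t)) (at t)" for t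
    using field_vector_diff_chain_at[OF dr[of t] holomorphic_derivI[OF holE open_UNIV]]
    by (simp add: o_def)
  define q where "q = (\<lambda>t. \<i> * deriv E (?r t) / E (?r t))"
  have cont_q: "isCont q t" for t
  proof -
    have "isCont E (?r t)" "isCont (deriv E) (?r t)"
      using holE holomorphic_deriv[OF holE open_UNIV]
      by (meson UNIV_I holomorphic_on_imp_differentiable_at field_differentiable_imp_continuous_at open_UNIV)+
    hence "isCont (\<lambda>t. E (?r t)) t" "isCont (\<lambda>t. deriv E (?r t)) t"
      using cr[of t] isCont_o2 by blast+
    thus ?thesis unfolding q_def using nz[of t] by (intro continuous_intros) auto
  qed
  obtain F where "\<forall>t::real. - \<infinity> < ereal t \<longrightarrow> ereal t < \<infinity> \<longrightarrow> (F has_vector_derivative q t) (at t)"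
    using einterval_antiderivative[of "-\<infinity>" "\<infinity>" q] cont_q by auto
  hence F: "(F has_vector_derivative q t) (at t)" for t by auto
  have dexp: "((\<lambda>t. exp (- F t)) has_vector_derivative - q t * exp (- F t)) (at t)" for t
    using field_vector_diff_chain_at[OF has_vector_derivative_minus[OF F[of t]] DERIV_exp]
    by (simp add: o_def)
  have "((\<lambda>t. E (?r t) * exp (- F t)) has_vector_derivative 0) (at t within UNIV)" for t
    using has_vector_derivative_mult[OF dE dexp, of t] nz[of t] by (simp add: q_def)
  then obtain C where C: "\<And>t. E (?r t) * exp (- F t) = C"
    using has_vector_derivative_zero_constant[of UNIV "\<lambda>t. E (?r t) * exp (- F t)"] by auto
  have C0: "C \<noteq> 0" using C[of 0] nz[of 0] by auto
  then obtain c where c: "C = exp c" using exp_Ln by metis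
  have Eexp: "E (?r t) = exp (F t + c)" for t
    using C[of t] c by (simp add: exp_add exp_minus field_simps)
  define \<phi> where "\<phi> = (\<lambda>t. Im (F t + c))"
  have "((\<lambda>t. Im (F t)) has_vector_derivative Im (q t)) (at t)" for t
    by (rule bounded_linear.has_vector_derivative[OF bounded_linear_Im F])
  hence "(\<phi> has_real_derivative Im (q t)) (at t)" for t
    unfolding \<phi>_def by (auto simp: has_real_derivative_iff_has_vector_derivative intro!: derivative_eq_intros)
  moreover have "Im (q t) = Re (deriv E (?r t) / E (?r t))" for t
    by (simp add: q_def times_divide_eq_right[symmetric] del: times_divide_eq_right)
  moreover have "E (?r t) = of_real (norm (E (?r t))) * cis (\<phi> t)" for t
    unfolding Eexp \<phi>_def by (simp add: exp_eq_polar[of "F t + c"] exp_of_real norm_mult)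
  ultimately show ?thesis by (intro that[of \<phi>]) simp_all
qed

lemma has_field_derivative_conj_refl_line:
  assumes holE: "E holomorphic_on UNIV"
  shows "(conj_refl E has_field_derivative - cnj (deriv E (Complex (1/2) t))) (at (Complex (1/2) t))"
  by (rule has_field_derivative_conj_refl)
     (use conj_refl_line[of t] holomorphic_derivI[OF holE open_UNIV] in simp)

text \<open>On the line the even and odd part are the real part and minus the imaginary part of \<open>E\<close>, so their
  zeros are where the phase of \<open>E\<close> is an odd, respectively even, multiple of \<open>pi / 2\<close>.\<close>

lemma Hermite_Biehler_phase:
  assumes holE: "E holomorphic_on UNIV"
    and off: "\<And>s. Re s \<noteq> 1/2 \<Longrightarrow> norm (conj_refl E s) \<noteq> norm (E s)"
    and nz: "\<And>t. E (Complex (1/2) t) \<noteq> 0"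
    and c: "c = 1 \<or> c = -1"
    and pos: "\<And>t. c * Re (deriv E (Complex (1/2) t) / E (Complex (1/2) t)) > 0"
  shows "even_part E holomorphic_on UNIV" "odd_part E holomorphic_on UNIV"
    "zeros_on_critical_line (even_part E)" "zeros_on_critical_line (odd_part E)"
    "all_zeros_simple (even_part E)" "all_zeros_simple (odd_part E)"
    "zeros_interlace (even_part E) (odd_part E)"
proof -
  let ?r = "\<lambda>t. Complex (1/2) t"
  have holR: "conj_refl E holomorphic_on UNIV" by (rule holomorphic_conj_refl[OF holE]) auto
  show holA: "even_part E holomorphic_on UNIV" unfolding even_part_def[abs_def]
    using holE holR by (intro holomorphic_intros)
  show holB: "odd_part E holomorphic_on UNIV" unfolding odd_part_def[abs_def]
    using holE holR by (intro holomorphic_intros)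
  have eqA: "conj_refl E s = - E s" if "even_part E s = 0" for s
    using that unfolding even_part_def by (simp add: add_eq_0_iff)
  have eqB: "conj_refl E s = E s" if "odd_part E s = 0" for s
    using that unfolding odd_part_def by simp
  show lineA: "zeros_on_critical_line (even_part E)"
    unfolding zeros_on_critical_line_def using eqA off by (metis norm_minus_cancel)
  show lineB: "zeros_on_critical_line (odd_part E)"
    unfolding zeros_on_critical_line_def using eqB off by metis
  have line: "s = ?r (Im s)" if "Re s = 1/2" for s using that by (simp add: complex_eq_iff)
  have dE: "(E has_field_derivative deriv E s) (at s)" for s
    using holomorphic_derivI[OF holE open_UNIV] by simp
  \<comment> \<open>Twice the real part of E'/E. At a zero of the even or odd part the value of
    \<open>E\<close> is imaginary or real, and a vanishing derivative of that part would make this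
    sum vanish.\<close>
  have sum0: "deriv E (?r t) / E (?r t) + cnj (deriv E (?r t) / E (?r t)) \<noteq> 0" for t
  proof -
    have "Re (deriv E (?r t) / E (?r t)) \<noteq> 0" using pos[of t] by force
    thus ?thesis unfolding complex_add_cnj of_real_eq_0_iff by simp
  qed
  have cnjE: "conj_refl E (?r t) = cnj (E (?r t))" for t by (simp add: conj_refl_def conj_refl_line)
  show simpA: "all_zeros_simple (even_part E)"
    unfolding all_zeros_simple_def
  proof safe
    fix s assume s0: "even_part E s = 0"
    define t where "t = Im s"
    have st: "s = ?r t" using lineA s0 line by (simp add: zeros_on_critical_line_def t_def)
    have d: "(even_part E has_field_derivative
        1 / 2 * (deriv E (?r t) - cnj (deriv E (?r t)))) (at s)"
      unfolding even_part_def[abs_def] st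
      by (auto intro!: derivative_eq_intros dE has_field_derivative_conj_refl_line[OF holE])
    have e: "cnj (E (?r t)) = - E (?r t)" using eqA[OF s0] cnjE[of t] st by simp
    have "deriv E (?r t) - cnj (deriv E (?r t)) \<noteq> 0"
    proof
      assume "deriv E (?r t) - cnj (deriv E (?r t)) = 0"
      hence "deriv E (?r t) / E (?r t) + cnj (deriv E (?r t) / E (?r t)) = 0"
        using e by (simp add: field_simps)
      thus False using sum0 by blast
    qed
    thus "zorder (even_part E) s = 1" by (intro zorder_simple_zero[OF holA s0 d]) simp
  qed
  show simpB: "all_zeros_simple (odd_part E)"
    unfolding all_zeros_simple_def
  proof safe
    fix s assume s0: "odd_part E s = 0"
    define t where "t = Im s"
    have st: "s = ?r t" using lineB s0 line by (simp add: zeros_on_critical_line_def t_def)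
    have d: "(odd_part E has_field_derivative
        - (1 / (2 * \<i>)) * (deriv E (?r t) + cnj (deriv E (?r t)))) (at s)"
      unfolding odd_part_def[abs_def] st
      by (rule derivative_eq_intros dE has_field_derivative_conj_refl_line[OF holE] refl)+ simp
    have e: "cnj (E (?r t)) = E (?r t)" using eqB[OF s0] cnjE[of t] st by simp
    have "deriv E (?r t) + cnj (deriv E (?r t)) \<noteq> 0"
    proof
      assume "deriv E (?r t) + cnj (deriv E (?r t)) = 0"
      hence "deriv E (?r t) / E (?r t) + cnj (deriv E (?r t) / E (?r t)) = 0"
        using e by (simp add: add_divide_distrib[symmetric])
      thus False using sum0 by blast
    qed
    thus "zorder (odd_part E) s = 1" by (intro zorder_simple_zero[OF holB s0 d]) simp
  qed
  obtain \<phi> where \<phi>: "\<And>t. (\<phi> has_real_derivative Re (deriv E (?r t) / E (?r t))) (at t)"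
    and pol: "\<And>t. E (?r t) = of_real (norm (E (?r t))) * cis (\<phi> t)"
    using phase_exists[OF holE nz] by blast
  have A: "even_part E (?r t) = of_real (norm (E (?r t)) * cos (\<phi> t))" for t
    unfolding even_part_def cnjE by (subst (1 2) pol) (simp add: complex_eq_iff)
  have B: "odd_part E (?r t) = - of_real (norm (E (?r t)) * sin (\<phi> t))" for t
    unfolding odd_part_def cnjE by (subst (1 2) pol) (simp add: complex_eq_iff)
  \<comment> \<open>For c = -1 the phase decreases. Negating it keeps the cosine and only changes
    the sign of the sine, so the zeros are the same.\<close>
  define \<psi> where "\<psi> = (\<lambda>t. c * \<phi> t)"
  have d\<psi>: "(\<psi> has_real_derivative c * Re (deriv E (?r t) / E (?r t))) (at t)" for t
    unfolding \<psi>_def by (intro DERIV_cmult \<phi>)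
  have cs: "cos (\<psi> t) = cos (\<phi> t)" "sin (\<psi> t) = c * sin (\<phi> t)" for t
    using c by (auto simp: \<psi>_def)
  show "zeros_interlace (even_part E) (odd_part E)"
  proof (rule zeros_interlace_phase[where \<phi>=\<psi>])
    show "continuous_on UNIV \<psi>"
      using d\<psi> by (auto intro!: DERIV_continuous_on simp: has_field_derivative_at_within)
    show "strict_mono \<psi>"
    proof (rule strict_monoI)
      fix x y :: real assume "x < y"
      thus "\<psi> x < \<psi> y" by (rule DERIV_pos_imp_increasing) (use d\<psi> pos in blast)
    qed
  qed (use A B cs c nz simpA simpB in auto)
qed

lemma log_derivative_pos:
  assumes holE: "E holomorphic_on UNIV"
    and less: "\<And>s. Re s > 1/2 \<Longrightarrow> norm (conj_refl E s) < norm (E s)"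
    and nz: "\<And>t. E (Complex (1/2) t) \<noteq> 0"
  shows "Re (deriv E (Complex (1/2) t) / E (Complex (1/2) t)) > 0"
proof -
  let ?w = "Complex (1/2) t"
  define f where "f = (\<lambda>s. conj_refl E s / E s)"
  define L where "L = deriv E ?w / E ?w"
  have dE: "(E has_field_derivative deriv E s) (at s)" for s
    using holomorphic_derivI[OF holE open_UNIV] by simp
  have cnjE: "conj_refl E ?w = cnj (E ?w)" by (simp add: conj_refl_def conj_refl_line)
  have holR: "conj_refl E holomorphic_on UNIV" by (rule holomorphic_conj_refl[OF holE]) auto
  have fw: "norm (f ?w) = 1" using nz[of t] by (simp add: f_def norm_divide cnjE)
  \<comment> \<open>On the line the reflected function is the conjugate of \<open>E\<close>, so the
    logarithmic derivative of \<open>f\<close> is -(L + cnj L), a real number. Hopf's lemma then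
    reads off the sign of Re L.\<close>
  have der: "(f has_field_derivative - (f ?w * of_real (2 * Re L))) (at ?w)"
  proof -
    have "(f has_field_derivative
       (- cnj (deriv E ?w) * E ?w - conj_refl E ?w * deriv E ?w) / (E ?w * E ?w)) (at ?w)"
      unfolding f_def using nz[of t]
      by (intro derivative_intros dE has_field_derivative_conj_refl_line[OF holE]) auto
    also have "(- cnj (deriv E ?w) * E ?w - conj_refl E ?w * deriv E ?w) / (E ?w * E ?w) =
        - (f ?w * (L + cnj L))"
    proof -
      have *: "(- d * e - c * g) / (e * e) = - (c / e * (g / e + d / c))"
        if "c \<noteq> 0" "e \<noteq> 0" for c d e g :: complex
        using that by (simp add: field_simps)
      have "cnj L = cnj (deriv E ?w) / conj_refl E ?w" by (simp add: L_def cnjE)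
      moreover have "(- cnj (deriv E ?w) * E ?w - conj_refl E ?w * deriv E ?w) / (E ?w * E ?w) =
        - (conj_refl E ?w / E ?w * (deriv E ?w / E ?w + cnj (deriv E ?w) / conj_refl E ?w))"
        by (rule *) (use nz[of t] cnjE in simp_all)
      ultimately show ?thesis by (simp only: f_def L_def)
    qed
    finally show ?thesis by (simp add: complex_add_cnj)
  qed
  have ball: "Re z > 1/2" if "z \<in> ball (?w + of_real 1) 1" for z
  proof -
    have "\<bar>Re (?w + of_real 1 - z)\<bar> < 1"
      using that abs_Re_le_cmod[of "?w + of_real 1 - z"] by (simp add: dist_norm)
    thus ?thesis by simp
  qed
  have "Re (cnj (f ?w) * (- (f ?w * of_real (2 * Re L)))) < 0"
  proof (rule Hopf_vertical_line[OF der fw zero_less_one])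
    have "E z \<noteq> 0" if "z \<in> ball (?w + of_real 1) 1" for z
      using less[OF ball[OF that]] by auto
    thus "f holomorphic_on ball (?w + of_real 1) 1" unfolding f_def
      by (intro holomorphic_intros holomorphic_on_subset[OF holE] holomorphic_on_subset[OF holR]) auto
    show "norm (f z) < 1" if "z \<in> ball (?w + of_real 1) 1" for z
    proof -
      have "0 < norm (E z)" using less[OF ball[OF that]] norm_ge_zero order.strict_trans1 by blast
      thus ?thesis using less[OF ball[OF that]]
        by (simp only: f_def norm_divide divide_less_eq_1_pos)
    qed
  qed
  moreover have eq: "cnj (f ?w) * (- (f ?w * of_real (2 * Re L))) = - of_real (2 * Re L)"
  proof -
    have "cnj (f ?w) * f ?w = of_real ((norm (f ?w))\<^sup>2)"
      by (simp only: complex_norm_square mult.commute)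
    hence 1: "cnj (f ?w) * f ?w = 1" using fw by simp
    have "cnj (f ?w) * (- (f ?w * x)) = - ((cnj (f ?w) * f ?w) * x)" for x
      by (simp only: mult_minus_right mult.assoc)
    thus ?thesis by (simp only: 1 mult_1)
  qed
  ultimately have "Re (- complex_of_real (2 * Re L)) < 0" by (simp only: eq)
  hence "Re L > 0" by simp
  thus ?thesis unfolding L_def .
qed

theorem Hermite_Biehler:
  assumes holE: "E holomorphic_on UNIV" and nz: "\<And>t. E (Complex (1/2) t) \<noteq> 0"
    and less: "(\<forall>s. Re s > 1/2 \<longrightarrow> norm (conj_refl E s) < norm (E s)) \<or>
               (\<forall>s. Re s > 1/2 \<longrightarrow> norm (E s) < norm (conj_refl E s))"
  shows "even_part E holomorphic_on UNIV \<and> odd_part E holomorphic_on UNIV \<and>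
    zeros_on_critical_line (even_part E) \<and> zeros_on_critical_line (odd_part E) \<and>
    all_zeros_simple (even_part E) \<and> all_zeros_simple (odd_part E) \<and>
    zeros_interlace (even_part E) (odd_part E)"
proof -
  have off: "norm (conj_refl E s) \<noteq> norm (E s)" if s: "Re s \<noteq> 1/2" for s
  proof (cases "Re s > 1/2")
    case True thus ?thesis using less by force
  next
    case False
    \<comment> \<open>Left of the line: reflection exchanges the two moduli, so the inequality at
      the mirror point is the one wanted here.\<close>
    hence "Re (1 - cnj s) > 1/2" using s by simp
    hence "norm (conj_refl E (1 - cnj s)) \<noteq> norm (E (1 - cnj s))" using less by (metis less_irrefl)
    thus ?thesis by (simp add: conj_refl_def)
  qed
  from less show ?thesis
  proof
    assume "\<forall>s. Re s > 1/2 \<longrightarrow> norm (conj_refl E s) < norm (E s)"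
    hence "Re (deriv E (Complex (1/2) t) / E (Complex (1/2) t)) > 0" for t
      using log_derivative_pos[OF holE _ nz] by blast
    thus ?thesis using Hermite_Biehler_phase[OF holE off nz, of 1] by simp
  next
    assume l: "\<forall>s. Re s > 1/2 \<longrightarrow> norm (E s) < norm (conj_refl E s)"
    have "Re (deriv (conj_refl E) (Complex (1/2) t) / conj_refl E (Complex (1/2) t)) > 0" (is "Re (?q t) > 0") for t
      using l nz by (intro log_derivative_pos holomorphic_conj_refl[OF holE])
        (auto simp: conj_refl_def conj_refl_line)
    moreover
    \<comment> \<open>Reflection changes the sign of the real part of the logarithmic derivative on
      the line, so the phase of \<open>E\<close> itself decreases: the case c = -1.\<close>
    have "deriv (conj_refl E) (Complex (1/2) t) / conj_refl E (Complex (1/2) t) =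
        - cnj (deriv E (Complex (1/2) t) / E (Complex (1/2) t))" for t
      using DERIV_imp_deriv[OF has_field_derivative_conj_refl_line[OF holE, of t]]
      by (simp add: conj_refl_def conj_refl_line)
    hence "Re (?q t) = - Re (deriv E (Complex (1/2) t) / E (Complex (1/2) t))" for t
      by (simp only: uminus_complex.simps cnj.simps)
    ultimately have "Re (deriv E (Complex (1/2) t) / E (Complex (1/2) t)) < 0" for t
      by (metis neg_0_less_iff_less)
    thus ?thesis using Hermite_Biehler_phase[OF holE off nz, of "-1"] by simp
  qed
qed

section \<open>Dirichlet series with bounded coefficient sums\<close>

lemma sum_by_parts:
  fixes a :: "nat \<Rightarrow> 'a::comm_ring" and b :: "nat \<Rightarrow> 'a"
  shows "(\<Sum>k<n. a k * b k) = (\<Sum>k<n. a k) * b n + (\<Sum>k<n. (\<Sum>j<Suc k. a j) * (b k - b (Suc k)))"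
proof (induction n)
  case (Suc n)
  define T where "T = (\<Sum>k<n. a k)"
  show ?case unfolding sum.lessThan_Suc Suc.IH T_def[symmetric] by (simp only: distrib_left distrib_right right_diff_distrib) simp
qed simp

lemma norm_sum_by_parts_le:
  fixes a :: "nat \<Rightarrow> complex" and b :: "nat \<Rightarrow> complex"
  assumes C: "\<And>n. norm (\<Sum>k<n. a k) \<le> C"
  shows "norm (\<Sum>k<n. a k * b k) \<le> C * (norm (b n) + (\<Sum>k<n. norm (b k - b (Suc k))))"
proof -
  have "norm (\<Sum>k<n. a k * b k) \<le> norm ((\<Sum>k<n. a k) * b n) +
      (\<Sum>k<n. norm ((\<Sum>j<Suc k. a j) * (b k - b (Suc k))))"
    by (subst sum_by_parts) (intro order.trans[OF norm_triangle_ineq] add_mono order.refl norm_sum)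
  also have "\<dots> \<le> C * norm (b n) + (\<Sum>k<n. C * norm (b k - b (Suc k)))"
    using C[of n] C by (intro add_mono sum_mono)
      (auto simp: norm_mult simp del: sum.lessThan_Suc intro!: mult_right_mono)
  finally show ?thesis by (simp add: sum_distrib_left distrib_left)
qed

text \<open>For a decreasing nonnegative weight the total variation telescopes, which leaves
  \<open>b 0\<close> alone, uniformly in n. This uniformity gives the dominating function for the
  Gamma integral and the constant in Monsky's argument.\<close>

lemma norm_sum_decreasing_le:
  fixes a :: "nat \<Rightarrow> complex" and b :: "nat \<Rightarrow> real"
  assumes C: "\<And>n. norm (\<Sum>k<n. a k) \<le> C"
    and dec: "\<And>k. b (Suc k) \<le> b k" and nonneg: "\<And>k. b k \<ge> 0"
  shows "norm (\<Sum>k<n. a k * of_real (b k)) \<le> C * b 0"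
proof -
  have "(\<Sum>k<n. norm (complex_of_real (b k) - of_real (b (Suc k)))) = (\<Sum>k<n. b k - b (Suc k))"
    using dec by (intro sum.cong refl) (simp flip: of_real_diff)
  also have "\<dots> = b 0 - b n" by (induction n) auto
  finally have "norm (complex_of_real (b n)) +
      (\<Sum>k<n. norm (complex_of_real (b k) - of_real (b (Suc k)))) = b 0"
    using nonneg by simp
  with norm_sum_by_parts_le[OF C, of "\<lambda>k. of_real (b k)" n] show ?thesis by simp
qed

section \<open>Periodic coefficients and the series they define\<close>

text \<open>Formulated for sequences instead of characters because it is also applied to the
  principal character minus its mean value.\<close>

definition zero_sum_periodic :: "nat \<Rightarrow> (nat \<Rightarrow> complex) \<Rightarrow> bool" where
  "zero_sum_periodic N a \<longleftrightarrow> N > 0 \<and> (\<forall>n. a (n + N) = a n) \<and> (\<Sum>n<N. a n) = 0"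

lemma periodic_mod:
  fixes a :: "nat \<Rightarrow> complex"
  assumes "N > 0" "\<And>n. a (n + N) = a n"
  shows "a n = a (n mod N)"
proof -
  have "a (m + q * N) = a m" for m q
  proof (induction q)
    case (Suc q)
    have "a (m + Suc q * N) = a ((m + q * N) + N)" by (simp add: algebra_simps)
    thus ?case using Suc assms(2) by simp
  qed simp
  from this[of "n mod N" "n div N"] show ?thesis by (simp add: mult.commute)
qed

lemma zero_sum_periodic_sum_bounded:
  assumes "zero_sum_periodic N a"
  obtains C where "\<And>n. norm (\<Sum>k<n. a k) \<le> C" "C > 0"
proof -
  have N: "N > 0" and per: "\<And>n. a (n + N) = a n" and z: "(\<Sum>n<N. a n) = 0"
    using assms by (auto simp: zero_sum_periodic_def)
  have "(\<Sum>k<n + N. a k) = (\<Sum>k<n. a k)" for n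
    by (induction n) (use z per in simp_all)
  hence eq: "(\<Sum>k<n. a k) = (\<Sum>k<n mod N. a k)" for n
    using periodic_mod[of N "\<lambda>n. \<Sum>k<n. a k" n] N by simp
  define C where "C = 1 + (\<Sum>k<N. norm (a k))"
  show ?thesis
  proof
    show "C > 0" unfolding C_def by (intro add_pos_nonneg sum_nonneg) auto
    fix n
    have "norm (\<Sum>k<n mod N. a k) \<le> (\<Sum>k<n mod N. norm (a k))" by (rule norm_sum)
    also have "\<dots> \<le> (\<Sum>k<N. norm (a k))"
      using N by (intro sum_mono2) (auto intro: less_trans[OF _ mod_less_divisor])
    finally show "norm (\<Sum>k<n. a k) \<le> C" unfolding eq[of n] C_def by simp
  qed
qed

lemma summable_powr_Suc:
  assumes "x < - 1"
  shows "summable (\<lambda>n. real (Suc n) powr x)"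
  using assms by (subst summable_Suc_iff) (simp add: summable_real_powr_iff)

text \<open>Dirichlet series are indexed from 0: the coefficient of \<open>(n + 1) powr (- s)\<close> is \<open>a (Suc n)\<close>.\<close>

definition dterm :: "complex \<Rightarrow> nat \<Rightarrow> complex" where
  "dterm s n = of_nat (Suc n) powr (- s)"

lemma norm_dterm: "norm (dterm s n) = real (Suc n) powr (- Re s)"
proof -
  have "norm (complex_of_real (real (Suc n)) powr (- s)) = real (Suc n) powr Re (- s)"
    by (subst norm_powr_real_powr) auto
  thus ?thesis by (simp add: dterm_def)
qed

lemma cpow_diff_bound:
  assumes s: "Re s > 0" and x: "0 < x" "x \<le> y"
  shows "norm (complex_of_real x powr (- s) - of_real y powr (- s)) \<le> norm s * x powr (- Re s - 1) * (y - x)"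
proof -
  have "norm (complex_of_real x powr (- s) - of_real y powr (- s)) \<le>
     (norm s * x powr (- Re s - 1)) * norm (complex_of_real x - of_real y)"
  proof (rule field_differentiable_bound[where S="closed_segment (of_real x) (of_real y)"
        and f="\<lambda>z. z powr (- s)" and f'="\<lambda>z. - s * z powr (- s - 1)"])
    fix z :: complex assume "z \<in> closed_segment (of_real x) (of_real y)"
    then obtain v where v: "z = of_real v" "x \<le> v" "v \<le> y"
      using x by (auto simp: closed_segment_of_real closed_segment_eq_real_ivl)
    have pos: "v > 0" using v x by simp
    show "((\<lambda>z. z powr (- s)) has_field_derivative (- s) * z powr (- s - 1))
        (at z within closed_segment (of_real x) (of_real y))"
      using pos v by (intro has_field_derivative_at_within[OF has_field_derivative_powr])
        (auto simp: complex_nonpos_Reals_iff)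
    have "norm (z powr (- s - 1)) = v powr (- Re s - 1)"
      unfolding v(1) using pos by (subst norm_powr_real_powr) auto
    also have "\<dots> \<le> x powr (- Re s - 1)" using v x s by (intro powr_mono2') auto
    finally show "norm ((- s) * z powr (- s - 1)) \<le> norm s * x powr (- Re s - 1)"
      by (simp add: norm_mult mult_left_mono)
  qed auto
  also have "norm (complex_of_real x - of_real y) = y - x"
    using x by (simp flip: of_real_diff)
  finally show ?thesis .
qed

lemma dterm_diff_bound:
  assumes s: "Re s > 0"
  shows "norm (dterm s n - dterm s (Suc n)) \<le> norm s * real (Suc n) powr (- Re s - 1)"
  using cpow_diff_bound[OF s, of "real (Suc n)" "real (Suc (Suc n))"] by (simp add: dterm_def)

definition dseries :: "(nat \<Rightarrow> complex) \<Rightarrow> complex \<Rightarrow> complex" where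
  "dseries a s = (\<Sum>n. a (Suc n) * dterm s n)"

lemma dterm_holomorphic [holomorphic_intros]: "(\<lambda>s. dterm s n) holomorphic_on A"
  unfolding dterm_def by (intro holomorphic_intros) (auto simp flip: of_nat_Suc)

lemma dterm_tendsto_0: "Re s > 0 \<Longrightarrow> dterm s \<longlonglongrightarrow> 0"
proof -
  assume s: "Re s > 0"
  have "((\<lambda>x. x powr (- Re s)) \<longlongrightarrow> 0) at_top" using s by (intro tendsto_neg_powr filterlim_ident) auto
  hence "(\<lambda>n. real (Suc n) powr (- Re s)) \<longlonglongrightarrow> 0"
    by (rule filterlim_compose) (intro filterlim_compose[OF filterlim_real_sequentially] filterlim_Suc)
  thus ?thesis by (subst tendsto_norm_zero_iff[symmetric]) (simp add: norm_dterm)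
qed

text \<open>Summation by parts replaces a series that may converge only conditionally by one whose
  terms are of size |s| n^(-Re s - 1). The factor |s| is the source of the linear growth of L in
  vertical strips.\<close>

lemma dseries_by_parts:
  assumes C: "\<And>n. norm (\<Sum>k<n. a (Suc k)) \<le> C" and s: "Re s > 0"
  shows "summable (\<lambda>n. (\<Sum>j<Suc n. a (Suc j)) * (dterm s n - dterm s (Suc n)))"
    and "(\<lambda>n. a (Suc n) * dterm s n) sums (\<Sum>n. (\<Sum>j<Suc n. a (Suc j)) * (dterm s n - dterm s (Suc n)))"
    and "norm (dseries a s) \<le> C * norm s * (\<Sum>n. real (Suc n) powr (- Re s - 1))"
proof -
  have C0: "C \<ge> 0" using C[of 0] by simp
  have summ: "summable (\<lambda>n. real (Suc n) powr (- Re s - 1))"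
    using s by (subst summable_Suc_iff) (simp add: summable_real_powr_iff)
  hence summ': "summable (\<lambda>n. C * norm s * real (Suc n) powr (- Re s - 1))" by (rule summable_mult)
  have bound: "norm ((\<Sum>j<Suc n. a (Suc j)) * (dterm s n - dterm s (Suc n))) \<le>
      C * norm s * real (Suc n) powr (- Re s - 1)" for n
    unfolding norm_mult mult.assoc
    using C[of "Suc n"] dterm_diff_bound[OF s, of n] C0
    by (intro mult_mono) (auto simp del: sum.lessThan_Suc)
  show 1: "summable (\<lambda>n. (\<Sum>j<Suc n. a (Suc j)) * (dterm s n - dterm s (Suc n)))"
    by (rule summable_comparison_test'[OF summ' bound])
  have "(\<lambda>n. (\<Sum>k<n. a (Suc k)) * dterm s n) \<longlonglongrightarrow> 0"
  proof (rule Lim_null_comparison)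
    show "\<forall>\<^sub>F n in sequentially. norm ((\<Sum>k<n. a (Suc k)) * dterm s n) \<le> C * norm (dterm s n)"
      using C by (auto simp: norm_mult intro!: always_eventually mult_right_mono)
    show "(\<lambda>n. C * norm (dterm s n)) \<longlonglongrightarrow> 0"
      using tendsto_mult_right_zero[OF tendsto_norm_zero[OF dterm_tendsto_0[OF s]]] .
  qed
  from tendsto_add[OF this summable_LIMSEQ[OF 1]]
  show 2: "(\<lambda>n. a (Suc n) * dterm s n) sums (\<Sum>n. (\<Sum>j<Suc n. a (Suc j)) * (dterm s n - dterm s (Suc n)))"
    unfolding sums_def sum_by_parts[of "\<lambda>n. a (Suc n)"] by simp
  show "norm (dseries a s) \<le> C * norm s * (\<Sum>n. real (Suc n) powr (- Re s - 1))"
    unfolding dseries_def sums_unique[OF 2, symmetric] suminf_mult[OF summ, symmetric]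
    by (rule norm_suminf_le[OF bound summ'])
qed

text \<open>Uniform convergence is tested on the series obtained by parts, since the original one
  need not converge absolutely for Re s \<le> 1.\<close>

lemma dseries_holomorphic:
  assumes C: "\<And>n. norm (\<Sum>k<n. a (Suc k)) \<le> C"
  shows "dseries a holomorphic_on {s. Re s > 0}"
proof (rule holomorphic_uniform_sequence)
  show "open {s. Re s > 0}" by (rule open_halfspace_Re_gt)
  define u where "u = (\<lambda>n s. (\<Sum>j<Suc n. a (Suc j)) * (dterm s n - dterm s (Suc n)))"
  show "(\<lambda>s. \<Sum>n<m. u n s) holomorphic_on {s. Re s > 0}" for m
    unfolding u_def by (intro holomorphic_intros)
  have C0: "C \<ge> 0" using C[of 0] by simp
  fix s assume s: "s \<in> {s. Re s > 0}"
  define d where "d = Re s / 2"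
  have d: "d > 0" using s by (simp add: d_def)
  have sub: "d \<le> Re z" "norm z \<le> norm s + d" if "z \<in> cball s d" for z
  proof -
    have "norm (s - z) \<le> d" using that by (simp add: dist_norm)
    thus "d \<le> Re z" "norm z \<le> norm s + d"
      using abs_Re_le_cmod[of "s - z"] norm_triangle_ineq2[of z s]
      by (auto simp: d_def norm_minus_commute)
  qed
  have "uniform_limit (cball s d) (\<lambda>m z. \<Sum>n<m. u n z) (\<lambda>z. \<Sum>n. u n z) sequentially"
  proof (rule Weierstrass_m_test)
    show "summable (\<lambda>n. C * ((norm s + d) * real (Suc n) powr (- d - 1)))"
      using d by (intro summable_mult, subst summable_Suc_iff) (simp add: summable_real_powr_iff)
    fix n z assume z: "z \<in> cball s d"
    have Rz: "Re z > 0" using sub(1)[OF z] d by simp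
    have "norm (dterm z n - dterm z (Suc n)) \<le> norm z * real (Suc n) powr (- Re z - 1)"
      by (rule dterm_diff_bound[OF Rz])
    also have "\<dots> \<le> (norm s + d) * real (Suc n) powr (- d - 1)"
      using sub[OF z] d by (intro mult_mono powr_mono) auto
    finally show "norm (u n z) \<le> C * ((norm s + d) * real (Suc n) powr (- d - 1))"
      unfolding u_def norm_mult using C[of "Suc n"] C0
      by (intro mult_mono) (auto simp del: sum.lessThan_Suc)
  qed
  moreover have "(\<Sum>n. u n z) = dseries a z" if "z \<in> cball s d" for z
    using dseries_by_parts(2)[OF C, of z] sub(1)[OF that] d
    by (simp add: u_def dseries_def sums_iff)
  ultimately have "uniform_limit (cball s d) (\<lambda>m z. \<Sum>n<m. u n z) (dseries a) sequentially"
    by (simp add: uniform_limit_iff)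
  moreover have "cball s d \<subseteq> {s. Re s > 0}" using sub(1) d by force
  ultimately show "\<exists>d. 0 < d \<and> cball s d \<subseteq> {s. Re s > 0} \<and>
      uniform_limit (cball s d) (\<lambda>m z. \<Sum>n<m. u n z) (dseries a) sequentially"
    using d by blast
qed

lemma zero_sum_periodic_Suc_bounded:
  assumes "zero_sum_periodic N a"
  obtains C where "\<And>n. norm (\<Sum>k<n. a (Suc k)) \<le> C" "C > 0"
proof -
  obtain C where C: "\<And>n. norm (\<Sum>k<n. a k) \<le> C" "C > 0"
    using zero_sum_periodic_sum_bounded[OF assms] by blast
  have eq: "(\<Sum>k<n. a (Suc k)) = (\<Sum>k<Suc n. a k) - a 0" for n
    by (simp only: sum.lessThan_Suc_shift) simp
  have "norm (\<Sum>k<n. a (Suc k)) \<le> C + norm (a 0)" for n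
    unfolding eq using C(1)[of "Suc n"] norm_triangle_ineq4[of "\<Sum>k<Suc n. a k" "a 0"] by linarith
  thus ?thesis using that C(2) by (metis add_pos_nonneg norm_ge_zero)
qed

text \<open>Comparison of \<open>(1 - s) n powr (- s)\<close> with the increments of \<open>n powr (1 - s)\<close>.\<close>

lemma zeta_bound:
  assumes s: "Re s > 1"
  shows "summable (\<lambda>n. norm (dterm s n))"
    and "norm (\<Sum>n. dterm s n) \<le> 1 / norm (s - 1) + norm s * (\<Sum>n. real (Suc n) powr (- 2))"
proof -
  define T where "T = (\<lambda>n. complex_of_real (real (Suc n)) powr (1 - s))"
  show summ: "summable (\<lambda>n. norm (dterm s n))"
    unfolding norm_dterm using s by (subst summable_Suc_iff) (simp add: summable_real_powr_iff)
  have summ2: "summable (\<lambda>n. real (Suc n) powr (- 2))"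
    by (subst summable_Suc_iff) (simp add: summable_real_powr_iff)
  have s1: "s \<noteq> 1" using s by auto
  define e where "e = (\<lambda>n. T (Suc n) - T n - (1 - s) * dterm s n)"
  have e: "norm (e n) \<le> norm (1 - s) * norm s * real (Suc n) powr (- 2)" for n
  proof -
    define x where "x = real (Suc n)"
    have x: "x \<ge> 1" by (simp add: x_def)
    \<comment> \<open>Subtracting the linear term makes the derivative (1 - s) (z^(-s) - x^(-s)),
      which is O(x^(-2)) on [x, x + 1] because Re s > 1. The increment of \<open>g\<close> over that
      interval is \<open>e n\<close>.\<close>
    define g where "g = (\<lambda>z. z powr (1 - s) - (1 - s) * dterm s n * z)"
    have "norm (g (of_real (x + 1)) - g (of_real x)) \<le>
       (norm (1 - s) * norm s * x powr (- 2)) * norm (complex_of_real (x + 1) - of_real x)"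
    proof (rule field_differentiable_bound[where S="closed_segment (of_real x) (of_real (x + 1))"
          and f'="\<lambda>z. (1 - s) * (z powr (- s) - dterm s n)"])
      fix z :: complex assume "z \<in> closed_segment (of_real x) (of_real (x + 1))"
      hence "z \<in> of_real ` closed_segment x (x + 1)" by (simp only: closed_segment_of_real)
      then obtain v where v: "z = of_real v" "x \<le> v" "v \<le> x + 1"
        by (auto simp: closed_segment_eq_real_ivl)
      show "(g has_field_derivative (1 - s) * (z powr (- s) - dterm s n))
        (at z within closed_segment (of_real x) (of_real (x + 1)))"
        unfolding g_def using v x
        by (auto intro!: derivative_eq_intros simp: complex_nonpos_Reals_iff right_diff_distrib)
      have "norm (of_real x powr (- s) - z powr (- s)) \<le> norm s * x powr (- Re s - 1) * (v - x)"
        unfolding v(1) using s x v by (intro cpow_diff_bound) auto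
      also have "\<dots> \<le> norm s * x powr (- 2) * 1"
        using s x v by (intro mult_mono powr_mono) auto
      finally have "norm (z powr (- s) - dterm s n) \<le> norm s * x powr (- 2)"
        by (simp add: dterm_def x_def norm_minus_commute)
      thus "norm ((1 - s) * (z powr (- s) - dterm s n)) \<le> norm (1 - s) * norm s * x powr (- 2)"
        unfolding norm_mult mult.assoc by (rule mult_left_mono) simp
    qed auto
    moreover have "g (of_real (x + 1)) - g (of_real x) = e n"
      by (simp add: g_def e_def T_def x_def algebra_simps)
    ultimately show ?thesis by (simp add: x_def)
  qed
  have Tlim: "T \<longlonglongrightarrow> 0"
    using dterm_tendsto_0[of "s - 1"] s by (simp add: dterm_def[abs_def] T_def)
  have se: "summable e"
    by (rule summable_comparison_test'[OF summable_mult[OF summ2] e])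
  have sT: "(\<lambda>n. T (Suc n) - T n) sums (0 - T 0)" by (rule telescope_sums[OF Tlim])
  have "(\<lambda>n. T (Suc n) - T n) sums (suminf e + (1 - s) * (\<Sum>n. dterm s n))"
    using sums_add[OF summable_sums[OF se] sums_mult[OF summable_sums[OF summable_norm_cancel[OF summ]], of "1 - s"]]
    by (simp add: e_def)
  with sT have "suminf e + (1 - s) * (\<Sum>n. dterm s n) = - 1"
    using sums_unique2 by (fastforce simp: T_def)
  hence eq: "(1 - s) * (\<Sum>n. dterm s n) = - 1 - suminf e" by (simp add: algebra_simps)
  have "norm (suminf e) \<le> norm (1 - s) * norm s * (\<Sum>n. real (Suc n) powr (- 2))"
    unfolding suminf_mult[OF summ2, symmetric] by (rule norm_suminf_le[OF e summable_mult[OF summ2]])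
  moreover have "norm (1 - s) * norm (\<Sum>n. dterm s n) \<le> 1 + norm (suminf e)"
    unfolding norm_mult[symmetric] eq using norm_triangle_ineq4[of "-1" "suminf e"] by simp
  ultimately have "norm (1 - s) * norm (\<Sum>n. dterm s n) \<le>
      1 + norm (1 - s) * (norm s * (\<Sum>n. real (Suc n) powr (- 2)))"
    by (simp add: mult.assoc)
  also have "\<dots> = norm (1 - s) * (1 / norm (1 - s) + norm s * (\<Sum>n. real (Suc n) powr (- 2)))"
    using s1 by (simp add: distrib_left)
  finally show "norm (\<Sum>n. dterm s n) \<le> 1 / norm (s - 1) + norm s * (\<Sum>n. real (Suc n) powr (- 2))"
    using s1 by (subst (asm) mult_le_cancel_left_pos) (auto simp: norm_minus_commute)
qed

section \<open>Dirichlet characters and Gauss sums\<close>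

locale dchar =
  fixes N :: nat and chi :: "int \<Rightarrow> complex"
  assumes char: "dirichlet_character N chi"
begin

lemma N_pos: "N > 0" and chi_mult: "chi (m * n) = chi m * chi n"
  and chi_add: "chi (m + int N) = chi m" and chi_nz: "chi m \<noteq> 0 \<longleftrightarrow> coprime m (int N)"
  using char by (auto simp: dirichlet_character_def)

lemma chi_add_mult: "chi (m + k * int N) = chi m"
proof -
  have *: "chi (m + int k * int N) = chi m" for m k
  proof (induction k)
    case (Suc k)
    have "m + int (Suc k) * int N = (m + int k * int N) + int N" by (simp add: algebra_simps)
    thus ?case using Suc chi_add by metis
  qed simp
  show ?thesis
  proof (cases "k \<ge> 0")
    case True
    thus ?thesis using *[of m "nat k"] by simp
  next
    case False
    thus ?thesis using *[of "m + k * int N" "nat (- k)"] by simp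
  qed
qed

lemma chi_cong: "[m = n] (mod int N) \<Longrightarrow> chi m = chi n"
  by (metis chi_add_mult cong_iff_lin mult.commute)

lemma chi_mod: "chi (m mod int N) = chi m"
  by (rule chi_cong) simp

lemma chi_1: "chi 1 = 1"
  using chi_mult[of 1 1] chi_nz[of 1] by simp

lemma chi_power: "chi (m ^ k) = chi m ^ k"
  by (induction k) (simp_all add: chi_1 chi_mult)

lemma norm_chi: "norm (chi m) = (if coprime m (int N) then 1 else 0)"
proof (cases "coprime m (int N)")
  case True
  have "coprime (m mod int N) (int N)" using True N_pos by simp
  moreover have nn: "m mod int N = int (nat (m mod int N))" using N_pos by simp
  ultimately have "coprime (nat (m mod int N)) N" by (metis coprime_int_iff)
  hence "[nat (m mod int N) ^ totient N = 1] (mod N)" by (rule euler_theorem)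
  hence "[int (nat (m mod int N)) ^ totient N = 1] (mod int N)"
    by (metis cong_int_iff of_nat_1 of_nat_power)
  hence "chi (m mod int N) ^ totient N = 1" using chi_cong chi_power chi_1 nn by metis
  hence "norm (chi m) ^ totient N = 1 ^ totient N" unfolding chi_mod by (metis norm_one norm_power power_one)
  hence "norm (chi m) = 1" using N_pos by (subst (asm) power_eq_iff_eq_base) auto
  thus ?thesis using True by simp
next
  case False
  thus ?thesis using chi_nz by auto
qed

lemma norm_chi_le: "norm (chi m) \<le> 1"
  by (simp add: norm_chi)

lemma chi_cnj: "coprime m (int N) \<Longrightarrow> chi m * cnj (chi m) = 1"
  using norm_chi[of m] complex_norm_square[of "chi m"] by simp

lemma dchar_square: "dchar N (\<lambda>m. chi m ^ 2)"
  using char by (auto simp: dchar_def dirichlet_character_def power_mult_distrib)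

lemma parity_cases: "chi (-1) = 1 \<or> chi (-1) = -1"
proof -
  have "chi (-1) ^ 2 = 1" using chi_mult[of "-1" "-1"] chi_1 by (simp add: power2_eq_square)
  thus ?thesis by (simp add: power2_eq_1_iff)
qed

lemma chi_minus: "chi (- m) = chi (-1) * chi m"
  using chi_mult[of "-1" m] by simp

lemma sum_residues_mult:
  fixes g :: "int \<Rightarrow> complex"
  assumes m: "coprime m (int N)" and g: "\<And>x. g (x mod int N) = g x"
  shows "(\<Sum>x\<in>{0..<int N}. g (m * x)) = (\<Sum>x\<in>{0..<int N}. g x)"
proof -
  define f where "f = (\<lambda>x. (m * x) mod int N)"
  have inj: "inj_on f {0..<int N}"
  proof
    fix x y assume xy: "x \<in> {0..<int N}" "y \<in> {0..<int N}" "f x = f y"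
    hence "[m * x = m * y] (mod int N)" by (simp add: f_def cong_def)
    hence "[x = y] (mod int N)" using m by (metis cong_mult_lcancel coprime_commute)
    thus "x = y" using xy by (simp add: cong_def)
  qed
  have "f ` {0..<int N} \<subseteq> {0..<int N}" using N_pos by (auto simp: f_def)
  hence im: "f ` {0..<int N} = {0..<int N}" using inj by (intro endo_inj_surj) auto
  have "(\<Sum>x\<in>{0..<int N}. g x) = (\<Sum>x\<in>f ` {0..<int N}. g x)" by (simp only: im)
  also have "\<dots> = (\<Sum>x\<in>{0..<int N}. g (f x))" using inj by (subst sum.reindex) auto
  finally show ?thesis by (simp add: f_def g)
qed

lemma sum_int_lessThan: "(\<Sum>x\<in>{0..<int n}. g x) = (\<Sum>k<n. g (int k))" for g :: "int \<Rightarrow> complex"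
  by (rule sum.reindex_bij_witness[of _ int nat]) auto

lemma zero_sum_nonprincipal:
  assumes "chi \<noteq> principal_character N"
  shows "zero_sum_periodic N (\<lambda>n. chi (int n))"
proof -
  have "\<exists>m. coprime m (int N) \<and> chi m \<noteq> 1"
  proof (rule ccontr)
    assume "\<not> ?thesis"
    hence "chi m = principal_character N m" for m
      using chi_nz[of m] by (auto simp: principal_character_def)
    thus False using assms by auto
  qed
  then obtain m where m: "coprime m (int N)" "chi m \<noteq> 1" by blast
  have "(\<Sum>x\<in>{0..<int N}. chi (m * x)) = (\<Sum>x\<in>{0..<int N}. chi x)"
    by (rule sum_residues_mult[where g=chi, OF m(1) chi_mod])
  hence "(chi m - 1) * (\<Sum>x\<in>{0..<int N}. chi x) = 0"
    by (simp add: chi_mult sum_distrib_left[symmetric] left_diff_distrib)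
  hence "(\<Sum>x\<in>{0..<int N}. chi x) = 0" using m(2) by simp
  thus ?thesis using N_pos chi_add by (simp add: zero_sum_periodic_def sum_int_lessThan)
qed

lemma nonprincipal_N: 
  assumes "chi \<noteq> principal_character N"
  shows "N > 1"
proof (rule ccontr)
  assume "\<not> N > 1"
  hence "N = 1" using N_pos by simp
  moreover have "(\<Sum>n<N. chi (int n)) = 0"
    using zero_sum_nonprincipal[OF assms] by (simp add: zero_sum_periodic_def)
  ultimately show False using chi_nz[of 0] by simp
qed

end

section \<open>Primitivity and Gauss sums\<close>

text \<open>The witness is a + k d, where k is the product of the primes dividing \<open>n\<close>
  but not \<open>a\<close>: every prime factor of \<open>n\<close> then divides exactly one of a and
  k d. This lifts units mod d to units of a larger modulus.\<close>

lemma coprime_lift: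
  fixes a d n :: int
  assumes "coprime a d" "n \<noteq> 0"
  obtains x where "[x = a] (mod d)" "coprime x n"
proof -
  define P where "P = {p. prime p \<and> p dvd n \<and> \<not> p dvd a}"
  have finP: "finite P"
    by (rule finite_subset[OF _ finite_divisors_int[OF assms(2)]]) (auto simp: P_def)
  define k where "k = \<Prod>P"
  have "coprime (a + k * d) n"
  proof (rule ccontr)
    assume "\<not> coprime (a + k * d) n"
    hence "\<not> is_unit (gcd (a + k * d) n)" "gcd (a + k * d) n \<noteq> 0"
      using assms(2) coprime_iff_gcd_eq_1[of "a + k * d" n] by auto
    then obtain p where "prime p" "p dvd gcd (a + k * d) n"
      using prime_divisor_exists by blast
    hence p: "prime p" "p dvd a + k * d" "p dvd n" by auto
    show False
    proof (cases "p dvd a")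
      case True
      hence "p dvd k * d" using p(2) dvd_add_right_iff[of p a "k * d"] by blast
      moreover have "\<not> p dvd d" using True assms(1) p(1) coprime_common_divisor[of a d p] not_prime_unit by blast
      ultimately have "p dvd k" using p(1) by (simp add: prime_dvd_mult_iff)
      then obtain q where "q \<in> P" "p dvd q" using prime_dvd_prod_iff[OF finP p(1), of "\<lambda>x. x"] unfolding k_def by blast
      hence "p = q" using p(1) primes_dvd_imp_eq[of p q] unfolding P_def by blast
      thus False using True \<open>q \<in> P\<close> by (simp add: P_def)
    next
      case False
      hence "p \<in> P" using p by (simp add: P_def)
      hence "p dvd k" unfolding k_def using dvd_prodI[OF finP, of p "\<lambda>x. x"] by simp
      thus False using p(2) False dvd_add_left_iff[of p "k * d" a] dvd_mult2[of p k d] by blast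
    qed
  qed
  moreover have "[a + k * d = a] (mod d)" by (simp add: cong_def)
  ultimately show ?thesis using that by blast
qed

context dchar
begin

text \<open>If chi were 1 on all units congruent to 1 mod d, its value at a unit would depend only
  on the residue mod d, and lifting units from d to N would give a character inducing chi. That
  contradicts the minimality of the conductor.\<close>

lemma not_induced_imp:
  assumes prim: "primitive_dirichlet_character N chi" and d: "d dvd N" "d < N"
  obtains m where "[m = 1] (mod int d)" "coprime m (int N)" "chi m \<noteq> 1"
proof -
  have "\<not> induced_from N chi d"
    using prim d(2) not_less_Least[of d "induced_from N chi"]
    by (auto simp: primitive_dirichlet_character_def conductor_def)
  moreover have "induced_from N chi d" if triv: "\<And>m. [m = 1] (mod int d) \<Longrightarrow> coprime m (int N) \<Longrightarrow> chi m = 1"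
  proof -
    have d0: "d > 0" using d N_pos by (auto intro: Nat.gr0I)
    have eqchi: "chi x = chi y" if xy: "[x = y] (mod int d)" "coprime x (int N)" "coprime y (int N)" for x y
    proof -
      obtain z where z: "[y * z = 1] (mod int N)" using xy(3) cong_solve_coprime_int by blast
      have zN: "coprime z (int N)" using z
        by (metis cong_imp_coprime cong_sym coprime_1_left coprime_mult_left_iff)
      have zd: "[y * z = 1] (mod int d)" using z d(1) by (meson cong_dvd_modulus int_dvd_int_iff)
      have "[x * z = 1] (mod int d)" using cong_trans[OF cong_scalar_right[OF xy(1)] zd] .
      hence "chi (x * z) = 1" using triv zN xy(2) by simp
      moreover have "chi (y * z) = 1" using triv zd zN xy(3) by simp
      ultimately have "chi x * chi z = chi y * chi z" by (simp add: chi_mult)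
      thus ?thesis using chi_nz[of z] zN by simp
    qed
    \<comment> \<open>A chosen lift of a unit mod d to a unit mod N. Different choices do not change
      \<open>chi\<close>, by \<open>eqchi\<close>, which makes the induced function multiplicative
      and periodic.\<close>
    define l where "l = (\<lambda>a. SOME x. [x = a] (mod int d) \<and> coprime x (int N))"
    have l: "[l a = a] (mod int d)" "coprime (l a) (int N)" if "coprime a (int d)" for a
    proof -
      have "\<exists>x. [x = a] (mod int d) \<and> coprime x (int N)"
        using coprime_lift[OF that, of "int N"] N_pos by (metis of_nat_0_less_iff less_irrefl)
      from someI_ex[OF this] show "[l a = a] (mod int d)" "coprime (l a) (int N)"
        by (auto simp: l_def)
    qed
    define \<psi> where "\<psi> = (\<lambda>a. if coprime a (int d) then chi (l a) else 0)"
    have "dirichlet_character d \<psi>"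
      unfolding dirichlet_character_def
    proof (intro conjI allI)
      show "d > 0" by (rule d0)
      fix m n
      show "\<psi> (m * n) = \<psi> m * \<psi> n"
      proof (cases "coprime m (int d) \<and> coprime n (int d)")
        case True
        hence c: "coprime m (int d)" "coprime n (int d)" "coprime (m * n) (int d)" by auto
        have "[l (m * n) = l m * l n] (mod int d)"
          using l(1)[OF c(3)] cong_mult[OF l(1)[OF c(1)] l(1)[OF c(2)]] by (meson cong_sym cong_trans)
        hence "chi (l (m * n)) = chi (l m * l n)" using l(2) c by (intro eqchi) auto
        thus ?thesis using c by (simp add: \<psi>_def chi_mult)
      qed (auto simp: \<psi>_def)
    next
      fix m
      have cm: "coprime (m + int d) (int d) \<longleftrightarrow> coprime m (int d)"
        by (metis coprime_iff_gcd_eq_1 gcd_add1)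
      show "\<psi> (m + int d) = \<psi> m"
      proof (cases "coprime m (int d)")
        case True
        have "[l (m + int d) = l m] (mod int d)"
          using l(1)[of "m + int d"] l(1)[OF True] cm True by (simp add: cong_def)
        hence "chi (l (m + int d)) = chi (l m)" using l(2) cm True by (intro eqchi) auto
        thus ?thesis using cm by (simp add: \<psi>_def)
      qed (simp add: \<psi>_def cm)
      show "\<psi> m \<noteq> 0 \<longleftrightarrow> coprime m (int d)" using l(2)[of m] chi_nz by (simp add: \<psi>_def)
    qed
    moreover have "chi m = \<psi> m" if "coprime m (int N)" for m
    proof -
      have c: "coprime m (int d)" using that d(1) by (meson coprime_divisors dvd_refl int_dvd_int_iff)
      have "chi m = chi (l m)" using l[OF c] that by (intro eqchi) (auto simp: cong_sym)
      thus ?thesis using c by (simp add: \<psi>_def)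
    qed
    ultimately show ?thesis unfolding induced_from_def using d(1) by blast
  qed
  ultimately show ?thesis using that by blast
qed

text \<open>The minus sign in the exponent matches the powers of exp (- w) in
  \<open>lambert_series_gauss\<close>.\<close>

definition unit_root :: "int \<Rightarrow> complex" where
  "unit_root k = cis (- 2 * pi * of_int k / real N)"

lemma unit_root_mod: "unit_root (k mod int N) = unit_root k"
proof -
  have "- 2 * pi * of_int k / real N = - 2 * pi * of_int (k mod int N) / real N + 2 * pi * of_int (- (k div int N))"
  proof -
    have "real_of_int k = of_int (k mod int N) + real N * of_int (k div int N)"
      by (metis mod_mult_div_eq of_int_add of_int_mult of_int_of_nat_eq)
    thus ?thesis using N_pos by (simp add: field_simps)
  qed
  hence "unit_root k = cis (- 2 * pi * of_int (k mod int N) / real N) * cis (2 * pi * of_int (- (k div int N)))"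
    by (simp only: unit_root_def cis_mult)
  moreover have "cis (2 * pi * of_int j) = 1" for j :: int
    by (rule cis_multiple_2pi) simp
  ultimately have "unit_root k = cis (- 2 * pi * of_int (k mod int N) / real N) * 1" by (simp only:)
  thus ?thesis by (simp add: unit_root_def)
qed

text \<open>With this sign it is the complex conjugate of the usual Gauss sum of \<open>chi\<close>
  at n.\<close>

definition gauss_sum :: "int \<Rightarrow> complex" where
  "gauss_sum n = (\<Sum>b\<in>{0..<int N}. cnj (chi b) * unit_root (b * n))"

text \<open>For n coprime to N the residues are permuted by n. Otherwise both sides vanish: with g =
  gcd n N, primitivity gives a unit m congruent to 1 mod N / g with chi m \<noteq> 1, and replacing
  b by m b multiplies the sum by cnj (chi m) without changing it.\<close>

lemma gauss_sum_primitive: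
  assumes prim: "primitive_dirichlet_character N chi"
  shows "gauss_sum n = chi n * gauss_sum 1"
proof (cases "coprime n (int N)")
  case True
  have "gauss_sum 1 = (\<Sum>b\<in>{0..<int N}. cnj (chi (n * b)) * unit_root (n * b * 1))"
    unfolding gauss_sum_def
    by (rule sum_residues_mult[OF True, symmetric]) (simp add: chi_mod unit_root_mod)
  also have "\<dots> = cnj (chi n) * gauss_sum n"
    by (simp add: gauss_sum_def chi_mult sum_distrib_left mult_ac)
  finally have "chi n * gauss_sum 1 = (chi n * cnj (chi n)) * gauss_sum n" by (simp add: mult.assoc)
  thus ?thesis using chi_cnj[OF True] by simp
next
  case False
  define g where "g = gcd n (int N)"
  have g: "g > 1"
  proof -
    have "g \<noteq> 1" using False by (simp add: g_def coprime_iff_gcd_eq_1)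
    moreover have "g > 0" using N_pos by (simp add: g_def)
    ultimately show ?thesis by simp
  qed
  obtain d' where d': "int N = g * d'" unfolding g_def by (metis dvdE gcd_dvd2)
  have d'0: "d' > 0" using d' g N_pos by (metis of_nat_0_less_iff zero_less_mult_pos order.strict_trans zero_less_one)
  define d where "d = nat d'"
  have d: "int d = d'" "d dvd N" "d < N"
  proof -
    show 1: "int d = d'" using d'0 by (simp add: d_def)
    show "d dvd N" using d' 1 by (metis dvd_triv_right int_dvd_int_iff)
    have "1 * d' < g * d'" using g d'0 by (intro mult_strict_right_mono) auto
    thus "d < N" using d' 1 by simp
  qed
  obtain m where m: "[m = 1] (mod int d)" "coprime m (int N)" "chi m \<noteq> 1"
    using not_induced_imp[OF prim d(2,3)] by blast
  \<comment> \<open>m - 1 is a multiple of N / g and n is a multiple of g.\<close>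
  have mn: "[m * n = n] (mod int N)"
  proof -
    obtain k where k: "m = 1 + int d * k" using m(1) by (metis cong_iff_lin cong_sym)
    obtain n' where n': "n = g * n'" unfolding g_def by (metis dvdE gcd_dvd1)
    have "m * n - n = int N * (k * n')" unfolding k n' d' d(1) by (simp add: algebra_simps)
    thus ?thesis by (metis cong_iff_dvd_diff dvd_triv_left)
  qed
  have ur: "unit_root (m * b * n) = unit_root (b * n)" for b
  proof -
    have "[m * b * n = b * n] (mod int N)" using cong_scalar_left[OF mn, of b] by (simp add: mult_ac)
    thus ?thesis by (metis cong_def unit_root_mod)
  qed
  have "gauss_sum n = (\<Sum>b\<in>{0..<int N}. cnj (chi (m * b)) * unit_root (m * b * n))"
    unfolding gauss_sum_def
    by (rule sum_residues_mult[OF m(2), symmetric]) (metis chi_mod unit_root_mod mod_mult_left_eq)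
  also have "\<dots> = cnj (chi m) * gauss_sum n"
    unfolding ur by (simp add: gauss_sum_def chi_mult sum_distrib_left mult_ac)
  finally have "(1 - cnj (chi m)) * gauss_sum n = 0" by (simp add: left_diff_distrib)
  moreover have "1 - cnj (chi m) \<noteq> 0" using m(3) by (metis complex_cnj_cnj complex_cnj_one eq_iff_diff_eq_0)
  ultimately show ?thesis using False chi_nz[of n] by simp
qed

end

section \<open>Euler products\<close>

definition sieved :: "nat set \<Rightarrow> nat set" where
  "sieved P = {n. n > 0 \<and> (\<forall>p\<in>P. \<not> p dvd n)}"

lemma sieved_insert:
  assumes p: "prime p" "p \<notin> P" "\<And>q. q \<in> P \<Longrightarrow> prime q"
  shows "sieved P = sieved (insert p P) \<union> (\<lambda>n. p * n) ` sieved P"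
    "sieved (insert p P) \<inter> (\<lambda>n. p * n) ` sieved P = {}"
proof -
  show "sieved P = sieved (insert p P) \<union> (\<lambda>n. p * n) ` sieved P"
  proof (intro equalityI subsetI)
    fix n assume n: "n \<in> sieved P"
    show "n \<in> sieved (insert p P) \<union> (\<lambda>n. p * n) ` sieved P"
    proof (cases "p dvd n")
      case True
      then obtain m where "n = p * m" by auto
      moreover have "m \<in> sieved P" using n unfolding \<open>n = p * m\<close> sieved_def by auto
      ultimately show ?thesis by auto
    qed (use n in \<open>auto simp: sieved_def\<close>)
  next
    fix n assume "n \<in> sieved (insert p P) \<union> (\<lambda>n. p * n) ` sieved P"
    thus "n \<in> sieved P"
    proof
      assume "n \<in> (\<lambda>n. p * n) ` sieved P"
      then obtain m where m: "n = p * m" "m \<in> sieved P" by auto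
      have "\<not> q dvd p * m" if q: "q \<in> P" for q
      proof
        assume "q dvd p * m"
        hence "q dvd p \<or> q dvd m" using p(3)[OF q] by (simp add: prime_dvd_mult_iff)
        hence "q dvd p" using m(2) q by (auto simp: sieved_def)
        hence "q = p" using p(1) p(3)[OF q] primes_dvd_imp_eq by blast
        thus False using q p(2) by simp
      qed
      thus ?thesis using m p(1) by (auto simp: sieved_def prime_gt_0_nat)
    qed (auto simp: sieved_def)
  qed
  show "sieved (insert p P) \<inter> (\<lambda>n. p * n) ` sieved P = {}" by (auto simp: sieved_def)
qed

text \<open>Sieving by one more prime p removes the multiples p n of the integers left so far, whose
  sum is g p times the sum before, by complete multiplicativity.\<close>

lemma sieve_infsum:
  fixes g :: "nat \<Rightarrow> complex"
  assumes mult: "\<And>m n. g (m * n) = g m * g n" and summ: "(\<lambda>n. norm (g n)) summable_on {0<..}"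
    and P: "finite P" "\<And>q. q \<in> P \<Longrightarrow> prime q"
  shows "infsum g (sieved P) = (\<Prod>p\<in>P. 1 - g p) * infsum g {0<..}"
  using P
proof (induction P rule: finite_induct)
  case empty
  have "sieved {} = {0<..}" by (auto simp: sieved_def)
  thus ?case by simp
next
  case (insert p P)
  have sub: "sieved Q \<subseteq> {0<..}" for Q by (auto simp: sieved_def)
  have s: "g summable_on A" if "A \<subseteq> {0<..}" for A
    by (rule abs_summable_summable, rule summable_on_subset_banach[OF summ that])
  have pp: "prime p" "\<And>q. q \<in> P \<Longrightarrow> prime q" using insert.prems by auto
  note si = sieved_insert[OF pp(1) insert.hyps(2) pp(2)]
  have im: "(\<lambda>n. p * n) ` sieved P \<subseteq> {0<..}" using pp(1) by (auto simp: sieved_def prime_gt_0_nat)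
  have inj: "inj_on (\<lambda>n. p * n) (sieved P)" using pp(1) by (auto intro!: inj_onI simp: prime_gt_0_nat)
  have "infsum g (sieved P) = infsum g (sieved (insert p P)) + infsum g ((\<lambda>n. p * n) ` sieved P)"
    using infsum_Un_disjoint[OF s[OF sub] s[OF im] si(2)] by (simp only: si(1)[symmetric])
  also have "infsum g ((\<lambda>n. p * n) ` sieved P) = g p * infsum g (sieved P)"
    by (simp only: infsum_reindex[OF inj] o_def mult infsum_cmult_right')
  finally have "infsum g (sieved (insert p P)) = infsum g (sieved P) - g p * infsum g (sieved P)"
    by (metis add_diff_cancel_right')
  also have "\<dots> = (1 - g p) * infsum g (sieved P)" by (simp only: left_diff_distrib mult_1)
  finally have "infsum g (sieved (insert p P)) = (1 - g p) * infsum g (sieved P)" .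
  thus ?case using insert by simp
qed

lemma summable_on_greaterThan_0:
  fixes g :: "nat \<Rightarrow> complex"
  assumes "summable (\<lambda>n. norm (g (Suc n)))"
  shows "(\<lambda>n. norm (g n)) summable_on {0<..}" "infsum g {0<..} = (\<Sum>n. g (Suc n))"
proof -
  have img: "{0<..} = Suc ` UNIV" by (auto simp: image_iff gr0_conv_Suc)
  have "(\<lambda>n. norm (g (Suc n))) summable_on UNIV"
    using assms by (simp add: norm_summable_imp_summable_on)
  thus "(\<lambda>n. norm (g n)) summable_on {0<..}"
    unfolding img by (subst summable_on_reindex) (auto simp: o_def)
  have "infsum g {0<..} = (\<Sum>\<^sub>\<infinity>n. g (Suc n))" unfolding img by (subst infsum_reindex) (auto simp: o_def)
  also have "((\<lambda>n. g (Suc n)) has_sum (\<Sum>n. g (Suc n))) UNIV"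
    using assms by (intro norm_summable_imp_has_sum summable_sums summable_norm_cancel[OF assms]) auto
  hence "(\<Sum>\<^sub>\<infinity>n. g (Suc n)) = (\<Sum>n. g (Suc n))" by (rule infsumI)
  finally show "infsum g {0<..} = (\<Sum>n. g (Suc n))" .
qed

text \<open>Stated as finite product times series tending to 1, so that nonvanishing of the series
  is immediate and no infinite product or division occurs.\<close>

lemma euler_product:
  fixes g :: "nat \<Rightarrow> complex"
  assumes mult: "\<And>m n. g (m * n) = g m * g n" and g1: "g 1 = 1"
    and summ: "summable (\<lambda>n. norm (g (Suc n)))"
  shows "(\<lambda>x. (\<Prod>p | prime p \<and> p \<le> x. 1 - g p) * (\<Sum>n. g (Suc n))) \<longlonglongrightarrow> 1"
proof -
  define S where "S = (\<lambda>x. sieved {p. prime p \<and> p \<le> x})"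
  have finP: "finite {p. prime p \<and> p \<le> x}" for x :: nat by (rule finite_subset[of _ "{..x}"]) auto
  note so = summable_on_greaterThan_0[OF summ]
  have eq: "(\<Prod>p | prime p \<and> p \<le> x. 1 - g p) * (\<Sum>n. g (Suc n)) = infsum g (S x)" for x
    unfolding S_def so(2)[symmetric] by (rule sieve_infsum[OF mult so(1) finP, symmetric]) auto
  have s: "(\<lambda>n. norm (g n)) summable_on A" if "A \<subseteq> {0<..}" for A
    by (rule summable_on_subset_banach[OF so(1) that])
  have sc: "g summable_on A" if "A \<subseteq> {0<..}" for A
    using s[OF that] by (rule abs_summable_summable)
  \<comment> \<open>After sieving by all primes up to x, only 1 and integers beyond x survive, so
    the error is a tail of an absolutely convergent series.\<close>
  have le: "norm (infsum g (S x) - 1) \<le> (\<Sum>n. norm (g (Suc (n + x))))" for x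
  proof -
    have S1: "1 \<in> S x" by (auto simp: S_def sieved_def)
    have S2: "n > x" if "n \<in> S x - {1}" for n
    proof (rule ccontr)
      assume "\<not> n > x"
      moreover from that have "n \<noteq> 1" "n > 0" by (auto simp: S_def sieved_def)
      then obtain p where "prime p" "p dvd n" using prime_factor_nat by blast
      moreover have "p \<le> n" using \<open>p dvd n\<close> \<open>n > 0\<close> by (rule dvd_imp_le)
      ultimately show False using that by (auto simp: S_def sieved_def)
    qed
    have sub: "S x - {1} \<subseteq> {0<..}" by (auto simp: S_def sieved_def)
    have "infsum g (S x) = infsum g ((S x - {1}) \<union> {1})"
      using S1 by (intro arg_cong2[where f=infsum]) auto
    also have "\<dots> = infsum g (S x - {1}) + infsum g {1}"
      by (rule infsum_Un_disjoint[OF sc[OF sub] sc]) auto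
    finally have "norm (infsum g (S x) - 1) = norm (infsum g (S x - {1}))" using g1 by simp
    also have "\<dots> \<le> (\<Sum>\<^sub>\<infinity>n\<in>S x - {1}. norm (g n))" by (rule norm_infsum_bound[OF s[OF sub]])
    also have "\<dots> \<le> (\<Sum>\<^sub>\<infinity>n\<in>{x<..}. norm (g n))"
      using S2 by (intro infsum_mono_neutral s sub) (auto intro: le_less_trans)
    also have "{x<..} = (\<lambda>n. Suc (n + x)) ` UNIV"
    proof (intro equalityI subsetI)
      fix n assume "n \<in> {x<..}"
      thus "n \<in> range (\<lambda>n. Suc (n + x))" by (intro image_eqI[of _ _ "n - Suc x"]) auto
    qed auto
    also have "(\<Sum>\<^sub>\<infinity>n\<in>range (\<lambda>n. Suc (n + x)). norm (g n)) = (\<Sum>\<^sub>\<infinity>n. norm (g (Suc (n + x))))"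
      by (subst infsum_reindex) (auto simp: o_def inj_on_def)
    also have "\<dots> = (\<Sum>n. norm (g (Suc (n + x))))"
    proof (rule infsumI, rule norm_summable_imp_has_sum)
      have "summable (\<lambda>n. norm (g (Suc (n + x))))"
        using summable_ignore_initial_segment[OF summ, of x] by simp
      thus "(\<lambda>n. norm (g (Suc (n + x)))) sums (\<Sum>n. norm (g (Suc (n + x))))"
        "summable (\<lambda>n. norm (norm (g (Suc (n + x)))))" by (auto intro: summable_sums)
    qed
    finally show ?thesis .
  qed
  have lim: "(\<lambda>x. \<Sum>n. norm (g (Suc (n + x)))) \<longlonglongrightarrow> 0"
    using suminf_exist_split2[OF summ] by simp
  have "(\<lambda>x. infsum g (S x) - 1) \<longlonglongrightarrow> 0"
    by (rule Lim_null_comparison[OF always_eventually[OF allI[OF le]] lim])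
  thus ?thesis unfolding eq by (simp add: LIM_zero_iff)
qed

section \<open>The 3-4-1 inequality\<close>

lemma ln_norm_one_minus_sums:
  assumes "norm w < 1"
  shows "(\<lambda>n. - Re (w ^ n) / of_nat n) sums ln (norm (1 - w))"
proof -
  have "(\<lambda>n. - ((- (- w)) ^ n) / of_nat n) sums ln (1 + (- w))"
    by (rule Ln_series') (use assms in simp)
  hence "(\<lambda>n. Re (- (w ^ n) / of_nat n)) sums Re (ln (1 - w))"
    by (intro sums_Re) simp
  moreover have "1 - w \<noteq> 0" using assms by auto
  ultimately show ?thesis by (simp add: Re_divide_of_nat)
qed

text \<open>The logarithm of the left side has the expansion \<open>- \<Sum> r^n (3 + 4 cos n\<theta> + cos 2n\<theta>) / n\<close>.\<close>

lemma three_four_one: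
  fixes r :: real and z :: complex
  assumes r: "0 \<le> r" "r < 1" and z: "norm z = 1 \<or> z = 0"
  shows "norm (1 - complex_of_real r) ^ 3 * norm (1 - of_real r * z) ^ 4 * norm (1 - of_real r * z\<^sup>2) \<le> 1"
  using z
proof
  \<comment> \<open>The case of a prime dividing the modulus, where only the zeta factor is
    left.\<close>
  assume z: "z = 0"
  have "norm (1 - complex_of_real r) = norm (complex_of_real (1 - r))" by (simp only: of_real_diff of_real_1)
  also have "\<dots> = 1 - r" using r by (simp only: norm_of_real)
  finally have "norm (1 - complex_of_real r) ^ 3 \<le> 1" using r by (simp only: power_le_one)
  thus ?thesis using z by simp
next
  assume z: "norm z = 1"
  have n: "norm (complex_of_real r) < 1" "norm (of_real r * z) < 1" "norm (of_real r * z\<^sup>2) < 1"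
    using r z by (auto simp: norm_mult norm_power)
  have pos: "norm (1 - w) > 0" if "norm w < 1" for w :: complex using that by auto
  let ?f = "\<lambda>n. 3 * (- Re (of_real r ^ n) / of_nat n) + 4 * (- Re ((of_real r * z) ^ n) / of_nat n)
      + (- Re ((of_real r * z\<^sup>2) ^ n) / of_nat n)"
  have sums: "?f sums (3 * ln (norm (1 - complex_of_real r)) + 4 * ln (norm (1 - of_real r * z)) + ln (norm (1 - of_real r * z\<^sup>2)))"
    by (intro sums_add sums_mult ln_norm_one_minus_sums n)
  have neg: "?f n \<le> 0" for n
  proof -
    define u where "u = z ^ n"
    have u: "(Re u)\<^sup>2 + (Im u)\<^sup>2 = 1" using z cmod_power2[of u] by (simp add: u_def norm_power)
    have "(z\<^sup>2) ^ n = u\<^sup>2" by (simp add: u_def flip: power_mult) (simp add: mult.commute)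
    hence e: "Re ((of_real r * z\<^sup>2) ^ n) = r ^ n * ((Re u)\<^sup>2 - (Im u)\<^sup>2)"
      "Re ((of_real r * z) ^ n) = r ^ n * Re u" "Re (complex_of_real r ^ n) = r ^ n"
      by (simp_all add: power_mult_distrib u_def[symmetric] Re_power2 flip: of_real_power)
    have "3 + 4 * Re u + ((Re u)\<^sup>2 - (Im u)\<^sup>2) = 2 * (1 + Re u)\<^sup>2"
      using u by (simp add: power2_eq_square algebra_simps)
    hence nn: "0 \<le> 3 + 4 * Re u + ((Re u)\<^sup>2 - (Im u)\<^sup>2)" by simp
    have "?f n = - (r ^ n / of_nat n) * (3 + 4 * Re u + ((Re u)\<^sup>2 - (Im u)\<^sup>2))"
      unfolding e by (simp add: algebra_simps add_divide_distrib diff_divide_distrib)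
    moreover have "0 \<le> r ^ n / of_nat n" using r by simp
    ultimately show ?thesis using mult_nonneg_nonneg[OF _ nn, of "r ^ n / of_nat n"] by linarith
  qed
  have le: "3 * ln (norm (1 - complex_of_real r)) + 4 * ln (norm (1 - of_real r * z)) + ln (norm (1 - of_real r * z\<^sup>2)) \<le> 0"
    by (rule sums_le[OF neg sums sums_zero])
  define a b c where "a = norm (1 - complex_of_real r)" and "b = norm (1 - of_real r * z)"
    and "c = norm (1 - of_real r * z\<^sup>2)"
  have abc: "a > 0" "b > 0" "c > 0" unfolding a_def b_def c_def using pos n by blast+
  have "ln (a ^ 3 * b ^ 4 * c) = 3 * ln a + 4 * ln b + ln c"
    using abc by (simp add: ln_mult ln_realpow)
  also have "\<dots> \<le> 0" using le by (simp add: a_def b_def c_def)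
  finally have "a ^ 3 * b ^ 4 * c \<le> 1" using abc by (subst (asm) ln_le_zero_iff) auto
  thus ?thesis by (simp add: a_def b_def c_def)
qed

context dchar
begin

text \<open>Meaningful where the series converges: Re s > 0 for a nonprincipal character, Re s > 1
  in general. The continuation to the plane is \<open>entire_L\<close>.\<close>

definition L :: "complex \<Rightarrow> complex" where
  "L = dseries (\<lambda>n. chi (int n))"

lemma summable_chi_dterm:
  assumes "Re s > 1"
  shows "summable (\<lambda>n. norm (chi (int (Suc n)) * dterm s n))"
  by (rule summable_comparison_test'[OF zeta_bound(1)[OF assms], of 0])
     (simp add: norm_mult norm_chi_le mult_left_le_one_le)

lemma euler_product_L:
  assumes s: "Re s > 1"
  shows "(\<lambda>x. (\<Prod>p | prime p \<and> p \<le> x. 1 - chi (int p) * of_nat p powr (- s)) * L s) \<longlonglongrightarrow> 1"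
proof -
  define g where "g = (\<lambda>n. chi (int n) * of_nat n powr (- s))"
  have "g (m * n) = g m * g n" for m n
    unfolding g_def of_nat_mult chi_mult by (subst powr_times_real) auto
  moreover have "g 1 = 1" by (simp add: g_def chi_1)
  moreover have "summable (\<lambda>n. norm (g (Suc n)))"
    using summable_chi_dterm[OF s] by (simp only: g_def dterm_def)
  ultimately have "(\<lambda>x. (\<Prod>p | prime p \<and> p \<le> x. 1 - g p) * (\<Sum>n. g (Suc n))) \<longlonglongrightarrow> 1"
    by (rule euler_product)
  thus ?thesis by (simp only: g_def L_def dseries_def dterm_def)
qed

lemma L_nonzero_right:
  assumes "Re s > 1"
  shows "L s \<noteq> 0"
proof
  assume "L s = 0"
  with euler_product_L[OF assms] have "(\<lambda>x::nat. 0::complex) \<longlonglongrightarrow> 1" by simp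
  thus False using LIMSEQ_unique tendsto_const zero_neq_one by blast
qed

end

text \<open>The inequality holds prime by prime for the inverse Euler factors, hence for finite
  products and in the limit. Three characters are involved, \<open>chi\<close>, its square, and the
  trivial one modulo 1 for zeta; therefore it stands outside the locale.\<close>

lemma L_three_four_one:
  assumes "dchar N chi" and \<sigma>: "\<sigma> > 1"
  shows "1 \<le> norm (\<Sum>n. dterm (of_real \<sigma>) n) ^ 3 * norm (dchar.L chi (Complex \<sigma> t)) ^ 4 *
     norm (dchar.L (\<lambda>m. chi m ^ 2) (Complex \<sigma> (2 * t)))"
proof -
  interpret dchar N chi by fact
  interpret sq: dchar N "\<lambda>m. chi m ^ 2" by (rule dchar_square)
  interpret one: dchar 1 "\<lambda>m. 1" by unfold_locales (auto simp: dirichlet_character_def)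
  define P where "P = (\<lambda>x::nat. {p. prime p \<and> p \<le> x})"
  let ?A = "\<lambda>x. \<Prod>p\<in>P x. 1 - 1 * complex_of_nat p powr (- of_real \<sigma>)"
  let ?B = "\<lambda>x. \<Prod>p\<in>P x. 1 - chi (int p) * of_nat p powr (- Complex \<sigma> t)"
  let ?C = "\<lambda>x. \<Prod>p\<in>P x. 1 - chi (int p) ^ 2 * of_nat p powr (- Complex \<sigma> (2 * t))"
  have "(\<lambda>x. norm (?A x * one.L (of_real \<sigma>)) ^ 3 * norm (?B x * L (Complex \<sigma> t)) ^ 4 *
      norm (?C x * sq.L (Complex \<sigma> (2 * t)))) \<longlonglongrightarrow> norm (1::complex) ^ 3 * norm (1::complex) ^ 4 * norm (1::complex)"
    unfolding P_def using \<sigma>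
    by (intro tendsto_intros one.euler_product_L euler_product_L sq.euler_product_L) auto
  hence lim: "(\<lambda>x. (norm (?A x) ^ 3 * norm (?B x) ^ 4 * norm (?C x)) *
     (norm (one.L (of_real \<sigma>)) ^ 3 * norm (L (Complex \<sigma> t)) ^ 4 * norm (sq.L (Complex \<sigma> (2 * t))))) \<longlonglongrightarrow> 1"
    by (simp add: norm_mult power_mult_distrib mult_ac)
  have le1: "norm (?A x) ^ 3 * norm (?B x) ^ 4 * norm (?C x) \<le> 1" for x
  proof -
    have "norm (?A x) ^ 3 * norm (?B x) ^ 4 * norm (?C x) =
      (\<Prod>p\<in>P x. norm (1 - complex_of_nat p powr (- of_real \<sigma>)) ^ 3 *
         norm (1 - chi (int p) * of_nat p powr (- Complex \<sigma> t)) ^ 4 *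
         norm (1 - chi (int p) ^ 2 * of_nat p powr (- Complex \<sigma> (2 * t))))"
      by (simp add: prod_norm[symmetric] prod_power_distrib prod.distrib)
    also have "\<dots> \<le> 1"
    proof (rule prod_le_1)
      fix p assume "p \<in> P x"
      hence p: "p > 1" by (simp add: P_def prime_gt_Suc_0_nat)
      define r where "r = real p powr (- \<sigma>)"
      define z where "z = chi (int p) * of_nat p powr (- Complex 0 t)"
      have r: "0 \<le> r" "r < 1" using p \<sigma> by (auto simp: r_def powr_less_one)
      have np: "norm (of_nat p powr (- Complex 0 t)) = 1"
        using p by (subst norm_powr_real_powr) auto
      have z: "norm z = 1 \<or> z = 0" unfolding z_def norm_mult np using norm_chi[of "int p"] by auto
      have 1: "of_nat p powr (- complex_of_real \<sigma>) = of_real r"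
        using p by (simp add: r_def powr_of_real[symmetric])
      have split: "- Complex \<sigma> u = - complex_of_real \<sigma> + - Complex 0 u" for u by (simp add: complex_eq_iff)
      have 2: "chi (int p) * of_nat p powr (- Complex \<sigma> t) = of_real r * z"
        unfolding split[of t] powr_add 1 z_def by simp
      have 3: "chi (int p) ^ 2 * of_nat p powr (- Complex \<sigma> (2 * t)) = of_real r * z\<^sup>2"
      proof -
        have "- Complex 0 (2 * t) = - Complex 0 t + - Complex 0 t" by (simp add: complex_eq_iff)
        hence "of_nat p powr (- Complex 0 (2 * t)) = (of_nat p powr (- Complex 0 t))\<^sup>2"
          by (simp only: powr_add power2_eq_square)
        thus ?thesis unfolding split[of "2 * t"] powr_add 1 z_def by (simp add: power_mult_distrib)
      qed
      show "0 \<le> norm (1 - complex_of_nat p powr (- complex_of_real \<sigma>)) ^ 3 *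
         norm (1 - chi (int p) * of_nat p powr (- Complex \<sigma> t)) ^ 4 *
         norm (1 - chi (int p) ^ 2 * of_nat p powr (- Complex \<sigma> (2 * t))) \<and>
        norm (1 - complex_of_nat p powr (- complex_of_real \<sigma>)) ^ 3 *
         norm (1 - chi (int p) * of_nat p powr (- Complex \<sigma> t)) ^ 4 *
         norm (1 - chi (int p) ^ 2 * of_nat p powr (- Complex \<sigma> (2 * t))) \<le> 1"
        unfolding 1 2 3 using three_four_one[OF r z] by simp
    qed
    finally show ?thesis .
  qed
  have "1 \<le> norm (one.L (of_real \<sigma>)) ^ 3 * norm (L (Complex \<sigma> t)) ^ 4 * norm (sq.L (Complex \<sigma> (2 * t)))"
    by (rule LIMSEQ_le_const2[OF lim]) (intro exI[of _ 0] allI impI mult_left_le_one_le le1 mult_nonneg_nonneg; simp)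
  thus ?thesis by (simp add: one.L_def dseries_def)
qed

section \<open>Nonvanishing on the line of abscissa 1\<close>

lemma divisors_prime_power_mult:
  fixes p k m :: nat
  assumes p: "prime p" "\<not> p dvd m" "m > 0"
  shows "bij_betw (\<lambda>(i, d). p ^ i * d) ({..k} \<times> {d. d dvd m}) {d. d dvd p ^ k * m}"
proof (rule bij_betw_imageI)
  show "inj_on (\<lambda>(i, d). p ^ i * d) ({..k} \<times> {d. d dvd m})"
  proof (rule inj_onI, clarify)
    fix i d i' d' assume h: "d dvd m" "d' dvd m" "p ^ i * d = p ^ i' * d'"
    have d: "d > 0" "d' > 0" "\<not> p dvd d" "\<not> p dvd d'"
      using h p by (auto intro: Nat.gr0I dvd_trans)
    have "multiplicity p (p ^ j * e) = j" if "e > 0" "\<not> p dvd e" for j e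
      using that p by (simp add: prime_elem_multiplicity_mult_distrib not_dvd_imp_multiplicity_0)
    hence "i = i'" using h(3) d by metis
    thus "i = i' \<and> d = d'" using h(3) p(1) by (simp add: prime_gt_0_nat)
  qed
  show "(\<lambda>(i, d). p ^ i * d) ` ({..k} \<times> {d. d dvd m}) = {d. d dvd p ^ k * m}"
  proof (intro equalityI subsetI)
    fix e assume "e \<in> (\<lambda>(i, d). p ^ i * d) ` ({..k} \<times> {d. d dvd m})"
    thus "e \<in> {d. d dvd p ^ k * m}" by (auto intro!: mult_dvd_mono le_imp_power_dvd)
  next
    fix e assume "e \<in> {d. d dvd p ^ k * m}"
    hence "e dvd p ^ k * m" by simp
    then obtain a b where ab: "e = a * b" "a dvd p ^ k" "b dvd m" by (metis division_decomp)
    then obtain i where "i \<le> k" "a = p ^ i" using divides_primepow_nat[OF p(1)] by blast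
    thus "e \<in> (\<lambda>(i, d). p ^ i * d) ` ({..k} \<times> {d. d dvd m})" using ab by auto
  qed
qed

text \<open>The divisor sum is multiplicative, and the factor of p^k is 1 + f p + ... + (f p)^k: it
  is never negative, and at least 1 when k is even. The induction splits off one prime power at a
  time; in a square all exponents are even.\<close>

lemma real_character_divisor_sum:
  fixes f :: "nat \<Rightarrow> real"
  assumes mult: "\<And>m n. f (m * n) = f m * f n" and f1: "f 1 = 1"
    and vals: "\<And>n. f n = 0 \<or> f n = 1 \<or> f n = -1" and n: "n > 0"
  shows "(\<Sum>d | d dvd n. f d) \<ge> 0 \<and> ((\<exists>m. n = m ^ 2) \<longrightarrow> (\<Sum>d | d dvd n. f d) \<ge> 1)"
  using n
proof (induction n rule: less_induct)
  case (less n)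
  show ?case
  proof (cases "n = 1")
    case True
    thus ?thesis using f1 by simp
  next
    case False
    then obtain p where p: "prime p" "p dvd n" using prime_factor_nat by blast
    define k where "k = multiplicity p n"
    obtain m where m: "n = p ^ k * m" "\<not> p dvd m"
      using less.prems p(1) multiplicity_decompose'[of n p] unfolding k_def
      by (metis not_prime_unit less_irrefl)
    have k: "k > 0" unfolding k_def using p less.prems by (simp add: prime_multiplicity_gt_zero_iff)
    have m0: "m > 0" using less.prems m(1) by (auto intro: Nat.gr0I)
    have "m < n"
    proof -
      have "1 < p ^ k" using p(1) k prime_gt_1_nat one_less_power by blast
      thus ?thesis unfolding m(1) using m0 by simp
    qed
    note IH = less.IH[OF this m0]
    have fpow: "f (p ^ i) = f p ^ i" for i
      by (induction i) (simp_all add: f1[simplified] mult)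
    have "(\<Sum>d | d dvd n. f d) = (\<Sum>(i, d)\<in>{..k} \<times> {d. d dvd m}. f (p ^ i * d))"
      unfolding m(1) using sum.reindex_bij_betw[OF divisors_prime_power_mult[OF p(1) m(2) m0], of f k]
      by (simp add: case_prod_unfold)
    also have "\<dots> = (\<Sum>i\<le>k. f p ^ i) * (\<Sum>d | d dvd m. f d)"
      by (simp add: mult fpow sum_product sum.cartesian_product)
    finally have eq: "(\<Sum>d | d dvd n. f d) = (\<Sum>i\<le>k. f p ^ i) * (\<Sum>d | d dvd m. f d)" .
    have P: "(\<Sum>i\<le>k. f p ^ i) \<ge> 0 \<and> (even k \<longrightarrow> (\<Sum>i\<le>k. f p ^ i) \<ge> 1)"
    proof -
      consider "f p = 0" | "f p = 1" | "f p = -1" using vals by blast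
      thus ?thesis
      proof cases
        case 1
        hence "(\<Sum>i\<le>k. f p ^ i) = 1" by (simp add: power_0_left)
        thus ?thesis by simp
      next
        case 2 thus ?thesis by simp
      next
        case 3
        have "(\<Sum>i\<le>k. (-1::real) ^ i) = (if even k then 1 else 0)" by (induction k) auto
        thus ?thesis using 3 by simp
      qed
    qed
    have "even k \<and> (\<exists>b. m = b ^ 2)" if a: "n = a ^ 2" for a
    proof -
      have a0: "a > 0" using a less.prems by (auto intro: Nat.gr0I)
      define j where "j = multiplicity p a"
      obtain b where b: "a = p ^ j * b" "\<not> p dvd b"
        using a0 p(1) multiplicity_decompose'[of a p] unfolding j_def
        by (metis not_prime_unit less_irrefl)
      have k2: "k = 2 * j" unfolding k_def j_def a using p(1) a0
        by (simp add: prime_elem_multiplicity_power_distrib)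
      have "(p ^ j * b) ^ 2 = p ^ (2 * j) * b ^ 2"
        by (simp add: power_mult_distrib power_mult[symmetric] mult.commute)
      hence "p ^ k * m = p ^ k * b ^ 2" using m(1) a b(1) k2 by metis
      moreover have "p ^ k > 0" using p(1) by (simp add: prime_gt_0_nat)
      ultimately have "m = b ^ 2" by (simp only: nat_mult_eq_cancel1)
      thus ?thesis using k2 by auto
    qed
    hence "1 * 1 \<le> (\<Sum>i\<le>k. f p ^ i) * (\<Sum>d | d dvd m. f d)" if "\<exists>a. n = a ^ 2"
      using that P IH by (intro mult_mono) auto
    thus ?thesis using P IH unfolding eq by simp
  qed
qed

text \<open>AM-GM for the terms with indices i and n - 1 - i; \<open>y\<close> is the square root of
  the ratio of the geometric sum.\<close>

lemma geometric_sum_ge: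
  fixes y :: real
  assumes "y \<ge> 0"
  shows "of_nat n * y ^ (n - 1) \<le> (\<Sum>i<n. (y\<^sup>2) ^ i)"
proof -
  have "2 * y ^ (n - 1) \<le> (y\<^sup>2) ^ i + (y\<^sup>2) ^ (n - Suc i)" if "i < n" for i
  proof -
    have "y ^ (n - 1) = y ^ i * y ^ (n - Suc i)" using that by (simp flip: power_add)
    moreover have "(y\<^sup>2) ^ j = (y ^ j)\<^sup>2" for j by (simp add: power_mult[symmetric] mult.commute)
    ultimately show ?thesis using sum_squares_ge_zero[of "y ^ i - y ^ (n - Suc i)" 0]
      by (simp add: power2_eq_square algebra_simps)
  qed
  hence "(\<Sum>i<n. 2 * y ^ (n - 1)) \<le> (\<Sum>i<n. (y\<^sup>2) ^ i + (y\<^sup>2) ^ (n - Suc i))" by (intro sum_mono) auto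
  thus ?thesis by (simp add: sum.distrib sum.nat_diff_reindex[of "\<lambda>i. (y\<^sup>2) ^ i"])
qed

lemma sum_divisor_lattice:
  fixes g :: "nat \<Rightarrow> nat \<Rightarrow> real"
  shows "(\<Sum>n=1..K. \<Sum>k=1..K div n. g n (n * k)) = (\<Sum>m=1..K. \<Sum>d | d dvd m. g d m)"
proof -
  have "(\<Sum>n=1..K. \<Sum>k=1..K div n. g n (n * k)) = (\<Sum>(n, k)\<in>Sigma {1..K} (\<lambda>n. {1..K div n}). g n (n * k))"
    by (rule sum.Sigma) auto
  also have "\<dots> = (\<Sum>(m, d)\<in>Sigma {1..K} (\<lambda>m. {d. d dvd m}). g d m)"
    by (rule sum.reindex_bij_witness[of _ "\<lambda>(m, d). (d, m div d)" "\<lambda>(n, k). (n * k, n)"])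
       (auto simp: less_eq_div_iff_mult_less_eq dvd_imp_le div_le_mono mult.commute Suc_le_eq
          intro: dvd_pos_nat order.trans[OF dvd_imp_le])
  also have "\<dots> = (\<Sum>m=1..K. \<Sum>d | d dvd m. g d m)"
    by (rule sum.Sigma[symmetric]) auto
  finally show ?thesis .
qed

text \<open>With n = k + 1, the Lambert term x^n / (1 - x^n) subtracted from its singular part 1 /
  (n (1 - x)) as x tends to 1.\<close>

definition lambert_gap :: "real \<Rightarrow> nat \<Rightarrow> real" where
  "lambert_gap x k = 1 / (real (Suc k) * (1 - x)) - x ^ Suc k / (1 - x ^ Suc k)"

text \<open>Writing 1 - x^n = (1 - x) A n with A n = 1 + ... + x^(n-1), monotonicity becomes n (n +
  1) x^n \<le> A n A (n + 1), which follows from AM-GM applied to each of the two factors.\<close>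

lemma lambert_gap_decreasing:
  assumes x: "0 < x" "x < 1"
  shows "lambert_gap x (Suc k) \<le> lambert_gap x k" "lambert_gap x k \<ge> 0"
proof -
  define A where "A = (\<lambda>n. \<Sum>i<n. x ^ i)"
  have A: "1 - x ^ n = (1 - x) * A n" for n using x by (simp add: A_def sum_gp_strict)
  have Apos: "A (Suc n) > 0" for n using x unfolding A_def by (intro sum_pos) auto
  define y where "y = sqrt x"
  have y: "y > 0" "y < 1" "y\<^sup>2 = x" using x by (auto simp: y_def)
  have ge: "real n * y ^ (n - 1) \<le> A n" for n using geometric_sum_ge[of y n] y by (simp add: A_def)
  have le1: "x ^ n \<le> y ^ (n - 1)" for n
  proof -
    have "x ^ n = y ^ (2 * n)" using y by (metis power_mult)
    also have "\<dots> \<le> y ^ (n - 1)" using y by (intro power_decreasing) auto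
    finally show ?thesis .
  qed
  have g: "lambert_gap x k = (1 / real (Suc k) - x ^ Suc k / A (Suc k)) / (1 - x)" for k
    unfolding lambert_gap_def A by (simp add: diff_divide_distrib mult.commute)
  have "x ^ Suc k / A (Suc k) \<le> 1 / real (Suc k)"
  proof -
    have "real (Suc k) * x ^ Suc k \<le> real (Suc k) * y ^ (Suc k - 1)" by (intro mult_left_mono le1) auto
    also have "\<dots> \<le> A (Suc k)" by (rule ge)
    finally show ?thesis using Apos[of k] by (simp add: field_simps)
  qed
  thus "lambert_gap x k \<ge> 0" unfolding g using x by simp
  define n where "n = Suc k"
  have n: "n > 0" by (simp add: n_def)
  have "real n * real (Suc n) * x ^ n \<le> (real n * y ^ (n - 1)) * (real (Suc n) * y ^ (Suc n - 1))"
  proof -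
    have "x ^ n = y ^ (2 * n)" using y by (metis power_mult)
    also have "\<dots> \<le> y ^ ((n - 1) + n)" using y by (intro power_decreasing) auto
    finally have "x ^ n \<le> y ^ (n - 1) * y ^ n" by (simp add: power_add)
    hence "(real n * real (Suc n)) * x ^ n \<le> (real n * real (Suc n)) * (y ^ (n - 1) * y ^ n)"
      by (intro mult_left_mono) auto
    thus ?thesis by (simp add: mult_ac)
  qed
  also have "\<dots> \<le> A n * A (Suc n)" using y n Apos[of k] by (intro mult_mono ge) (auto simp: n_def less_imp_le)
  finally have key: "real n * real (Suc n) * x ^ n \<le> A n * A (Suc n)" .
  have An: "A n > 0" "A (Suc n) > 0" using Apos by (auto simp: n_def)
  \<comment> \<open>The numerator collapses because A (n + 1) = 1 + x A n.\<close>
  have "x ^ n / A n - x ^ Suc n / A (Suc n) = x ^ n / (A n * A (Suc n))"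
  proof -
    have "A (Suc n) = 1 + x * A n"
      unfolding A_def by (subst sum.lessThan_Suc_shift) (simp add: sum_distrib_left)
    hence "x ^ n * A (Suc n) - x ^ Suc n * A n = x ^ n" by (simp add: algebra_simps)
    moreover have "x ^ n / A n - x ^ Suc n / A (Suc n) = (x ^ n * A (Suc n) - x ^ Suc n * A n) / (A n * A (Suc n))"
      using An by (subst diff_frac_eq) auto
    ultimately show ?thesis by (simp only:)
  qed
  also have "\<dots> \<le> 1 / (real n * real (Suc n))"
    using key An n by (simp add: divide_simps mult_ac)
  also have "\<dots> = 1 / real n - 1 / real (Suc n)" using n by (simp add: divide_simps)
  finally have "1 / real (Suc n) - x ^ Suc n / A (Suc n) \<le> 1 / real n - x ^ n / A n" by linarith
  thus "lambert_gap x (Suc k) \<le> lambert_gap x k" unfolding g n_def[symmetric]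
    using x by (intro divide_right_mono) auto
qed

text \<open>Monsky's proof of the nonvanishing at 1 for real characters, with truncated Lambert series.\<close>

lemma real_character_sum_nonzero:
  fixes f :: "nat \<Rightarrow> real"
  assumes mult: "\<And>m n. f (m * n) = f m * f n" and f1: "f 1 = 1"
    and vals: "\<And>n. f n = 0 \<or> f n = 1 \<or> f n = -1"
    and C: "\<And>n. norm (\<Sum>k<n. complex_of_real (f (Suc k))) \<le> C"
  shows "\<not> (\<lambda>k. f (Suc k) / real (Suc k)) sums 0"
proof
  assume zero: "(\<lambda>k. f (Suc k) / real (Suc k)) sums 0"
  \<comment> \<open>The bound is uniform in x and J, so letting x tend to 1 would give J \<le> C for
    every J.\<close>
  have bound: "(\<Sum>j=1..J. x ^ (j ^ 2)) \<le> C" if x: "0 < x" "x < 1" for x J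
  proof -
    \<comment> \<open>Truncation at K keeps every rearrangement finite; the error K x^K / (1 - x)
      disappears as K grows. K \<ge> J^2 ensures that the squares up to J^2 are among the m \<le>
      K.\<close>
    have main: "(\<Sum>j=1..J. x ^ (j ^ 2)) \<le> (\<Sum>k<K. f (Suc k) / real (Suc k)) / (1 - x) + C + real K * x ^ K / (1 - x)"
      if K: "K \<ge> J\<^sup>2" for K
    proof -
      define t where "t = (\<lambda>n. x ^ n / (1 - x ^ n))"
      have xn: "x ^ n < 1" "x ^ n \<le> x" if "n \<ge> 1" for n
        using x that power_Suc_less_one[of x "n - 1"] power_decreasing[of 1 n x] by auto
      have geo: "\<bar>t n - (\<Sum>k=1..K div n. x ^ (n * k))\<bar> \<le> x ^ K / (1 - x)" if n: "n \<ge> 1" for n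
      proof -
        define q where "q = K div n"
        have "(\<Sum>k=1..q. x ^ (n * k)) = (x ^ n - x ^ (n * Suc q)) / (1 - x ^ n)"
        proof (induction q)
          case (Suc q)
          have "(\<Sum>k=1..Suc q. x ^ (n * k)) = (x ^ n - x ^ (n * Suc q)) / (1 - x ^ n) + x ^ (n * Suc q)"
            using Suc by simp
          also have "\<dots> = (x ^ n - x ^ (n * Suc q) + x ^ (n * Suc q) * (1 - x ^ n)) / (1 - x ^ n)"
            using xn(1)[OF n] by (subst add_divide_distrib[of _ "x ^ (n * Suc q) * (1 - x ^ n)"]) simp
          also have "x ^ n - x ^ (n * Suc q) + x ^ (n * Suc q) * (1 - x ^ n) = x ^ n - x ^ (n * Suc (Suc q))"
          proof -
            have "x ^ (n * Suc (Suc q)) = x ^ (n * Suc q) * x ^ n" by (simp flip: power_add add: ac_simps)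
            thus ?thesis by (simp only: right_diff_distrib mult_1_right)
          qed
          finally show ?case .
        qed simp
        hence "t n - (\<Sum>k=1..q. x ^ (n * k)) = x ^ (n * Suc q) / (1 - x ^ n)"
          unfolding t_def by (simp add: diff_divide_distrib)
        moreover have "x ^ (n * Suc q) / (1 - x ^ n) \<le> x ^ K / (1 - x)"
        proof (rule frac_le)
          have "K = n * q + K mod n" by (simp add: q_def)
          moreover have "K mod n < n" using n by simp
          ultimately have "K \<le> n * Suc q" unfolding mult_Suc_right by linarith
          thus "x ^ (n * Suc q) \<le> x ^ K" using x by (intro power_decreasing) auto
        qed (use x xn[OF n] in auto)
        moreover have "0 \<le> x ^ (n * Suc q) / (1 - x ^ n)" using x xn(1)[OF n] by simp
        ultimately show ?thesis unfolding q_def by linarith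
      qed
      have ds: "(\<Sum>d | d dvd m. f d) \<ge> 0" "m = j ^ 2 \<Longrightarrow> (\<Sum>d | d dvd m. f d) \<ge> 1" if "m > 0" for m j
        using real_character_divisor_sum[OF mult f1 vals that] by blast+
      have "(\<Sum>j=1..J. x ^ (j ^ 2)) = (\<Sum>m\<in>(\<lambda>j. j ^ 2) ` {1..J}. x ^ m)"
        by (subst sum.reindex) (auto simp: inj_on_def)
      also have "\<dots> \<le> (\<Sum>m\<in>(\<lambda>j. j ^ 2) ` {1..J}. (\<Sum>d | d dvd m. f d) * x ^ m)"
      proof (rule sum_mono)
        fix m assume "m \<in> (\<lambda>j. j ^ 2) ` {1..J}"
        then obtain j where "m = j ^ 2" "j \<ge> 1" by auto
        hence "(\<Sum>d | d dvd m. f d) \<ge> 1" using ds(2)[of m j] by simp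
        thus "x ^ m \<le> (\<Sum>d | d dvd m. f d) * x ^ m" using x by (simp add: mult_le_cancel_right1)
      qed
      also have "\<dots> \<le> (\<Sum>m=1..K. (\<Sum>d | d dvd m. f d) * x ^ m)"
      proof (rule sum_mono2)
        show "(\<lambda>j. j ^ 2) ` {1..J} \<subseteq> {1..K}"
        proof
          fix m assume "m \<in> (\<lambda>j. j ^ 2) ` {1..J}"
          then obtain j where j: "m = j ^ 2" "1 \<le> j" "j \<le> J" by auto
          have "j ^ 2 \<le> J ^ 2" using j by (intro power_mono) auto
          hence "m \<le> K" using K j(1) by linarith
          thus "m \<in> {1..K}" using j by simp
        qed
      qed (use ds(1) x in auto)
      also have "\<dots> = (\<Sum>n=1..K. \<Sum>k=1..K div n. f n * x ^ (n * k))"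
        by (subst sum_divisor_lattice[of "\<lambda>n m. f n * x ^ m"]) (simp add: sum_distrib_right)
      also have "\<dots> \<le> (\<Sum>n=1..K. f n * t n + x ^ K / (1 - x))"
      proof (rule sum_mono)
        fix n assume "n \<in> {1..K}"
        hence "\<bar>t n - (\<Sum>k=1..K div n. x ^ (n * k))\<bar> \<le> x ^ K / (1 - x)" using geo by simp
        moreover have "(\<Sum>k=1..K div n. f n * x ^ (n * k)) = f n * (\<Sum>k=1..K div n. x ^ (n * k))"
          by (simp add: sum_distrib_left)
        moreover have "f n * s \<le> f n * t n + e" if "\<bar>t n - s\<bar> \<le> e" for s e
        proof -
          from vals[of n] that show ?thesis by (elim disjE) auto
        qed
        ultimately show "(\<Sum>k=1..K div n. f n * x ^ (n * k)) \<le> f n * t n + x ^ K / (1 - x)" by metis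
      qed
      also have "\<dots> = (\<Sum>n=1..K. f n * t n) + real K * x ^ K / (1 - x)" by (simp add: sum.distrib)
      also have "(\<Sum>n=1..K. f n * t n) = (\<Sum>k<K. f (Suc k) * t (Suc k))"
        by (rule sum.reindex_bij_witness[of _ Suc "\<lambda>n. n - 1"]) auto
      \<comment> \<open>The singular parts are collected into a partial sum of the series assumed to
        be 0, which vanishes for K to infinity at fixed x, before x tends to 1.\<close>
      also have "\<dots> = (\<Sum>k<K. f (Suc k) / real (Suc k) / (1 - x) - f (Suc k) * lambert_gap x k)"
        by (intro sum.cong refl) (simp add: lambert_gap_def t_def right_diff_distrib)
      also have "\<dots> = (\<Sum>k<K. f (Suc k) / real (Suc k)) / (1 - x) - (\<Sum>k<K. f (Suc k) * lambert_gap x k)"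
        by (simp add: sum_subtractf sum_divide_distrib)
      finally have "(\<Sum>j=1..J. x ^ (j ^ 2)) \<le> (\<Sum>k<K. f (Suc k) / real (Suc k)) / (1 - x) -
         (\<Sum>k<K. f (Suc k) * lambert_gap x k) + real K * x ^ K / (1 - x)" .
      \<comment> \<open>Summation by parts against the decreasing gaps; the first gap is exactly 1,
        so x does not enter the bound.\<close>
      moreover have "\<bar>\<Sum>k<K. f (Suc k) * lambert_gap x k\<bar> \<le> C"
      proof -
        have "norm (\<Sum>k<K. complex_of_real (f (Suc k)) * of_real (lambert_gap x k)) \<le> C * lambert_gap x 0"
          by (rule norm_sum_decreasing_le[OF C]) (use lambert_gap_decreasing[OF x] in auto)
        also have "(\<Sum>k<K. complex_of_real (f (Suc k)) * of_real (lambert_gap x k)) =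
            of_real (\<Sum>k<K. f (Suc k) * lambert_gap x k)" by simp
        also have "lambert_gap x 0 = 1" using x by (simp add: lambert_gap_def diff_divide_distrib[symmetric])
        finally show ?thesis by (simp only: norm_of_real mult_1_right)
      qed
      ultimately show ?thesis by linarith
    qed
    have "(\<lambda>K. (\<Sum>k<K. f (Suc k) / real (Suc k)) / (1 - x) + C + real K * x ^ K / (1 - x)) \<longlonglongrightarrow> 0 / (1 - x) + C + 0 / (1 - x)"
      using zero x unfolding sums_def by (intro tendsto_intros powser_times_n_limit_0) auto
    hence "(\<lambda>K. (\<Sum>k<K. f (Suc k) / real (Suc k)) / (1 - x) + C + real K * x ^ K / (1 - x)) \<longlonglongrightarrow> C" by simp
    from LIMSEQ_le_const[OF this] show ?thesis using main by blast
  qed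
  define J where "J = nat \<lceil>C\<rceil> + 1"
  have "((\<lambda>x::real. \<Sum>j=1..J. x ^ (j ^ 2)) \<longlongrightarrow> (\<Sum>j=1..J. 1 ^ (j ^ 2))) (at_left 1)"
    by (intro tendsto_intros)
  moreover have "eventually (\<lambda>x::real. (\<Sum>j=1..J. x ^ (j ^ 2)) \<le> C) (at_left 1)"
    by (rule eventually_at_leftI[of 0]) (use bound in auto)
  ultimately have "(\<Sum>j=1..J. (1::real) ^ (j ^ 2)) \<le> C" by (intro tendsto_upperbound) auto
  hence "real J \<le> C" by simp
  thus False unfolding J_def by linarith
qed

section \<open>Nonvanishing on the whole line\<close>

context dchar
begin

lemma L_sums:
  assumes "chi \<noteq> principal_character N" "Re s > 0"
  shows "(\<lambda>n. chi (int (Suc n)) * dterm s n) sums L s"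
proof -
  obtain C where C: "\<And>n. norm (\<Sum>k<n. chi (int (Suc k))) \<le> C"
    using zero_sum_periodic_Suc_bounded[OF zero_sum_nonprincipal[OF assms(1)]] by blast
  have "(\<lambda>n. chi (int (Suc n)) * dterm s n) sums
      (\<Sum>n. (\<Sum>j<Suc n. chi (int (Suc j))) * (dterm s n - dterm s (Suc n)))"
    by (rule dseries_by_parts(2)[OF C assms(2)])
  thus ?thesis unfolding L_def dseries_def by (simp only: sums_iff)
qed

lemma L_holomorphic:
  assumes "chi \<noteq> principal_character N"
  shows "L holomorphic_on {s. Re s > 0}"
proof -
  obtain C where "\<And>n. norm (\<Sum>k<n. chi (int (Suc k))) \<le> C"
    using zero_sum_periodic_Suc_bounded[OF zero_sum_nonprincipal[OF assms(1)]] by blast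
  thus ?thesis unfolding L_def by (rule dseries_holomorphic)
qed

lemma L_growth:
  assumes "chi \<noteq> principal_character N" "\<delta> > 0"
  obtains C where "C > 0" "\<And>s. Re s \<ge> \<delta> \<Longrightarrow> norm (L s) \<le> C * norm s"
proof -
  obtain C where C: "\<And>n. norm (\<Sum>k<n. chi (int (Suc k))) \<le> C" "C > 0"
    using zero_sum_periodic_Suc_bounded[OF zero_sum_nonprincipal[OF assms(1)]] by blast
  define K where "K = (\<Sum>n. real (Suc n) powr (- \<delta> - 1))"
  have summ: "summable (\<lambda>n. real (Suc n) powr (- x - 1))" if "x > 0" for x
    using that by (subst summable_Suc_iff) (simp add: summable_real_powr_iff)
  have K: "K > 0" unfolding K_def by (rule suminf_pos[OF summ[OF assms(2)]]) simp
  have "norm (L s) \<le> C * K * norm s" if s: "Re s \<ge> \<delta>" for s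
  proof -
    have "norm (L s) \<le> C * norm s * (\<Sum>n. real (Suc n) powr (- Re s - 1))"
      unfolding L_def by (rule dseries_by_parts(3)[OF C(1)]) (use s assms(2) in linarith)
    also have "\<dots> \<le> C * norm s * K"
      unfolding K_def using s assms(2) C(2)
      by (intro mult_left_mono suminf_le summ powr_mono) auto
    finally show ?thesis by (simp add: mult_ac)
  qed
  thus ?thesis using that[of "C * K"] C(2) K by simp
qed

end

text \<open>Removing the mean c of the coefficients leaves c times zeta, controlled by
  \<open>zeta_bound\<close> off its pole because u \<noteq> 0, and a series with bounded coefficient
  sums.\<close>

lemma principal_L_bounded:
  assumes "dchar N (principal_character N)" and u: "u \<noteq> 0"
  obtains M where "\<And>\<sigma>. 1 < \<sigma> \<Longrightarrow> \<sigma> \<le> 2 \<Longrightarrow> norm (dchar.L (principal_character N) (Complex \<sigma> u)) \<le> M"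
proof -
  interpret dchar N "principal_character N" by fact
  define c where "c = (\<Sum>n<N. principal_character N (int n)) / of_nat N"
  define a where "a = (\<lambda>n. principal_character N (int n) - c)"
  have "zero_sum_periodic N a"
    unfolding zero_sum_periodic_def a_def using N_pos chi_add by (simp add: sum_subtractf c_def)
  then obtain C where C: "\<And>n. norm (\<Sum>k<n. a (Suc k)) \<le> C" "C > 0"
    using zero_sum_periodic_Suc_bounded by blast
  define K where "K = (\<Sum>n. real (Suc n) powr (- 2))"
  define R where "R = 2 + \<bar>u\<bar>"
  have "norm (L (Complex \<sigma> u)) \<le> norm c * (1 / \<bar>u\<bar> + R * K) + C * R * K" if \<sigma>: "1 < \<sigma>" "\<sigma> \<le> 2" for \<sigma>
  proof -
    define s where "s = Complex \<sigma> u"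
    have s: "Re s > 1" using \<sigma> by (simp add: s_def)
    have ns: "norm s \<le> R" using cmod_le[of s] \<sigma> by (simp add: s_def R_def)
    have K0: "K \<ge> 0" unfolding K_def by (intro suminf_nonneg)
      (auto intro: summable_powr_Suc simp del: of_nat_Suc)
    have summ: "summable (\<lambda>n. dterm s n)" using zeta_bound(1)[OF s] by (rule summable_norm_cancel)
    have "(\<lambda>n. a (Suc n) * dterm s n) sums dseries a s"
      using dseries_by_parts(2)[OF C(1), of s] s unfolding dseries_def by (simp add: sums_iff)
    hence "(\<lambda>n. c * dterm s n + a (Suc n) * dterm s n) sums (c * (\<Sum>n. dterm s n) + dseries a s)"
      by (intro sums_add sums_mult summable_sums[OF summ])
    hence "L s = c * (\<Sum>n. dterm s n) + dseries a s"
      unfolding L_def dseries_def by (simp add: a_def algebra_simps sums_iff)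
    hence "norm (L s) \<le> norm c * norm (\<Sum>n. dterm s n) + norm (dseries a s)"
      by (metis norm_mult norm_triangle_ineq)
    moreover have "norm (\<Sum>n. dterm s n) \<le> 1 / \<bar>u\<bar> + R * K"
    proof -
      have "norm (\<Sum>n. dterm s n) \<le> 1 / norm (s - 1) + norm s * K"
        unfolding K_def by (rule zeta_bound(2)[OF s])
      also have "\<dots> \<le> 1 / \<bar>u\<bar> + R * K"
        using abs_Im_le_cmod[of "s - 1"] u ns K0 by (intro add_mono frac_le mult_right_mono) (auto simp: s_def)
      finally show ?thesis .
    qed
    moreover have "norm (dseries a s) \<le> C * R * K"
    proof -
      have "norm (dseries a s) \<le> C * norm s * (\<Sum>n. real (Suc n) powr (- Re s - 1))"
        by (rule dseries_by_parts(3)[OF C(1)]) (use s in linarith)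
      also have "\<dots> \<le> C * R * K"
        unfolding K_def using s C(2) ns
        by (intro mult_mono suminf_le powr_mono suminf_nonneg)
           (auto intro: summable_powr_Suc simp: R_def simp del: of_nat_Suc)
      finally show ?thesis .
    qed
    ultimately show ?thesis unfolding s_def
      by (meson add_mono mult_left_mono norm_ge_zero order.trans)
  qed
  thus ?thesis using that by blast
qed

context dchar
begin

text \<open>A principal square forces the values 0, 1, -1, so the real-valued result applies. This
  is the one case in which the third factor of the 3-4-1 inequality has a pole.\<close>

lemma L_one_nonzero_real:
  assumes np: "chi \<noteq> principal_character N" and sq: "(\<lambda>m. chi m ^ 2) = principal_character N"
  shows "L 1 \<noteq> 0"
proof
  assume L1: "L 1 = 0"
  define f where "f = (\<lambda>n. Re (chi (int n)))"
  have vals: "chi m = 0 \<or> chi m = 1 \<or> chi m = -1" for m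
  proof -
    have "chi m ^ 2 = 0 \<or> chi m ^ 2 = 1" using fun_cong[OF sq, of m] by (auto simp: principal_character_def)
    thus ?thesis by (auto simp: power2_eq_1_iff)
  qed
  have cf: "chi (int n) = of_real (f n)" for n
    using vals[of "int n"] by (elim disjE) (simp_all add: f_def)
  have "of_real (f (m * n)) = complex_of_real (f m * f n)" for m n
    by (simp only: cf[symmetric] of_nat_mult chi_mult of_real_mult)
  hence mult: "f (m * n) = f m * f n" for m n using of_real_eq_iff by blast
  obtain C where C: "\<And>n. norm (\<Sum>k<n. chi (int (Suc k))) \<le> C"
    using zero_sum_periodic_Suc_bounded[OF zero_sum_nonprincipal[OF np]] by blast
  have "\<not> (\<lambda>k. f (Suc k) / real (Suc k)) sums 0"
  proof (rule real_character_sum_nonzero[OF mult])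
    show "f 1 = 1" using chi_1 by (simp add: f_def)
    show "f n = 0 \<or> f n = 1 \<or> f n = -1" for n using vals[of "int n"] by (auto simp: f_def)
    show "norm (\<Sum>k<n. complex_of_real (f (Suc k))) \<le> C" for n
      using C[of n] by (simp only: cf)
  qed
  moreover have "(\<lambda>k. f (Suc k) / real (Suc k)) sums 0"
  proof -
    have "(\<lambda>n. chi (int (Suc n)) * dterm 1 n) sums 0" using L_sums[OF np, of 1] L1 by simp
    moreover have "chi (int (Suc n)) * dterm 1 n = of_real (f (Suc n) / real (Suc n))" for n
    proof -
      have "dterm 1 n = 1 / of_real (real (Suc n))"
        unfolding dterm_def by (simp add: powr_minus_divide del: of_nat_Suc)
      thus ?thesis unfolding cf by (simp del: of_nat_Suc)
    qed
    ultimately have "(\<lambda>n. complex_of_real (f (Suc n) / real (Suc n))) sums of_real 0" by (simp del: of_real_divide)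
    thus ?thesis unfolding sums_of_real_iff .
  qed
  ultimately show False by blast
qed

text \<open>A zero at 1 + i t would make the fourth power of L of size x^4 at abscissa 1 + x,
  against x^(-3) from zeta. The remaining factor stays bounded unless chi^2 is principal and t = 0,
  the case settled before.\<close>

lemma L_nonzero_line:
  assumes np: "chi \<noteq> principal_character N"
  shows "L (Complex 1 t) \<noteq> 0"
proof
  assume L0: "L (Complex 1 t) = 0"
  interpret sq: dchar N "\<lambda>m. chi m ^ 2" by (rule dchar_square)
  have "\<exists>M. \<forall>\<sigma>. 1 < \<sigma> \<and> \<sigma> \<le> 2 \<longrightarrow> norm (sq.L (Complex \<sigma> (2 * t))) \<le> M"
  proof (cases "(\<lambda>m. chi m ^ 2) = principal_character N")
    case True
    hence "t \<noteq> 0" using L_one_nonzero_real[OF np] L0 by (auto simp: one_complex.code)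
    then obtain M where "\<And>\<sigma>. 1 < \<sigma> \<Longrightarrow> \<sigma> \<le> 2 \<Longrightarrow> norm (dchar.L (principal_character N) (Complex \<sigma> (2 * t))) \<le> M"
      using principal_L_bounded[of N "2 * t"] sq.dchar_axioms unfolding True by auto
    thus ?thesis unfolding True by blast
  next
    case False
    then obtain C where C: "C > 0" "\<And>s. Re s \<ge> 1 \<Longrightarrow> norm (sq.L s) \<le> C * norm s"
      using sq.L_growth[of 1] by auto
    have "norm (sq.L (Complex \<sigma> (2 * t))) \<le> C * (2 + \<bar>2 * t\<bar>)" if "1 < \<sigma>" "\<sigma> \<le> 2" for \<sigma>
    proof -
      have "norm (Complex \<sigma> (2 * t)) \<le> 2 + \<bar>2 * t\<bar>" using cmod_le[of "Complex \<sigma> (2 * t)"] that by simp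
      hence "C * norm (Complex \<sigma> (2 * t)) \<le> C * (2 + \<bar>2 * t\<bar>)" using C(1) by simp
      thus ?thesis using C(2)[of "Complex \<sigma> (2 * t)"] that by simp
    qed
    thus ?thesis by blast
  qed
  then obtain M where M: "\<And>\<sigma>. 1 < \<sigma> \<Longrightarrow> \<sigma> \<le> 2 \<Longrightarrow> norm (sq.L (Complex \<sigma> (2 * t))) \<le> M" by blast
  define K where "K = (\<Sum>n. real (Suc n) powr (- 2))"
  define D where "D = deriv L (Complex 1 t)"
  have K0: "K \<ge> 0" unfolding K_def by (intro suminf_nonneg)
    (auto intro: summable_powr_Suc simp del: of_nat_Suc)
  have der: "(L has_field_derivative D) (at (Complex 1 t))"
    unfolding D_def by (rule holomorphic_derivI[OF L_holomorphic[OF np] open_halfspace_Re_gt]) simp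
  have "filterlim (\<lambda>x::real. complex_of_real x) (at 0) (at_right 0)"
    by (auto simp: filterlim_at eventually_at_filter intro!: tendsto_eq_intros)
  with der have "((\<lambda>x::real. (L (Complex 1 t + of_real x) - L (Complex 1 t)) / of_real x) \<longlongrightarrow> D) (at_right 0)"
    unfolding DERIV_def by (rule filterlim_compose)
  hence "((\<lambda>x::real. norm ((L (Complex 1 t + of_real x) - L (Complex 1 t)) / of_real x)) \<longlongrightarrow> norm D) (at_right 0)"
    by (rule tendsto_norm)
  hence ev1: "eventually (\<lambda>x::real. norm ((L (Complex 1 t + of_real x) - L (Complex 1 t)) / of_real x) < norm D + 1) (at_right 0)"
    by (rule order_tendstoD(2)) simp
  define B where "B = norm D + 1"
  have ev2: "eventually (\<lambda>x::real. x \<in> {0<..<1}) (at_right 0)"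
    by (rule eventually_at_right_real) simp
  \<comment> \<open>One power of x is left over from x^4 and x^(-3), so the right side tends to
    0.\<close>
  have "eventually (\<lambda>x::real. 1 \<le> (1 + 2 * K) ^ 3 * B ^ 4 * M * x) (at_right 0)"
    using ev1 ev2
  proof eventually_elim
    case (elim x)
    define \<sigma> where "\<sigma> = 1 + x"
    have x: "0 < x" "x < 1" and \<sigma>: "1 < \<sigma>" "\<sigma> \<le> 2" using elim by (auto simp: \<sigma>_def)
    have "Complex 1 t + of_real x = Complex \<sigma> t" by (simp add: complex_eq_iff \<sigma>_def)
    hence "norm (L (Complex \<sigma> t)) / x < B" using elim L0 x by (simp add: norm_divide B_def)
    hence b1: "norm (L (Complex \<sigma> t)) \<le> B * x" using x by (simp add: divide_less_eq less_imp_le)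
    have "norm (\<Sum>n. dterm (of_real \<sigma>) n) \<le> 1 / norm (complex_of_real \<sigma> - 1) + norm (complex_of_real \<sigma>) * K"
      unfolding K_def by (rule zeta_bound(2)) (use \<sigma> in simp)
    also have "complex_of_real \<sigma> - 1 = of_real x" by (simp add: \<sigma>_def)
    also have "1 / norm (complex_of_real x) + norm (complex_of_real \<sigma>) * K \<le> 1 / x + 2 * K"
      using x \<sigma> K0 by (intro add_mono mult_right_mono) auto
    also have "\<dots> \<le> 1 / x + 2 * K / x"
      using x K0 by (intro add_left_mono) (simp add: le_divide_eq mult_left_le)
    also have "\<dots> = (1 + 2 * K) / x" by (simp add: add_divide_distrib)
    finally have b2: "norm (\<Sum>n. dterm (of_real \<sigma>) n) \<le> (1 + 2 * K) / x" .
    have b3: "norm (sq.L (Complex \<sigma> (2 * t))) \<le> M" by (rule M[OF \<sigma>])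
    have "1 \<le> norm (\<Sum>n. dterm (of_real \<sigma>) n) ^ 3 * norm (L (Complex \<sigma> t)) ^ 4 * norm (sq.L (Complex \<sigma> (2 * t)))"
      by (rule L_three_four_one[OF dchar_axioms \<sigma>(1)])
    also have "\<dots> \<le> ((1 + 2 * K) / x) ^ 3 * (B * x) ^ 4 * M"
      using b1 b2 b3 x K0 by (intro mult_mono power_mono) (auto simp: B_def)
    also have "\<dots> = (1 + 2 * K) ^ 3 * B ^ 4 * M * x"
      using x by (simp add: power_divide power_mult_distrib) (simp add: power4_eq_xxxx power3_eq_cube)
    finally show ?case .
  qed
  moreover have "((\<lambda>x::real. (1 + 2 * K) ^ 3 * B ^ 4 * M * x) \<longlongrightarrow> (1 + 2 * K) ^ 3 * B ^ 4 * M * 0) (at_right 0)"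
    by (intro tendsto_intros)
  ultimately have "1 \<le> (1 + 2 * K) ^ 3 * B ^ 4 * M * 0" by (intro tendsto_lowerbound) auto
  thus False by simp
qed

end

section \<open>Mellin transforms and partial fractions\<close>

lemma scaled_gamma_integral:
  fixes s c :: real
  assumes s: "s > 0" and c: "c > 0"
  shows "((\<lambda>t. t powr (s - 1) * exp (- (c * t))) has_integral Gamma s * c powr (- s)) {0<..}"
proof -
  define f where "f = (\<lambda>t::real. t powr (s - 1) / exp t)"
  have "(f has_integral Gamma s) {0..}" unfolding f_def by (rule Gamma_integral_real[OF s])
  hence f: "(f has_integral Gamma s) {0<..}"
  proof -
    have "{x \<in> {0..} - {0<..}. f x \<noteq> 0} = {}" "{x \<in> {0<..} - {0..}. f x \<noteq> 0} = {}"
      by (auto simp: f_def)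
    hence "(f has_integral Gamma s) {0..} \<longleftrightarrow> (f has_integral Gamma s) {0<..}"
      by (intro has_integral_spike_set_eq) (simp_all only: negligible_empty)
    thus ?thesis using \<open>(f has_integral Gamma s) {0..}\<close> by blast
  qed
  have "f absolutely_integrable_on {0<..} \<and> integral {0<..} f = Gamma s"
    using f by (auto intro!: nonnegative_absolutely_integrable_1 simp: f_def has_integral_iff)
  moreover have im: "(\<lambda>t. c * t) ` {0<..} = {0<..}"
  proof (intro equalityI subsetI)
    fix x assume "x \<in> {0::real<..}"
    thus "x \<in> (\<lambda>t. c * t) ` {0<..}" using c by (intro image_eqI[of _ _ "x / c"]) auto
  qed (use c in auto)
  moreover have "(\<lambda>t. \<bar>c\<bar> * f (c * t)) absolutely_integrable_on {0<..} \<and>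
      integral {0<..} (\<lambda>t. \<bar>c\<bar> * f (c * t)) = Gamma s
     \<longleftrightarrow> f absolutely_integrable_on ((\<lambda>t. c * t) ` {0<..}) \<and> integral ((\<lambda>t. c * t) ` {0<..}) f = Gamma s"
    by (rule has_absolute_integral_change_of_variables_1')
       (use c in \<open>auto intro!: derivative_eq_intros inj_onI\<close>)
  ultimately have "((\<lambda>t. \<bar>c\<bar> * f (c * t)) has_integral Gamma s) {0<..}"
    by (metis has_integral_integrable_integral set_lebesgue_integral_eq_integral(1))
  hence int: "((\<lambda>t. c powr (- s) * (\<bar>c\<bar> * f (c * t))) has_integral c powr (- s) * Gamma s) {0<..}"
    by (rule has_integral_mult_right)
  have eq: "c powr (- s) * (\<bar>c\<bar> * f (c * t)) = t powr (s - 1) * exp (- (c * t))" if "t \<in> {0<..}" for t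
  proof -
    have "c powr (- s) * c * c powr (s - 1) = 1"
      using c by (simp add: powr_minus powr_diff)
    moreover have "c powr (- s) * (\<bar>c\<bar> * f (c * t)) = (c powr (- s) * c * c powr (s - 1)) * (t powr (s - 1) * exp (- (c * t)))"
      using c that by (simp add: f_def powr_mult exp_minus divide_inverse mult_ac)
    ultimately show ?thesis by simp
  qed
  from has_integral_eq[OF eq int] show ?thesis by (simp only: mult.commute[of "Gamma s"])
qed

text \<open>The substitution u = t^2 / (c^2 + t^2) turns the integral into Beta a (1 - a). The
  product of Gamma values is kept as it is, because one of its factors will be absorbed by the
  duplication formula.\<close>

lemma mellin_lorentz:
  fixes a c :: real
  assumes a: "0 < a" "a < 1" and c: "c > 0"
  shows "((\<lambda>t. 2 * t powr (2 * a - 1) / (c\<^sup>2 + t\<^sup>2)) has_integral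
     c powr (2 * a - 2) * (Gamma a * Gamma (1 - a))) {0<..}"
proof -
  define f where "f = (\<lambda>u::real. u powr (a - 1) * (1 - u) powr ((1 - a) - 1))"
  define g where "g = (\<lambda>t::real. t\<^sup>2 / (c\<^sup>2 + t\<^sup>2))"
  define g' where "g' = (\<lambda>t::real. 2 * t * c\<^sup>2 / (c\<^sup>2 + t\<^sup>2)\<^sup>2)"
  have D: "c\<^sup>2 + t\<^sup>2 > 0" for t using c by (intro add_pos_nonneg) auto
  have "(f has_integral Beta a (1 - a)) {0..1}"
    unfolding f_def by (rule has_integral_Beta_real) (use a in auto)
  hence f: "(f has_integral Beta a (1 - a)) {0<..<1}" by (simp add: has_integral_Icc_iff_Ioo)
  hence "f absolutely_integrable_on {0<..<1} \<and> integral {0<..<1} f = Beta a (1 - a)"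
    by (auto intro!: nonnegative_absolutely_integrable_1 simp: f_def has_integral_iff)
  moreover have g1: "1 - g t = c\<^sup>2 / (c\<^sup>2 + t\<^sup>2)" for t
  proof -
    have "c\<^sup>2 / (c\<^sup>2 + t\<^sup>2) + t\<^sup>2 / (c\<^sup>2 + t\<^sup>2) = 1" 
      using less_imp_neq[OF D[of t]] by (simp only: add_divide_distrib[symmetric] divide_self not_sym simp_thms)
    thus ?thesis unfolding g_def by linarith
  qed
  have im: "g ` {0<..} = {0<..<1}"
  proof (intro equalityI subsetI)
    fix u assume "u \<in> g ` {0<..}"
    then obtain t where t: "t > 0" "u = g t" by auto
    have "g t > 0" using t D[of t] by (simp add: g_def)
    moreover have "1 - g t > 0" unfolding g1 using c D[of t] by simp
    ultimately show "u \<in> {0<..<1}" using t by simp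
  next
    fix u :: real assume u: "u \<in> {0<..<1}"
    define t where "t = c * sqrt (u / (1 - u))"
    have t: "t > 0" using u c by (simp add: t_def)
    have "t\<^sup>2 = c\<^sup>2 * (u / (1 - u))" using u by (simp add: t_def power_mult_distrib)
    hence "t\<^sup>2 * (1 - u) = c\<^sup>2 * u" using u by simp
    hence "t\<^sup>2 = u * (c\<^sup>2 + t\<^sup>2)" by (simp add: algebra_simps)
    hence "g t = u * (c\<^sup>2 + t\<^sup>2) / (c\<^sup>2 + t\<^sup>2)" unfolding g_def by (rule arg_cong[where f="\<lambda>x. x / (c\<^sup>2 + t\<^sup>2)"])
    also have "\<dots> = u" using less_imp_neq[OF D[of t]] by (intro nonzero_mult_div_cancel_right) auto
    finally have "g t = u" .
    thus "u \<in> g ` {0<..}" using t by auto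
  qed
  have inj: "inj_on g {0<..}"
  proof (rule inj_onI)
    fix x y :: real assume h: "x \<in> {0<..}" "y \<in> {0<..}" "g x = g y"
    have "c\<^sup>2 / (c\<^sup>2 + x\<^sup>2) = c\<^sup>2 / (c\<^sup>2 + y\<^sup>2)" using h(3) by (simp only: g1[symmetric])
    hence "x\<^sup>2 = y\<^sup>2" using c D[of x] D[of y] by (simp add: frac_eq_eq)
    thus "x = y" using h by (simp add: power2_eq_iff_nonneg)
  qed
  have der: "(g has_field_derivative g' t) (at t within {0<..})" for t
  proof -
    have "(g has_field_derivative ((2 * t) * (c\<^sup>2 + t\<^sup>2) - t\<^sup>2 * (2 * t)) / ((c\<^sup>2 + t\<^sup>2) * (c\<^sup>2 + t\<^sup>2))) (at t within {0<..})"
    proof -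
      have "((\<lambda>t. t\<^sup>2) has_field_derivative 2 * t) (at t within {0<..})"
        "((\<lambda>t. c\<^sup>2 + t\<^sup>2) has_field_derivative 2 * t) (at t within {0<..})"
        by (auto intro!: derivative_eq_intros)
      thus ?thesis unfolding g_def by (rule DERIV_divide) (use less_imp_neq[OF D[of t]] in metis)
    qed
    also have "((2 * t) * (c\<^sup>2 + t\<^sup>2) - t\<^sup>2 * (2 * t)) / ((c\<^sup>2 + t\<^sup>2) * (c\<^sup>2 + t\<^sup>2)) = g' t"
      unfolding g'_def by (simp add: power2_eq_square algebra_simps)
    finally show ?thesis .
  qed
  have "(\<lambda>t. \<bar>g' t\<bar> * f (g t)) absolutely_integrable_on {0<..} \<and>
      integral {0<..} (\<lambda>t. \<bar>g' t\<bar> * f (g t)) = Beta a (1 - a)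
     \<longleftrightarrow> f absolutely_integrable_on (g ` {0<..}) \<and> integral (g ` {0<..}) f = Beta a (1 - a)"
    by (rule has_absolute_integral_change_of_variables_1'[OF _ der inj]) auto
  ultimately have "((\<lambda>t. \<bar>g' t\<bar> * f (g t)) has_integral Beta a (1 - a)) {0<..}"
    unfolding im by (metis has_integral_integrable_integral set_lebesgue_integral_eq_integral(1))
  hence int: "((\<lambda>t. c powr (2 * a - 2) * (\<bar>g' t\<bar> * f (g t))) has_integral c powr (2 * a - 2) * Beta a (1 - a)) {0<..}"
    by (rule has_integral_mult_right)
  have eq: "c powr (2 * a - 2) * (\<bar>g' t\<bar> * f (g t)) = 2 * t powr (2 * a - 1) / (c\<^sup>2 + t\<^sup>2)" if "t \<in> {0<..}" for t
  proof -
    define d where "d = c\<^sup>2 + t\<^sup>2"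
    have d: "d > 0" using D by (simp add: d_def)
    have t: "t > 0" using that by simp
    have p2: "(x\<^sup>2) powr y = x powr (2 * y)" if "x > 0" for x y :: real
      using that by (simp add: powr_powr flip: powr_numeral)
    have "f (g t) = (t powr (2 * (a - 1)) / d powr (a - 1)) * (c powr (2 * (- a)) / d powr (- a))"
      unfolding f_def g1 unfolding g_def d_def[symmetric] using t c d
      by (simp add: powr_divide p2)
    also have "\<dots> = t powr (2 * a - 2) * c powr (- (2 * a)) * (d powr a / d powr (a - 1))"
      by (simp add: powr_minus divide_inverse algebra_simps)
    also have "d powr a / d powr (a - 1) = d" using d by (simp flip: powr_diff)
    finally have fg: "f (g t) = t powr (2 * a - 2) * c powr (- (2 * a)) * d" .
    have "\<bar>g' t\<bar> = 2 * t * c\<^sup>2 / d\<^sup>2" unfolding g'_def d_def[symmetric] using t by simp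
    hence "c powr (2 * a - 2) * (\<bar>g' t\<bar> * f (g t)) =
       (c powr (2 * a - 2) * c\<^sup>2 * c powr (- (2 * a))) * (2 * (t powr (2 * a - 2) * t)) * (d / d\<^sup>2)"
      unfolding fg by simp
    also have "c powr (2 * a - 2) * c\<^sup>2 * c powr (- (2 * a)) = 1"
      using c by (simp add: powr_minus powr_diff)
    also have "t powr (2 * a - 2) * t = t powr (2 * a - 1)"
      using t powr_add[of t "2 * a - 2" 1] by simp
    also have "d / d\<^sup>2 = 1 / d" using d by (simp add: power2_eq_square)
    finally show ?thesis by (simp add: d_def)
  qed
  have "Beta a (1 - a) = Gamma a * Gamma (1 - a)"
    by (simp add: Beta_def)
  with has_integral_eq[OF eq int] show ?thesis by (simp only:)
qed

section \<open>Partial fractions of the character series\<close>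

text \<open>The logarithmic derivative of the reflection formula for Gamma, with the limit formula
  for Digamma at z and at 1 - z.\<close>

lemma cot_partial_fractions:
  fixes z :: complex
  assumes "z \<notin> \<int>"
  shows "(\<lambda>m. \<Sum>n<m. 1 / (z + of_nat n) - 1 / (1 - z + of_nat n)) \<longlonglongrightarrow>
     of_real pi * cos (of_real pi * z) / sin (of_real pi * z)"
proof -
  have z: "z \<notin> \<int>\<^sub>\<le>\<^sub>0" "1 - z \<notin> \<int>\<^sub>\<le>\<^sub>0" "z \<noteq> 0" "1 - z \<noteq> 0"
    using assms nonpos_Ints_subset_Ints Ints_diff[of 1 "1 - z"] by auto
  have s0: "sin (of_real pi * z) \<noteq> 0"
  proof
    assume "sin (of_real pi * z) = 0"
    then obtain n :: int where "of_real pi * z = of_real (of_int n * pi)"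
      using sin_eq_0[of "of_real pi * z"] by blast
    hence "z = of_int n" by simp
    thus False using assms by simp
  qed
  have "(\<lambda>m. (of_real (ln (real m)) - (\<Sum>n<m. inverse (1 - z + of_nat n))) -
       (of_real (ln (real m)) - (\<Sum>n<m. inverse (z + of_nat n)))) \<longlonglongrightarrow> Digamma (1 - z) - Digamma z"
    by (intro tendsto_diff Digamma_LIMSEQ z)
  hence lim: "(\<lambda>m. \<Sum>n<m. 1 / (z + of_nat n) - 1 / (1 - z + of_nat n)) \<longlonglongrightarrow> Digamma (1 - z) - Digamma z"
    by (simp add: sum_subtractf divide_inverse)
  have "((\<lambda>z. Gamma z * Gamma (1 - z)) has_field_derivative
      (Gamma z * Digamma z) * Gamma (1 - z) + (Gamma (1 - z) * Digamma (1 - z) * (- 1)) * Gamma z) (at z)"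
    by (intro DERIV_mult has_field_derivative_Gamma z DERIV_chain2[where f=Gamma])
       (auto intro!: derivative_eq_intros)
  moreover have "((\<lambda>z. of_real pi / sin (of_real pi * z)) has_field_derivative
      (0 * sin (of_real pi * z) - of_real pi * (cos (of_real pi * z) * of_real pi)) / (sin (of_real pi * z) * sin (of_real pi * z))) (at z)"
    by (intro DERIV_divide s0) (auto intro!: derivative_eq_intros)
  ultimately have "(Gamma z * Digamma z) * Gamma (1 - z) + (Gamma (1 - z) * Digamma (1 - z) * (- 1)) * Gamma z =
     (0 * sin (of_real pi * z) - of_real pi * (cos (of_real pi * z) * of_real pi)) / (sin (of_real pi * z) * sin (of_real pi * z))"
    unfolding Gamma_reflection_complex by (rule DERIV_unique)
  hence "(Gamma z * Gamma (1 - z)) * (Digamma (1 - z) - Digamma z) =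
     (of_real pi / sin (of_real pi * z)) * (of_real pi * cos (of_real pi * z) / sin (of_real pi * z))"
    by (simp add: algebra_simps)
  hence "Digamma (1 - z) - Digamma z = of_real pi * cos (of_real pi * z) / sin (of_real pi * z)"
    unfolding Gamma_reflection_complex using s0 by (subst (asm) mult_cancel_left) auto
  thus ?thesis using lim by simp
qed

text \<open>The cotangent expansion at z = w / (2 pi i), divided by 2 pi i; z is not an integer
  because Re w > 0. The poles n and -(n + 1) are paired, as in the expansion used.\<close>

lemma exp_partial_fractions:
  fixes w :: complex
  assumes w: "Re w > 0"
  shows "(\<lambda>m. \<Sum>n<m. 1 / (w + 2 * of_real pi * \<i> * of_nat n) + 1 / (w - 2 * of_real pi * \<i> * of_nat (Suc n)))
     \<longlonglongrightarrow> 1 / (1 - exp (- w)) - 1 / 2"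
proof -
  define k where "k = 2 * of_real pi * \<i>"
  have k0: "k \<noteq> 0" by (simp add: k_def)
  define z where "z = w / k"
  have wz: "w = k * z" using k0 by (simp add: z_def)
  have "Im z \<noteq> 0"
  proof
    assume "Im z = 0"
    hence "Re w = 0" unfolding wz k_def by simp
    thus False using w by simp
  qed
  hence zI: "z \<notin> \<int>" by (auto elim!: Ints_cases)
  define q where "q = exp (- w)"
  have q1: "q \<noteq> 1"
  proof
    assume "q = 1"
    hence "norm q = 1" by simp
    thus False using w by (simp add: q_def)
  qed
  define e where "e = exp (\<i> * (of_real pi * z))"
  have e0: "e \<noteq> 0" by (simp add: e_def)
  have "- w = - (\<i> * (of_real pi * z)) + - (\<i> * (of_real pi * z))" by (simp add: wz k_def)
  hence "q = exp (- (\<i> * (of_real pi * z))) * exp (- (\<i> * (of_real pi * z)))"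
    unfolding q_def by (simp only: exp_add)
  hence qe: "exp (- (\<i> * (of_real pi * z))) = q * e" using e0 by (simp add: e_def exp_minus)
  have c: "cos (of_real pi * z) = e * (1 + q) / 2" "sin (of_real pi * z) = e * (1 - q) / (2 * \<i>)"
    unfolding cos_exp_eq sin_exp_eq qe e_def[symmetric] by (simp_all add: algebra_simps)
  have "of_real pi * cos (of_real pi * z) / sin (of_real pi * z) / k = (1 + q) / (1 - q) / 2"
    unfolding c k_def using e0 q1 by (simp add: divide_simps) (simp add: algebra_simps)
  also have "\<dots> = 1 / (1 - q) - 1 / 2"
    using q1 by (simp add: divide_simps)
  finally have val: "of_real pi * cos (of_real pi * z) / sin (of_real pi * z) / k = 1 / (1 - q) - 1 / 2" .
  have "(\<lambda>m. (\<Sum>n<m. 1 / (z + of_nat n) - 1 / (1 - z + of_nat n)) / k) \<longlonglongrightarrow> 1 / (1 - q) - 1 / 2"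
    unfolding val[symmetric] by (intro tendsto_divide cot_partial_fractions[OF zI] tendsto_const k0)
  moreover have "(\<Sum>n<m. 1 / (z + of_nat n) - 1 / (1 - z + of_nat n)) / k =
     (\<Sum>n<m. 1 / (w + k * of_nat n) + 1 / (w - k * of_nat (Suc n)))" for m
    unfolding sum_divide_distrib
  proof (intro sum.cong refl)
    fix n
    have "w + k * of_nat n = k * (z + of_nat n)" "w - k * of_nat (Suc n) = k * (- (1 - z + of_nat n))"
      by (simp_all add: wz algebra_simps)
    moreover have "(1 / A - 1 / B) / k = 1 / (k * A) + 1 / (k * (- B))" for A B :: complex
      by (simp add: diff_divide_distrib mult.commute)
    ultimately show "(1 / (z + of_nat n) - 1 / (1 - z + of_nat n)) / k = 1 / (w + k * of_nat n) + 1 / (w - k * of_nat (Suc n))"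
      by (simp only:)
  qed
  ultimately show ?thesis by (simp add: k_def q_def)
qed

context dchar
begin

text \<open>Primitivity writes the Gauss sum times chi n as a combination of N-th roots of unity,
  which splits the series into N geometric ones. The sum may start at n = 1 because chi 0 =
  0.\<close>

lemma lambert_series_gauss:
  assumes prim: "primitive_dirichlet_character N chi" and N: "N > 1" and t: "t > 0"
  shows "(\<lambda>n. gauss_sum 1 * (chi (int (Suc n)) * of_real (exp (- (real (Suc n) * t))))) sums
    (\<Sum>b<N. cnj (chi (int b)) / (1 - exp (- (of_real t + of_real (2 * pi / N) * of_nat b * \<i>))))"
proof -
  define q where "q = (\<lambda>b::nat. exp (- (of_real t + of_real (2 * pi / N) * of_nat b * \<i>)))"
  have qpow: "q b ^ n = of_real (exp (- (real n * t))) * unit_root (int b * int n)" for b n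
  proof -
    have "q b ^ n = exp (of_nat n * (- (of_real t + of_real (2 * pi / N) * of_nat b * \<i>)))"
      by (simp only: q_def exp_of_nat_mult)
    also have "of_nat n * (- (of_real t + of_real (2 * pi / N) * of_nat b * \<i>)) =
        of_real (- (real n * t)) + \<i> * of_real (- 2 * pi * of_int (int b * int n) / real N)"
      by (simp add: algebra_simps)
    also have "exp \<dots> = of_real (exp (- (real n * t))) * unit_root (int b * int n)"
      unfolding exp_add unit_root_def cis_conv_exp exp_of_real ..
    finally show ?thesis .
  qed
  have nq: "norm (q b) < 1" for b using t by (simp add: q_def)
  have "(\<lambda>n. \<Sum>b<N. cnj (chi (int b)) * q b ^ n) sums (\<Sum>b<N. cnj (chi (int b)) * (1 / (1 - q b)))"
    by (intro sums_sum sums_mult geometric_sums nq)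
  moreover have "(\<Sum>b<N. cnj (chi (int b)) * q b ^ n) = gauss_sum 1 * (chi (int n) * of_real (exp (- (real n * t))))" for n
  proof -
    have "(\<Sum>b<N. cnj (chi (int b)) * q b ^ n) = of_real (exp (- (real n * t))) * gauss_sum (int n)"
      unfolding qpow gauss_sum_def sum_int_lessThan sum_distrib_left by (intro sum.cong refl) (simp add: mult_ac)
    thus ?thesis unfolding gauss_sum_primitive[OF prim, of "int n"] by (simp add: mult_ac)
  qed
  ultimately have "(\<lambda>n. gauss_sum 1 * (chi (int n) * of_real (exp (- (real n * t))))) sums
      (\<Sum>b<N. cnj (chi (int b)) / (1 - q b))" by simp
  moreover have "chi 0 = 0" using chi_nz[of 0] N by simp
  ultimately have "(\<lambda>n. gauss_sum 1 * (chi (int (Suc n)) * of_real (exp (- (real (Suc n) * t))))) sums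
      (\<Sum>b<N. cnj (chi (int b)) / (1 - q b))"
    by (subst sums_Suc_iff) simp
  thus ?thesis by (simp only: q_def)
qed

text \<open>The partial fractions of index k + 1 and -(k + 1), joined by the parity of the
  character. The result is real for an even and imaginary for an odd character.\<close>

definition kernel :: "nat \<Rightarrow> real \<Rightarrow> complex" where
  "kernel k t = 1 / (of_real t + \<i> * of_real (2 * pi / N * real (Suc k))) +
     chi (-1) / (of_real t - \<i> * of_real (2 * pi / N * real (Suc k)))"

text \<open>Expanding 1 / (1 - exp (- w)) for each residue b and regrouping by the index n N + b.
  Only partial sums of length m N arise, since the residue classes are truncated together.\<close>

lemma kernel_sum_tendsto:
  assumes prim: "primitive_dirichlet_character N chi" and np: "chi \<noteq> principal_character N" and t: "t > 0"
  shows "(\<lambda>m. \<Sum>k<m * N. cnj (chi (int (Suc k))) * kernel k t) \<longlonglongrightarrow>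
    gauss_sum 1 * (\<Sum>n. chi (int (Suc n)) * of_real (exp (- (real (Suc n) * t))))"
proof -
  note N = nonprincipal_N[OF np]
  define \<delta> where "\<delta> = 2 * pi / N"
  define w where "w = (\<lambda>b::nat. of_real t + of_real \<delta> * of_nat b * \<i>)"
  have \<delta>N: "of_real \<delta> * of_nat N = complex_of_real (2 * pi)" using N by (simp add: \<delta>_def)
  have c0: "(\<Sum>b<N. cnj (chi (int b))) = 0"
  proof -
    have "(\<Sum>b<N. chi (int b)) = 0" using zero_sum_nonprincipal[OF np] by (simp add: zero_sum_periodic_def)
    hence "cnj (\<Sum>b<N. chi (int b)) = 0" by simp
    thus ?thesis by simp
  qed
  have chi0: "chi 0 = 0" using chi_nz[of 0] N by simp
  have summ: "summable (\<lambda>n. chi (int (Suc n)) * of_real (exp (- (real (Suc n) * t))))"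
  proof (rule summable_comparison_test'[where N=0])
    show "summable (\<lambda>n. exp (- t) ^ n)" using t by (intro summable_geometric) simp
    fix n
    have "exp (- (real (Suc n) * t)) \<le> exp (real n * (- t))" using t by (simp add: algebra_simps)
    thus "norm (chi (int (Suc n)) * of_real (exp (- (real (Suc n) * t)))) \<le> exp (- t) ^ n"
      using norm_chi_le[of "int (Suc n)"] unfolding norm_mult norm_of_real exp_of_nat_mult[symmetric]
      by (metis abs_exp_cancel exp_ge_zero mult_left_le_one_le norm_ge_zero order.trans)
  qed
  have val: "gauss_sum 1 * (\<Sum>n. chi (int (Suc n)) * of_real (exp (- (real (Suc n) * t)))) =
      (\<Sum>b<N. cnj (chi (int b)) * (1 / (1 - exp (- w b)) - 1 / 2))"
  proof -
    have "gauss_sum 1 * (\<Sum>n. chi (int (Suc n)) * of_real (exp (- (real (Suc n) * t)))) =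
       (\<Sum>b<N. cnj (chi (int b)) / (1 - exp (- w b)))"
      using sums_unique2[OF sums_mult[OF summable_sums[OF summ]] lambert_series_gauss[OF prim N t]]
      by (simp only: w_def \<delta>_def)
    \<comment> \<open>The constant 1/2 of the expansion can be inserted freely, because the
      character values sum to 0.\<close>
    also have "\<dots> = (\<Sum>b<N. cnj (chi (int b)) / (1 - exp (- w b))) - (\<Sum>b<N. cnj (chi (int b))) / 2"
      using c0 by simp
    also have "\<dots> = (\<Sum>b<N. cnj (chi (int b)) * (1 / (1 - exp (- w b)) - 1 / 2))"
      by (simp only: sum_divide_distrib sum_subtractf[symmetric] right_diff_distrib times_divide_eq_right mult_1_right)
    finally show ?thesis .
  qed
  define g where "g = (\<lambda>k::nat. cnj (chi (int k)) / (of_real t + \<i> * of_real (\<delta> * real k)))"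
  define h where "h = (\<lambda>k::nat. cnj (chi (int (Suc k))) * (chi (-1) / (of_real t - \<i> * of_real (\<delta> * real (Suc k)))))"
  have e1: "(\<Sum>n<m. \<Sum>b<N. cnj (chi (int b)) / (w b + 2 * of_real pi * \<i> * of_nat n)) = (\<Sum>k<m * N. g k)" for m
  proof -
    have "(\<Sum>k<m * N. g k) = (\<Sum>n<m. \<Sum>k=n * N..<n * N + N. g k)" by (rule sum.nat_group[symmetric])
    also have "\<dots> = (\<Sum>n<m. \<Sum>b<N. cnj (chi (int b)) / (w b + 2 * of_real pi * \<i> * of_nat n))"
    proof (rule sum.cong[OF refl])
      fix n
      have "(\<Sum>k=n * N..<n * N + N. g k) = (\<Sum>b<N. g (n * N + b))"
        by (rule sum.reindex_bij_witness[of _ "\<lambda>b. n * N + b" "\<lambda>k. k - n * N"]) auto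
      also have "\<dots> = (\<Sum>b<N. cnj (chi (int b)) / (w b + 2 * of_real pi * \<i> * of_nat n))"
      proof (intro sum.cong refl)
        fix b
        have "chi (int (n * N + b)) = chi (int b)" using chi_add_mult[of "int b" "int n"] by (simp add: add.commute)
        moreover have "of_real t + \<i> * of_real (\<delta> * real (n * N + b)) = w b + 2 * of_real pi * \<i> * of_nat n"
        proof -
          have "of_real t + \<i> * of_real (\<delta> * real (n * N + b)) = w b + (of_real \<delta> * of_nat N) * \<i> * of_nat n"
            by (simp add: w_def algebra_simps)
          thus ?thesis unfolding \<delta>N by simp
        qed
        ultimately show "g (n * N + b) = cnj (chi (int b)) / (w b + 2 * of_real pi * \<i> * of_nat n)"
          by (simp only: g_def)
      qed
      finally show "(\<Sum>k=n * N..<n * N + N. g k) = (\<Sum>b<N. cnj (chi (int b)) / (w b + 2 * of_real pi * \<i> * of_nat n))" .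
    qed
    finally show ?thesis ..
  qed
  \<comment> \<open>Here the pole index is (n + 1) N - b, so each block is traversed backwards, and
    passing from -b to b produces chi (-1).\<close>
  have e2: "(\<Sum>n<m. \<Sum>b<N. cnj (chi (int b)) / (w b - 2 * of_real pi * \<i> * of_nat (Suc n))) = (\<Sum>k<m * N. h k)" for m
  proof -
    have "(\<Sum>k<m * N. h k) = (\<Sum>n<m. \<Sum>k=n * N..<n * N + N. h k)" by (rule sum.nat_group[symmetric])
    also have "\<dots> = (\<Sum>n<m. \<Sum>b<N. cnj (chi (int b)) / (w b - 2 * of_real pi * \<i> * of_nat (Suc n)))"
    proof (rule sum.cong[OF refl])
      fix n
      have "(\<Sum>k=n * N..<n * N + N. h k) = (\<Sum>b<N. h (n * N + (N - Suc b)))"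
        by (rule sum.reindex_bij_witness[of _ "\<lambda>b. n * N + (N - Suc b)" "\<lambda>k. N - Suc (k - n * N)"]) auto
      also have "\<dots> = (\<Sum>b<N. cnj (chi (int b)) / (w b - 2 * of_real pi * \<i> * of_nat (Suc n)))"
      proof (intro sum.cong refl)
        fix b assume b: "b \<in> {..<N}"
        define j where "j = Suc (n * N + (N - Suc b))"
        have j: "int j = - int b + int (Suc n) * int N" using b by (simp add: j_def algebra_simps of_nat_diff)
        have rj: "real j = real (Suc n) * real N - real b" using b by (simp add: j_def algebra_simps of_nat_diff)
        have "chi (int j) = chi (-1) * chi (int b)" unfolding j chi_add_mult by (rule chi_minus)
        hence "cnj (chi (int j)) * chi (-1) = cnj (chi (int b))" using parity_cases by auto
        moreover have "of_real t - \<i> * of_real (\<delta> * real j) = w b - 2 * of_real pi * \<i> * of_nat (Suc n)"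
        proof -
          have "of_real t - \<i> * of_real (\<delta> * real j) = w b - (of_real \<delta> * of_nat N) * \<i> * of_nat (Suc n)"
            unfolding rj by (simp add: w_def algebra_simps)
          thus ?thesis unfolding \<delta>N by simp
        qed
        ultimately show "h (n * N + (N - Suc b)) = cnj (chi (int b)) / (w b - 2 * of_real pi * \<i> * of_nat (Suc n))"
          unfolding h_def j_def[symmetric] by (metis times_divide_eq_right)
      qed
      finally show "(\<Sum>k=n * N..<n * N + N. h k) = (\<Sum>b<N. cnj (chi (int b)) / (w b - 2 * of_real pi * \<i> * of_nat (Suc n)))" .
    qed
    finally show ?thesis ..
  qed
  \<comment> \<open>The end terms at 0 and at m N vanish with the character, which allows the shift
    to k + 1.\<close>
  have e3: "(\<Sum>k<m * N. g k) = (\<Sum>k<m * N. g (Suc k))" for m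
  proof -
    have "chi (int (m * N)) = 0" using chi_add_mult[of 0 "int m"] chi0 by simp
    hence "g (m * N) = 0" "g 0 = 0" using chi0 by (simp_all add: g_def)
    thus ?thesis using sum.lessThan_Suc_shift[of g "m * N"] sum.lessThan_Suc[of g "m * N"] by simp
  qed
  have "(\<lambda>m. \<Sum>b<N. cnj (chi (int b)) * (\<Sum>n<m. 1 / (w b + 2 * of_real pi * \<i> * of_nat n) + 1 / (w b - 2 * of_real pi * \<i> * of_nat (Suc n))))
      \<longlonglongrightarrow> (\<Sum>b<N. cnj (chi (int b)) * (1 / (1 - exp (- w b)) - 1 / 2))"
    by (intro tendsto_sum tendsto_mult tendsto_const exp_partial_fractions) (simp add: w_def t)
  moreover have "(\<Sum>b<N. cnj (chi (int b)) * (\<Sum>n<m. 1 / (w b + 2 * of_real pi * \<i> * of_nat n) + 1 / (w b - 2 * of_real pi * \<i> * of_nat (Suc n)))) =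
      (\<Sum>k<m * N. cnj (chi (int (Suc k))) * kernel k t)" for m
  proof -
    have "(\<Sum>b<N. cnj (chi (int b)) * (\<Sum>n<m. 1 / (w b + 2 * of_real pi * \<i> * of_nat n) + 1 / (w b - 2 * of_real pi * \<i> * of_nat (Suc n)))) =
      (\<Sum>b<N. \<Sum>n<m. cnj (chi (int b)) / (w b + 2 * of_real pi * \<i> * of_nat n) + cnj (chi (int b)) / (w b - 2 * of_real pi * \<i> * of_nat (Suc n)))"
      by (simp only: sum_distrib_left distrib_left times_divide_eq_right mult_1_right)
    also have "\<dots> = (\<Sum>n<m. \<Sum>b<N. cnj (chi (int b)) / (w b + 2 * of_real pi * \<i> * of_nat n) + cnj (chi (int b)) / (w b - 2 * of_real pi * \<i> * of_nat (Suc n)))"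
      by (rule sum.swap)
    also have "\<dots> = (\<Sum>k<m * N. g (Suc k)) + (\<Sum>k<m * N. h k)"
      by (simp only: sum.distrib e1 e2 e3)
    also have "\<dots> = (\<Sum>k<m * N. cnj (chi (int (Suc k))) * kernel k t)"
      unfolding sum.distrib[symmetric] kernel_def g_def h_def \<delta>_def
      by (simp only: distrib_left times_divide_eq_right mult_1_right)
    finally show ?thesis .
  qed
  ultimately show ?thesis unfolding val by simp
qed

end

section \<open>The functional equation on the unit interval\<close>

lemma of_real_dterm: "dterm (of_real s) n = of_real (real (Suc n) powr (- s))"
  unfolding dterm_def by (simp add: powr_of_real[symmetric] del: of_nat_Suc)

text \<open>Splits a power of r between two smaller quantities, so that decay in t can be traded for
  decay in the summation index.\<close>

lemma powr_mult_le:
  fixes t c r \<alpha> \<beta> :: real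
  assumes "0 < t" "t \<le> r" "0 < c" "c \<le> r" "\<alpha> \<ge> 0" "\<beta> \<ge> 0"
  shows "t powr \<alpha> * c powr \<beta> \<le> r powr (\<alpha> + \<beta>)"
  unfolding powr_add using assms by (intro mult_mono powr_mono2) auto

context dchar
begin

text \<open>For 0 < s \<le> 1 the series need not converge absolutely. Bounded character sums
  against decreasing exponentials still give C exp (- t) for all partial sums at once, which is
  integrable against t^(s-1).\<close>

lemma gamma_L_integral:
  assumes np: "chi \<noteq> principal_character N" and s: "s > 0"
  shows "((\<lambda>t. of_real (t powr (s - 1)) * (\<Sum>n. chi (int (Suc n)) * of_real (exp (- (real (Suc n) * t)))))
     has_integral of_real (Gamma s) * L (of_real s)) {0<..}"
proof -
  define F where "F = (\<lambda>K t. \<Sum>k<K. chi (int (Suc k)) * of_real (t powr (s - 1) * exp (- (real (Suc k) * t))))"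
  define g where "g = (\<lambda>t. complex_of_real (t powr (s - 1)) * (\<Sum>n. chi (int (Suc n)) * of_real (exp (- (real (Suc n) * t)))))"
  have int: "(F K has_integral (\<Sum>k<K. chi (int (Suc k)) * of_real (Gamma s * real (Suc k) powr (- s)))) {0<..}" for K
    unfolding F_def
  proof (intro has_integral_sum has_integral_mult_right)
    fix k
    show "((\<lambda>t. complex_of_real (t powr (s - 1) * exp (- (real (Suc k) * t)))) has_integral
        of_real (Gamma s * real (Suc k) powr (- s))) {0<..}"
      by (rule has_integral_linear[OF scaled_gamma_integral bounded_linear_of_real, unfolded o_def]) (use s in auto)
  qed auto
  obtain C where C: "\<And>n. norm (\<Sum>k<n. chi (int (Suc k))) \<le> C"
    using zero_sum_periodic_Suc_bounded[OF zero_sum_nonprincipal[OF np]] by blast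
  define h where "h = (\<lambda>t::real. C * (t powr (s - 1) * exp (- (1 * t))))"
  have h: "h integrable_on {0<..}"
    unfolding h_def using has_integral_mult_right[OF scaled_gamma_integral[OF s zero_less_one], of C] by blast
  have le: "norm (F K t) \<le> h t" if "t \<in> {0<..}" for K t
  proof -
    have t: "t > 0" using that by simp
    have "F K t = of_real (t powr (s - 1)) * (\<Sum>k<K. chi (int (Suc k)) * of_real (exp (- (real (Suc k) * t))))"
      unfolding F_def sum_distrib_left by (intro sum.cong refl) simp
    hence "norm (F K t) = t powr (s - 1) * norm (\<Sum>k<K. chi (int (Suc k)) * of_real (exp (- (real (Suc k) * t))))"
      by (simp add: norm_mult)
    also have "\<dots> \<le> t powr (s - 1) * (C * exp (- (real (Suc 0) * t)))"
      by (intro mult_left_mono norm_sum_decreasing_le[OF C]) (use t in auto)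
    also have "\<dots> = h t" by (simp add: h_def mult_ac)
    finally show ?thesis .
  qed
  have conv: "(\<lambda>K. F K t) \<longlonglongrightarrow> g t" if "t \<in> {0<..}" for t
  proof -
    have t: "t > 0" using that by simp
    have "summable (\<lambda>n. chi (int (Suc n)) * of_real (exp (- (real (Suc n) * t))))"
    proof (rule summable_comparison_test'[where N=0])
      show "summable (\<lambda>n. exp (- t) ^ n)" using t by (intro summable_geometric) simp
      fix n
      have "norm (chi (int (Suc n)) * of_real (exp (- (real (Suc n) * t)))) \<le> 1 * exp (- (real (Suc n) * t))"
        unfolding norm_mult by (intro mult_mono norm_chi_le) auto
      also have "\<dots> \<le> exp (real n * (- t))" using t by (simp add: algebra_simps)
      finally show "norm (chi (int (Suc n)) * of_real (exp (- (real (Suc n) * t)))) \<le> exp (- t) ^ n"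
        by (simp only: exp_of_nat_mult)
    qed
    hence "(\<lambda>n. of_real (t powr (s - 1)) * (chi (int (Suc n)) * of_real (exp (- (real (Suc n) * t))))) sums g t"
      unfolding g_def by (intro sums_mult summable_sums)
    moreover have "(\<lambda>n. of_real (t powr (s - 1)) * (chi (int (Suc n)) * of_real (exp (- (real (Suc n) * t))))) =
       (\<lambda>n. chi (int (Suc n)) * of_real (t powr (s - 1) * exp (- (real (Suc n) * t))))"
      by (rule ext) (simp only: of_real_mult mult_ac)
    ultimately have "(\<lambda>n. chi (int (Suc n)) * of_real (t powr (s - 1) * exp (- (real (Suc n) * t)))) sums g t"
      by (simp only:)
    thus ?thesis unfolding sums_def F_def .
  qed
  note dom = dominated_convergence[OF has_integral_integrable[OF int] h le conv]
  have "(\<lambda>K. integral {0<..} (F K)) \<longlonglongrightarrow> integral {0<..} g" by (rule dom(2))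
  moreover have "(\<lambda>K. integral {0<..} (F K)) \<longlonglongrightarrow> of_real (Gamma s) * L (of_real s)"
  proof -
    have "(\<lambda>n. of_real (Gamma s) * (chi (int (Suc n)) * dterm (of_real s) n)) sums (of_real (Gamma s) * L (of_real s))"
      by (intro sums_mult L_sums[OF np]) (use s in simp)
    moreover have "of_real (Gamma s) * (chi (int (Suc n)) * dterm (of_real s) n) =
      chi (int (Suc n)) * of_real (Gamma s * real (Suc n) powr (- s))" for n
      unfolding of_real_dterm of_real_mult by (simp only: mult_ac)
    ultimately show ?thesis unfolding sums_def integral_unique[OF int] by (simp only:)
  qed
  ultimately have "integral {0<..} g = of_real (Gamma s) * L (of_real s)" by (rule LIMSEQ_unique)
  with dom(1) have "(g has_integral of_real (Gamma s) * L (of_real s)) {0<..}"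
    by (simp add: has_integral_integrable_integral)
  thus ?thesis unfolding g_def .
qed

section \<open>Mellin transform of the partial fractions\<close>

text \<open>i^(-\<kappa>) for the parity \<kappa>; the -i comes from the imaginary kernel of an odd
  character.\<close>

definition sign_factor :: complex where
  "sign_factor = (if chi (-1) = 1 then 1 else - \<i>)"

text \<open>The kernel is 2 t / (c^2 + t^2) or -i 2 c / (c^2 + t^2) according to parity. The
  parameter \<open>a\<close> absorbs the extra t in the even case, while the factor c does the same
  in the odd case, so both give c^(s-1).\<close>

lemma kernel_integral:
  assumes s: "0 < s" "s < 1"
  defines "a \<equiv> (s + 1 - real (parity chi)) / 2"
  shows "((\<lambda>t. of_real (t powr (s - 1)) * kernel k t) has_integral
    sign_factor * of_real ((2 * pi / N * real (Suc k)) powr (s - 1) * (Gamma a * Gamma (1 - a)))) {0<..}"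
proof -
  define c where "c = 2 * pi / N * real (Suc k)"
  have c: "c > 0" using N_pos by (simp add: c_def)
  have nz: "complex_of_real t + \<i> * of_real c \<noteq> 0" "complex_of_real t - \<i> * of_real c \<noteq> 0" "c\<^sup>2 + t\<^sup>2 \<noteq> 0"
    if "t > 0" for t
    using that c by (auto simp: complex_eq_iff sum_power2_eq_zero_iff)
  have prod: "(complex_of_real t + \<i> * of_real c) * (of_real t - \<i> * of_real c) = of_real (c\<^sup>2 + t\<^sup>2)" for t
    by (simp add: power2_eq_square algebra_simps)
  have sumf: "1 / (complex_of_real t + \<i> * of_real c) + 1 / (of_real t - \<i> * of_real c) = of_real (2 * t / (c\<^sup>2 + t\<^sup>2))"
    "1 / (complex_of_real t + \<i> * of_real c) - 1 / (of_real t - \<i> * of_real c) = - \<i> * of_real (2 * c / (c\<^sup>2 + t\<^sup>2))"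
    if "t > 0" for t
    using add_frac_eq[OF nz(1,2)[OF that], of 1 1] diff_frac_eq[OF nz(1,2)[OF that], of 1 1]
    unfolding prod by simp_all
  show ?thesis
  proof (cases "chi (-1) = 1")
    case True
    hence a: "a = (s + 1) / 2" by (simp add: a_def parity_def)
    have a01: "0 < a" "a < 1" using s by (auto simp: a)
    have "((\<lambda>t. 2 * t powr (2 * a - 1) / (c\<^sup>2 + t\<^sup>2)) has_integral c powr (2 * a - 2) * (Gamma a * Gamma (1 - a))) {0<..}"
      by (rule mellin_lorentz[OF a01 c])
    hence int: "((\<lambda>t. complex_of_real (2 * t powr (2 * a - 1) / (c\<^sup>2 + t\<^sup>2))) has_integral
        of_real (c powr (2 * a - 2) * (Gamma a * Gamma (1 - a)))) {0<..}"
      by (rule has_integral_linear[OF _ bounded_linear_of_real, unfolded o_def])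
    have eq: "complex_of_real (2 * t powr (2 * a - 1) / (c\<^sup>2 + t\<^sup>2)) = of_real (t powr (s - 1)) * kernel k t"
      if "t \<in> {0<..}" for t
    proof -
      have t: "t > 0" using that by simp
      have "kernel k t = of_real (2 * t / (c\<^sup>2 + t\<^sup>2))"
        unfolding kernel_def True c_def[symmetric] by (rule sumf(1)[OF t])
      moreover have "t powr (2 * a - 1) = t powr (s - 1) * t"
      proof -
        have "2 * a - 1 = (s - 1) + 1" by (simp add: a add_divide_distrib)
        thus ?thesis using t by (simp only: powr_add) simp
      qed
      ultimately show ?thesis by simp
    qed
    have "2 * a - 2 = s - 1" by (simp add: a)
    with has_integral_eq[OF eq int] show ?thesis unfolding sign_factor_def c_def using True by simp
  next
    case False
    hence m1: "chi (-1) = -1" using parity_cases by blast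
    have a: "a = s / 2" using False by (simp add: a_def parity_def)
    have a01: "0 < a" "a < 1" using s by (auto simp: a)
    have "((\<lambda>t. c * (2 * t powr (2 * a - 1) / (c\<^sup>2 + t\<^sup>2))) has_integral c * (c powr (2 * a - 2) * (Gamma a * Gamma (1 - a)))) {0<..}"
      by (intro has_integral_mult_right mellin_lorentz[OF a01 c])
    hence "((\<lambda>t. complex_of_real (c * (2 * t powr (2 * a - 1) / (c\<^sup>2 + t\<^sup>2)))) has_integral
        of_real (c * (c powr (2 * a - 2) * (Gamma a * Gamma (1 - a))))) {0<..}"
      by (rule has_integral_linear[OF _ bounded_linear_of_real, unfolded o_def])
    hence int: "((\<lambda>t. - \<i> * complex_of_real (c * (2 * t powr (2 * a - 1) / (c\<^sup>2 + t\<^sup>2)))) has_integral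
        - \<i> * of_real (c * (c powr (2 * a - 2) * (Gamma a * Gamma (1 - a))))) {0<..}"
      by (rule has_integral_mult_right)
    have eq: "- \<i> * complex_of_real (c * (2 * t powr (2 * a - 1) / (c\<^sup>2 + t\<^sup>2))) = of_real (t powr (s - 1)) * kernel k t"
      if "t \<in> {0<..}" for t
    proof -
      have t: "t > 0" using that by simp
      have "kernel k t = - \<i> * of_real (2 * c / (c\<^sup>2 + t\<^sup>2))"
        unfolding kernel_def m1 c_def[symmetric] using sumf(2)[OF t] by simp
      thus ?thesis by (simp add: a)
    qed
    have cc: "c * (c powr (2 * a - 2) * x) = c powr (s - 1) * x" for x
      using powr_add[of c "s - 2" 1] c by (simp add: a)
    show ?thesis using has_integral_eq[OF eq int] False unfolding cc sign_factor_def c_def[symmetric] by simp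
  qed
qed

text \<open>Kernels are O(1/r) and consecutive ones differ by O(1/r^2), where r dominates both t and
  the frequency. Giving t the power \<alpha> leaves the differences of order k^(\<alpha>-2),
  summable as \<alpha> < 1.\<close>

lemma kernel_sum_bound:
  assumes np: "chi \<noteq> principal_character N" and \<alpha>: "0 \<le> \<alpha>" "\<alpha> < 1"
  obtains H where "H \<ge> 0" "\<And>K t. t > 0 \<Longrightarrow> norm (\<Sum>k<K. cnj (chi (int (Suc k))) * kernel k t) \<le> H * t powr (- \<alpha>)"
proof -
  define \<delta> where "\<delta> = 2 * pi / N"
  have \<delta>: "\<delta> > 0" using N_pos by (simp add: \<delta>_def)
  obtain C where C: "\<And>n. norm (\<Sum>k<n. chi (int (Suc k))) \<le> C" "C > 0"
    using zero_sum_periodic_Suc_bounded[OF zero_sum_nonprincipal[OF np]] by blast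
  have C': "norm (\<Sum>k<n. cnj (chi (int (Suc k)))) \<le> C" for n
    unfolding cnj_sum[symmetric] complex_mod_cnj by (rule C)
  define Z where "Z = (\<Sum>k. real (Suc k) powr (\<alpha> - 2))"
  have summ: "summable (\<lambda>k. real (Suc k) powr (\<alpha> - 2))" using \<alpha> by (intro summable_powr_Suc) simp
  have Z: "Z \<ge> 0" unfolding Z_def by (rule suminf_nonneg[OF summ]) simp
  define c where "c = (\<lambda>k. \<delta> * real (Suc k))"
  have c: "c k > 0" "c k \<ge> \<delta>" "c (Suc k) - c k = \<delta>" for k
    using \<delta> by (auto simp: c_def algebra_simps intro: add_pos_nonneg)
  define H where "H = C * (2 * \<delta> powr (\<alpha> - 1) + 2 * \<delta> powr (\<alpha> - 1) * Z)"
  have "norm (\<Sum>k<K. cnj (chi (int (Suc k))) * kernel k t) \<le> H * t powr (- \<alpha>)" if t: "t > 0" for K t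
  proof -
    define p where "p = (\<lambda>k. complex_of_real t + \<i> * of_real (c k))"
    define m where "m = (\<lambda>k. complex_of_real t - \<i> * of_real (c k))"
    define r where "r = (\<lambda>k. sqrt (t\<^sup>2 + (c k)\<^sup>2))"
    have np: "norm (p k) = r k" "norm (m k) = r k" for k by (simp_all add: p_def m_def r_def cmod_def)
    have r: "t \<le> r k" "c k \<le> r k" "r k > 0" for k
      using t c(1)[of k] by (auto simp: r_def real_le_rsqrt add_pos_pos)
    have nz: "p k \<noteq> 0" "m k \<noteq> 0" for k using np[of k] r(3)[of k] by auto
    have eps: "norm (chi (-1)) = 1" using parity_cases by auto
    have ker: "kernel k t = 1 / p k + chi (-1) * (1 / m k)" for k
      by (simp add: kernel_def p_def m_def c_def \<delta>_def)
    have b1: "norm (kernel K t) \<le> 2 * \<delta> powr (\<alpha> - 1) * t powr (- \<alpha>)"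
    proof -
      have "norm (kernel K t) \<le> norm (1 / p K) + norm (chi (-1) * (1 / m K))"
        unfolding ker by (rule norm_triangle_ineq)
      also have "\<dots> = 2 * (1 / r K)" by (simp add: norm_divide norm_mult eps np)
      also have "\<dots> \<le> 2 * (\<delta> powr (\<alpha> - 1) * t powr (- \<alpha>))"
      proof (rule mult_left_mono)
        have "t powr \<alpha> * \<delta> powr (1 - \<alpha>) \<le> r K powr (\<alpha> + (1 - \<alpha>))"
          using t \<delta> r[of K] c[of K] \<alpha> by (intro powr_mult_le) auto
        hence "t powr \<alpha> * \<delta> powr (1 - \<alpha>) \<le> r K" using r(3)[of K] by simp
        hence "1 / r K \<le> 1 / (t powr \<alpha> * \<delta> powr (1 - \<alpha>))" using t \<delta> r(3)[of K] by (intro divide_left_mono) auto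
        also have "\<dots> = \<delta> powr (\<alpha> - 1) * t powr (- \<alpha>)"
          using powr_minus[of \<delta> "1 - \<alpha>"] powr_minus[of t \<alpha>] by (simp add: divide_inverse)
        finally show "1 / r K \<le> \<delta> powr (\<alpha> - 1) * t powr (- \<alpha>)" .
      qed simp
      finally show ?thesis by simp
    qed
    have b2: "norm (kernel k t - kernel (Suc k) t) \<le> 2 * \<delta> powr (\<alpha> - 1) * t powr (- \<alpha>) * real (Suc k) powr (\<alpha> - 2)" for k
    proof -
      have rr: "r k \<le> r (Suc k)"
        unfolding r_def using c(1)[of k] c(3)[of k] \<delta>
        by (intro real_sqrt_le_mono add_left_mono power_mono) linarith+
      have d: "1 / p k - 1 / p (Suc k) = \<i> * of_real \<delta> / (p k * p (Suc k))"
        "1 / m k - 1 / m (Suc k) = - \<i> * of_real \<delta> / (m k * m (Suc k))"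
        using diff_frac_eq[OF nz(1)[of k] nz(1)[of "Suc k"], of 1 1] diff_frac_eq[OF nz(2)[of k] nz(2)[of "Suc k"], of 1 1]
          c(3)[of k, symmetric]
        by (simp_all add: p_def m_def right_diff_distrib)
      have "kernel k t - kernel (Suc k) t = (1 / p k - 1 / p (Suc k)) + chi (-1) * (1 / m k - 1 / m (Suc k))"
        unfolding ker by (simp only: right_diff_distrib) simp
      hence "norm (kernel k t - kernel (Suc k) t) \<le> norm (1 / p k - 1 / p (Suc k)) + norm (chi (-1) * (1 / m k - 1 / m (Suc k)))"
        by (simp only: norm_triangle_ineq)
      also have "\<dots> = 2 * (\<delta> / (r k * r (Suc k)))"
        unfolding d by (simp add: norm_divide norm_mult eps np \<delta> less_imp_le)
      also have "\<dots> \<le> 2 * (\<delta> / (r k * r k))"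
        using rr r(3)[of k] r(3)[of "Suc k"] \<delta> by (intro mult_left_mono divide_left_mono mult_pos_pos) auto
      also have "\<dots> \<le> 2 * (\<delta> * (t powr (- \<alpha>) * (\<delta> powr (\<alpha> - 2) * real (Suc k) powr (\<alpha> - 2))))"
      proof (intro mult_left_mono)
        have "t powr \<alpha> * c k powr (2 - \<alpha>) \<le> r k powr (\<alpha> + (2 - \<alpha>))"
          using t r[of k] c(1)[of k] \<alpha> by (intro powr_mult_le) auto
        also have "r k powr (\<alpha> + (2 - \<alpha>)) = r k * r k" using r(3)[of k] by (simp add: power2_eq_square)
        finally have "1 / (r k * r k) \<le> 1 / (t powr \<alpha> * c k powr (2 - \<alpha>))"
          using t c(1)[of k] r(3)[of k] by (intro divide_left_mono) auto
        also have "\<dots> = t powr (- \<alpha>) * c k powr (\<alpha> - 2)"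
          using powr_minus[of "c k" "2 - \<alpha>"] powr_minus[of t \<alpha>] by (simp add: divide_inverse)
        also have "c k powr (\<alpha> - 2) = \<delta> powr (\<alpha> - 2) * real (Suc k) powr (\<alpha> - 2)"
          unfolding c_def using \<delta> by (simp add: powr_mult del: of_nat_Suc)
        finally have "\<delta> * (1 / (r k * r k)) \<le> \<delta> * (t powr (- \<alpha>) * (\<delta> powr (\<alpha> - 2) * real (Suc k) powr (\<alpha> - 2)))"
          using \<delta> by (intro mult_left_mono) auto
        thus "\<delta> / (r k * r k) \<le> \<delta> * (t powr (- \<alpha>) * (\<delta> powr (\<alpha> - 2) * real (Suc k) powr (\<alpha> - 2)))" by simp
      qed simp
      also have "\<dots> = 2 * (\<delta> * \<delta> powr (\<alpha> - 2)) * t powr (- \<alpha>) * real (Suc k) powr (\<alpha> - 2)" by (simp only: mult_ac)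
      also have "\<delta> * \<delta> powr (\<alpha> - 2) = \<delta> powr (\<alpha> - 1)" using powr_add[of \<delta> "\<alpha> - 2" 1] \<delta> by simp
      finally show ?thesis .
    qed
    have "norm (\<Sum>k<K. cnj (chi (int (Suc k))) * kernel k t) \<le>
        C * (norm (kernel K t) + (\<Sum>k<K. norm (kernel k t - kernel (Suc k) t)))"
      by (rule norm_sum_by_parts_le[OF C'])
    also have "\<dots> \<le> C * (2 * \<delta> powr (\<alpha> - 1) * t powr (- \<alpha>) + 2 * \<delta> powr (\<alpha> - 1) * t powr (- \<alpha>) * Z)"
    proof (intro mult_left_mono add_mono b1)
      have "(\<Sum>k<K. norm (kernel k t - kernel (Suc k) t)) \<le>
         2 * \<delta> powr (\<alpha> - 1) * t powr (- \<alpha>) * (\<Sum>k<K. real (Suc k) powr (\<alpha> - 2))"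
        unfolding sum_distrib_left by (intro sum_mono b2)
      also have "\<dots> \<le> 2 * \<delta> powr (\<alpha> - 1) * t powr (- \<alpha>) * Z"
        unfolding Z_def by (intro mult_left_mono sum_le_suminf summ) auto
      finally show "(\<Sum>k<K. norm (kernel k t - kernel (Suc k) t)) \<le> 2 * \<delta> powr (\<alpha> - 1) * t powr (- \<alpha>) * Z" .
    qed (use C(2) in simp)
    also have "\<dots> = H * t powr (- \<alpha>)" by (simp add: H_def distrib_left distrib_right mult_ac)
    finally show ?thesis .
  qed
  moreover have "H \<ge> 0" using C(2) Z by (simp add: H_def)
  ultimately show ?thesis using that by blast
qed

lemma kernel_sum_dominated:
  assumes np: "chi \<noteq> principal_character N" and s: "0 < s" "s < 1"
  obtains h where "h integrable_on {0<..}"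
    "\<And>K t. t \<in> {0<..} \<Longrightarrow> norm (\<Sum>k<K. cnj (chi (int (Suc k))) * (of_real (t powr (s - 1)) * kernel k t)) \<le> h t"
proof -
  \<comment> \<open>Strictly between s and 1: t^(s-1-\<alpha>) is then integrable at infinity, while
    \<alpha> = 0 serves near 0.\<close>
  define \<alpha> where "\<alpha> = (1 + s) / 2"
  have \<alpha>: "0 \<le> \<alpha>" "\<alpha> < 1" "s < \<alpha>" using s by (auto simp: \<alpha>_def)
  obtain H0 where H0: "H0 \<ge> 0" "\<And>K t. t > 0 \<Longrightarrow> norm (\<Sum>k<K. cnj (chi (int (Suc k))) * kernel k t) \<le> H0 * t powr (- 0)"
    using kernel_sum_bound[OF np, of 0] by auto
  obtain H1 where H1: "H1 \<ge> 0" "\<And>K t. t > 0 \<Longrightarrow> norm (\<Sum>k<K. cnj (chi (int (Suc k))) * kernel k t) \<le> H1 * t powr (- \<alpha>)"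
    using kernel_sum_bound[OF np \<alpha>(1,2)] by auto
  define f where "f = (\<lambda>a t::real. 2 * t powr (2 * a - 1) / (1\<^sup>2 + t\<^sup>2))"
  \<comment> \<open>The exponents 2 a - 1 = s - 1 and 2 b - 1 = s + 1 - \<alpha> make the two
    Lorentz integrands dominate t^(s-1) on (0, 1] and t^(s-1-\<alpha>) beyond 1; s < \<alpha> gives
    b < 1.\<close>
  define a b where "a = s / 2" and "b = (s + 2 - \<alpha>) / 2"
  define h where "h = (\<lambda>t. H0 * f a t + H1 * f b t)"
  have "h integrable_on {0<..}"
    unfolding h_def f_def using s \<alpha>
    by (intro integrable_add integrable_on_mult_right has_integral_integrable[OF mellin_lorentz])
       (auto simp: a_def b_def)
  moreover have "norm (\<Sum>k<K. cnj (chi (int (Suc k))) * (of_real (t powr (s - 1)) * kernel k t)) \<le> h t"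
    if "t \<in> {0<..}" for K t
  proof -
    have t: "t > 0" using that by simp
    have "(\<Sum>k<K. cnj (chi (int (Suc k))) * (of_real (t powr (s - 1)) * kernel k t)) =
        of_real (t powr (s - 1)) * (\<Sum>k<K. cnj (chi (int (Suc k))) * kernel k t)"
      unfolding sum_distrib_left by (intro sum.cong refl) (simp only: mult_ac)
    hence n: "norm (\<Sum>k<K. cnj (chi (int (Suc k))) * (of_real (t powr (s - 1)) * kernel k t)) =
        t powr (s - 1) * norm (\<Sum>k<K. cnj (chi (int (Suc k))) * kernel k t)"
      by (simp add: norm_mult)
    have f0: "f a t \<ge> 0" "f b t \<ge> 0" by (auto simp: f_def)
    show ?thesis
    proof (cases "t \<le> 1")
      case True
      have "t powr (s - 1) * norm (\<Sum>k<K. cnj (chi (int (Suc k))) * kernel k t) \<le> t powr (s - 1) * H0"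
        using H0(2)[OF t, of K] t by (intro mult_left_mono) auto
      also have "t powr (s - 1) \<le> f a t"
      proof -
        have "t\<^sup>2 \<le> 1" using True t by (simp add: power_le_one)
        hence "t powr (s - 1) * (1\<^sup>2 + t\<^sup>2) \<le> t powr (s - 1) * 2" by (intro mult_left_mono) auto
        thus ?thesis using t by (simp add: f_def a_def pos_le_divide_eq add_pos_pos mult.commute)
      qed
      hence "t powr (s - 1) * H0 \<le> H0 * f a t" using H0(1) by (simp add: mult.commute mult_left_mono)
      finally show ?thesis unfolding n h_def using H1(1) f0 by (simp add: add_increasing2)
    next
      case False
      have "t powr (s - 1) * norm (\<Sum>k<K. cnj (chi (int (Suc k))) * kernel k t) \<le> t powr (s - 1) * (H1 * t powr (- \<alpha>))"
        using H1(2)[OF t, of K] by (intro mult_left_mono) auto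
      also have "\<dots> = H1 * t powr (s - 1 - \<alpha>)" by (simp add: powr_add[symmetric] mult.left_commute)
      also have "t powr (s - 1 - \<alpha>) \<le> f b t"
      proof -
        have "t powr (s - 1 - \<alpha>) * (1\<^sup>2 + t\<^sup>2) \<le> t powr (s - 1 - \<alpha>) * (2 * t\<^sup>2)"
          using False by (intro mult_left_mono) (auto simp: one_le_power)
        also have "\<dots> = 2 * (t powr (s - 1 - \<alpha>) * t powr 2)" using t by simp
        also have "t powr (s - 1 - \<alpha>) * t powr 2 = t powr (2 * b - 1)"
        proof -
          have "2 * b - 1 = (s - 1 - \<alpha>) + 2" by (simp add: b_def)
          thus ?thesis by (simp only: powr_add)
        qed
        finally show ?thesis using t by (simp add: f_def pos_le_divide_eq add_pos_pos)
      qed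
      hence "H1 * t powr (s - 1 - \<alpha>) \<le> H1 * f b t" using H1(1) by (rule mult_left_mono)
      finally show ?thesis unfolding n h_def using H0(1) f0 by (simp add: add_increasing)
    qed
  qed
  ultimately show ?thesis using that by blast
qed

text \<open>The partial fraction identity is integrated against t^(s-1). One side is a Gamma
  integral; on the other the frequencies enter as (k + 1)^(s-1), which for real s sums to the
  conjugate of L at 1 - s.\<close>

lemma functional_equation_real:
  assumes prim: "primitive_dirichlet_character N chi" and np: "chi \<noteq> principal_character N"
    and s: "0 < s" "s < 1"
  defines "a \<equiv> (s + 1 - real (parity chi)) / 2"
  shows "gauss_sum 1 * (of_real (Gamma s) * L (of_real s)) =
    sign_factor * of_real ((2 * pi / N) powr (s - 1) * (Gamma a * Gamma (1 - a))) * cnj (L (of_real (1 - s)))"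
proof -
  define F where "F = (\<lambda>m t. \<Sum>k<m * N. cnj (chi (int (Suc k))) * (of_real (t powr (s - 1)) * kernel k t))"
  define g where "g = (\<lambda>t. complex_of_real (t powr (s - 1)) * (\<Sum>n. chi (int (Suc n)) * of_real (exp (- (real (Suc n) * t)))))"
  define I where "I = (\<lambda>k. sign_factor * complex_of_real ((2 * pi / N * real (Suc k)) powr (s - 1) * (Gamma a * Gamma (1 - a))))"
  have int: "(F m has_integral (\<Sum>k<m * N. cnj (chi (int (Suc k))) * I k)) {0<..}" for m
    unfolding F_def I_def a_def by (intro has_integral_sum has_integral_mult_right kernel_integral s) auto
  obtain h where h: "h integrable_on {0<..}"
    "\<And>K t. t \<in> {0<..} \<Longrightarrow> norm (\<Sum>k<K. cnj (chi (int (Suc k))) * (of_real (t powr (s - 1)) * kernel k t)) \<le> h t"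
    using kernel_sum_dominated[OF np s] by blast
  have le: "norm (F m t) \<le> h t" if "t \<in> {0<..}" for m t
    unfolding F_def by (rule h(2)[OF that])
  have conv: "(\<lambda>m. F m t) \<longlonglongrightarrow> gauss_sum 1 * g t" if "t \<in> {0<..}" for t
  proof -
    have t: "t > 0" using that by simp
    have "(\<lambda>m. of_real (t powr (s - 1)) * (\<Sum>k<m * N. cnj (chi (int (Suc k))) * kernel k t)) \<longlonglongrightarrow>
      of_real (t powr (s - 1)) * (gauss_sum 1 * (\<Sum>n. chi (int (Suc n)) * of_real (exp (- (real (Suc n) * t)))))"
      by (intro tendsto_mult tendsto_const kernel_sum_tendsto[OF prim np t])
    moreover have "of_real (t powr (s - 1)) * (\<Sum>k<m * N. cnj (chi (int (Suc k))) * kernel k t) = F m t" for m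
      unfolding F_def sum_distrib_left by (intro sum.cong refl) (simp only: mult_ac)
    ultimately show ?thesis by (simp only: g_def mult.left_commute)
  qed
  have "(\<lambda>m. integral {0<..} (F m)) \<longlonglongrightarrow> integral {0<..} (\<lambda>t. gauss_sum 1 * g t)"
    by (rule dominated_convergence(2)[OF has_integral_integrable[OF int] h(1) le conv])
  moreover have "integral {0<..} (\<lambda>t. gauss_sum 1 * g t) = gauss_sum 1 * (of_real (Gamma s) * L (of_real s))"
    using gamma_L_integral[OF np s(1)] unfolding g_def[symmetric]
    by (intro integral_unique has_integral_mult_right)
  moreover have "(\<lambda>m. integral {0<..} (F m)) \<longlonglongrightarrow>
     sign_factor * of_real ((2 * pi / N) powr (s - 1) * (Gamma a * Gamma (1 - a))) * cnj (L (of_real (1 - s)))"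
  proof -
    define S where "S = (\<lambda>K. \<Sum>k<K. chi (int (Suc k)) * dterm (of_real (1 - s)) k)"
    have "S \<longlonglongrightarrow> L (of_real (1 - s))"
      using L_sums[OF np, of "of_real (1 - s)"] s by (simp add: sums_def S_def)
    \<comment> \<open>The kernel sums were only controlled along multiples of N, so the convergent
      Dirichlet series is read along the same subsequence.\<close>
    hence "(S \<circ> (\<lambda>m. m * N)) \<longlonglongrightarrow> L (of_real (1 - s))"
      by (rule LIMSEQ_subseq_LIMSEQ) (use N_pos in \<open>auto intro!: strict_monoI\<close>)
    hence "(\<lambda>m. sign_factor * of_real ((2 * pi / N) powr (s - 1) * (Gamma a * Gamma (1 - a))) * cnj (S (m * N))) \<longlonglongrightarrow>
      sign_factor * of_real ((2 * pi / N) powr (s - 1) * (Gamma a * Gamma (1 - a))) * cnj (L (of_real (1 - s)))"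
      by (intro tendsto_mult tendsto_const tendsto_cnj) (simp add: o_def)
    moreover have "sign_factor * of_real ((2 * pi / N) powr (s - 1) * (Gamma a * Gamma (1 - a))) * cnj (S (m * N)) =
        integral {0<..} (F m)" for m
      unfolding integral_unique[OF int] S_def cnj_sum sum_distrib_left
    proof (rule sum.cong[OF refl])
      fix k
      have "(2 * pi / N * real (Suc k)) powr (s - 1) = (2 * pi / N) powr (s - 1) * real (Suc k) powr (s - 1)"
        by (rule powr_mult)
      thus "sign_factor * of_real ((2 * pi / N) powr (s - 1) * (Gamma a * Gamma (1 - a))) *
          cnj (chi (int (Suc k)) * dterm (of_real (1 - s)) k) = cnj (chi (int (Suc k))) * I k"
        unfolding I_def of_real_dterm by (simp del: of_nat_Suc) 
    qed
    ultimately show ?thesis by simp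
  qed
  ultimately show ?thesis using LIMSEQ_unique by metis
qed

end

section \<open>The completed L-function\<close>

lemma gamma_duplication_real:
  fixes s :: real
  assumes "s > 0"
  shows "Gamma (s / 2) * Gamma ((s + 1) / 2) = 2 powr (1 - s) * sqrt pi * Gamma s"
proof -
  have ne: "complex_of_real x \<notin> \<int>\<^sub>\<le>\<^sub>0" if "x > 0" for x
    using that by (auto elim!: nonpos_Ints_cases simp: complex_eq_iff)
  have "of_real (s / 2) + 1 / 2 = complex_of_real ((s + 1) / 2)" by (simp add: add_divide_distrib)
  moreover have "2 * complex_of_real (s / 2) = of_real s" by simp
  moreover have "exp ((1 - complex_of_real s) * of_real (ln 2)) = of_real (2 powr (1 - s))"
  proof -
    have "(1 - complex_of_real s) * of_real (ln 2) = of_real ((1 - s) * ln 2)" by simp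
    thus ?thesis by (simp only: exp_of_real powr_def) simp
  qed
  ultimately have "Gamma (complex_of_real (s / 2)) * Gamma (of_real ((s + 1) / 2)) =
      of_real (2 powr (1 - s)) * of_real (sqrt pi) * Gamma (complex_of_real s)"
    using Gamma_legendre_duplication[of "of_real (s / 2)"] ne[of "s / 2"] ne[of "(s + 1) / 2"] assms
    by (simp only:) simp
  hence "complex_of_real (Gamma (s / 2) * Gamma ((s + 1) / 2)) = of_real (2 powr (1 - s) * sqrt pi * Gamma s)"
    by (simp only: Gamma_complex_of_real of_real_mult)
  thus ?thesis by (simp only: of_real_eq_iff)
qed

lemma islimpt_half: "1/2 islimpt (complex_of_real ` {0<..<1})"
  unfolding islimpt_approachable
proof safe
  fix e :: real assume e: "e > 0"
  define d where "d = min (e / 2) (1 / 4)"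
  have d: "d > 0" "d < e" "d < 1 / 2" using e by (auto simp: d_def)
  have "complex_of_real (1 / 2 + d) - 1 / 2 = of_real d" by simp
  hence "dist (complex_of_real (1 / 2 + d)) (1 / 2) = d"
    using d(1) by (simp only: dist_norm norm_of_real abs_of_pos)
  thus "\<exists>x'\<in>complex_of_real ` {0<..<1}. x' \<noteq> 1 / 2 \<and> dist x' (1 / 2) < e"
    using d by (intro bexI[of _ "complex_of_real (1 / 2 + d)"] imageI) auto
qed

context dchar
begin

abbreviation kap :: "complex" where "kap \<equiv> of_nat (parity chi)"

definition gamma_factor :: "complex \<Rightarrow> complex" where
  "gamma_factor s = of_real (pi / real N) powr (- ((s + kap) / 2)) * Gamma ((s + kap) / 2)"

definition completed :: "complex \<Rightarrow> complex" where
  "completed s = gamma_factor s * L s"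

lemma gamma_arg: "Re s > 0 \<Longrightarrow> (s + kap) / 2 \<notin> \<int>\<^sub>\<le>\<^sub>0"
  by (auto elim!: nonpos_Ints_cases simp: complex_eq_iff)

lemma gamma_factor_nonzero: "Re s > 0 \<Longrightarrow> gamma_factor s \<noteq> 0"
  using gamma_arg[of s] N_pos by (simp add: gamma_factor_def Gamma_eq_zero_iff)

lemma completed_holomorphic:
  assumes "chi \<noteq> principal_character N"
  shows "completed holomorphic_on {s. Re s > 0}"
  unfolding completed_def gamma_factor_def
  by (intro holomorphic_intros L_holomorphic[OF assms]) (use N_pos gamma_arg in auto)

text \<open>The complex conjugate of the usual root number \<tau>(chi) / (i^\<kappa> sqrt N),
  because \<open>gauss_sum 1\<close> is the conjugate of \<tau>(chi).\<close>

definition root_number :: complex where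
  "root_number = gauss_sum 1 / (sign_factor * of_real (sqrt (real N)))"

text \<open>Of the factors Gamma a and Gamma (1 - a), the first combines with the Gamma factor at s
  by duplication, for either parity, and cancels Gamma s; the second is the Gamma factor at 1 -
  s.\<close>

lemma completed_real:
  assumes prim: "primitive_dirichlet_character N chi" and np: "chi \<noteq> principal_character N"
    and s: "0 < s" "s < 1"
  shows "root_number * completed (of_real s) = cnj (completed (of_real (1 - s)))"
proof -
  define \<kappa> where "\<kappa> = real (parity chi)"
  define y where "y = pi / real N"
  have y: "y > 0" using N_pos by (simp add: y_def)
  define p p' a where "p = (s + \<kappa>) / 2" and "p' = (1 - s + \<kappa>) / 2" and "a = (s + 1 - \<kappa>) / 2"
  have \<kappa>: "\<kappa> = 0 \<or> \<kappa> = 1" by (simp add: \<kappa>_def parity_def)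
  have G: "gamma_factor (of_real u) = of_real (y powr (- ((u + \<kappa>) / 2)) * Gamma ((u + \<kappa>) / 2))" for u
  proof -
    have "(complex_of_real u + kap) / 2 = of_real ((u + \<kappa>) / 2)" by (simp add: \<kappa>_def)
    thus ?thesis unfolding gamma_factor_def y_def[symmetric]
      using y by (simp only: of_real_minus[symmetric] powr_of_real less_imp_le Gamma_complex_of_real of_real_mult)
  qed
  have dup: "Gamma p * Gamma a = 2 powr (1 - s) * sqrt pi * Gamma s"
    using gamma_duplication_real[OF s(1)] \<kappa> by (auto simp: p_def a_def mult.commute)
  have a1: "1 - a = p'" by (simp add: a_def p'_def field_simps)
  have Gs: "Gamma s > 0" using s by simp
  \<comment> \<open>The powers of 2 cancel against those of the duplication formula, and y^(-1/2)
    sqrt pi = sqrt N.\<close>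
  have pw: "y powr (- p) * (2 * y) powr (s - 1) * 2 powr (1 - s) * sqrt pi = sqrt N * y powr (- p')"
  proof -
    have "y powr (- p) * (2 * y) powr (s - 1) * 2 powr (1 - s) =
       y powr (- p) * y powr (s - 1) * (2 powr (s - 1) * 2 powr (1 - s))"
      by (simp only: powr_mult mult_ac)
    also have "\<dots> = y powr (- p + (s - 1))" by (simp add: powr_add[symmetric])
    also have "- p + (s - 1) = - (1 / 2) + (- p')" by (simp add: p_def p'_def field_simps)
    also have "y powr (- (1 / 2) + (- p')) = y powr (- (1 / 2)) * y powr (- p')" by (rule powr_add)
    also have "y powr (- (1 / 2)) = sqrt N / sqrt pi"
      using y N_pos by (simp add: powr_minus powr_half_sqrt y_def real_sqrt_divide)
    finally show ?thesis by simp
  qed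
  have R: "(y powr (- p) * Gamma p) * ((2 * y) powr (s - 1) * (Gamma a * Gamma (1 - a))) =
      sqrt N * Gamma s * (y powr (- p') * Gamma p')"
  proof -
    have "(y powr (- p) * Gamma p) * ((2 * y) powr (s - 1) * (Gamma a * Gamma (1 - a))) =
      (y powr (- p) * (2 * y) powr (s - 1)) * (Gamma p * Gamma a) * Gamma p'"
      unfolding a1 by (simp only: mult_ac)
    also have "\<dots> = (y powr (- p) * (2 * y) powr (s - 1) * 2 powr (1 - s) * sqrt pi) * Gamma s * Gamma p'"
      unfolding dup by (simp only: mult_ac)
    also have "\<dots> = sqrt N * Gamma s * (y powr (- p') * Gamma p')"
      unfolding pw by (simp only: mult_ac)
    finally show ?thesis .
  qed
  have sf: "sign_factor \<noteq> 0" by (simp add: sign_factor_def)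
  have sN: "complex_of_real (sqrt N) \<noteq> 0" using N_pos by simp
  have FE: "gauss_sum 1 * (of_real (Gamma s) * L (of_real s)) =
    sign_factor * of_real ((2 * y) powr (s - 1) * (Gamma a * Gamma (1 - a))) * cnj (L (of_real (1 - s)))"
    using functional_equation_real[OF prim np s] by (simp add: y_def a_def \<kappa>_def)
  have "(sign_factor * of_real (sqrt N) * of_real (Gamma s)) * (root_number * completed (of_real s)) =
      of_real (y powr (- p) * Gamma p) * (gauss_sum 1 * (of_real (Gamma s) * L (of_real s)))"
    unfolding root_number_def completed_def G p_def[symmetric] using sf sN
    by (simp only: times_divide_eq_left times_divide_eq_right mult_ac nonzero_mult_div_cancel_left)
       (simp add: mult_ac)
  also have "\<dots> = sign_factor * of_real ((y powr (- p) * Gamma p) * ((2 * y) powr (s - 1) * (Gamma a * Gamma (1 - a)))) * cnj (L (of_real (1 - s)))"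
    unfolding FE by (simp only: of_real_mult mult_ac)
  also have "\<dots> = (sign_factor * of_real (sqrt N) * of_real (Gamma s)) * cnj (completed (of_real (1 - s)))"
    unfolding R completed_def G p'_def by (simp add: mult_ac)
  finally show ?thesis using sf sN Gs by (subst (asm) mult_cancel_left) auto
qed

text \<open>Stated with \<open>conj_refl\<close>, which preserves holomorphy, so that the identity
  theorem extends the equation from the real segment.\<close>

lemma completed_strip:
  assumes prim: "primitive_dirichlet_character N chi" and np: "chi \<noteq> principal_character N"
    and s: "0 < Re s" "Re s < 1"
  shows "root_number * completed s = conj_refl completed s"
proof -
  define S where "S = {s. 0 < Re s} \<inter> {s. Re s < 1}"
  have S: "open S" "connected S"
    unfolding S_def by (intro open_Int open_halfspace_Re_gt open_halfspace_Re_lt)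
      (intro convex_connected convex_Int convex_halfspace_Re_gt convex_halfspace_Re_lt)
  have hol: "(\<lambda>s. root_number * completed s - conj_refl completed s) holomorphic_on S"
  proof (intro holomorphic_intros)
    show "completed holomorphic_on S"
      by (rule holomorphic_on_subset[OF completed_holomorphic[OF np]]) (auto simp: S_def)
    show "conj_refl completed holomorphic_on S"
      by (rule holomorphic_conj_refl[OF completed_holomorphic[OF np] open_halfspace_Re_gt]) (auto simp: S_def)
  qed
  have "root_number * completed s - conj_refl completed s = 0"
  proof (rule analytic_continuation[OF hol S _ _ islimpt_half])
    show "complex_of_real ` {0<..<1} \<subseteq> S" by (auto simp: S_def)
    show "1 / 2 \<in> S" by (simp add: S_def)
    fix z assume "z \<in> complex_of_real ` {0<..<1}"
    then obtain x where x: "z = of_real x" "0 < x" "x < 1" by auto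
    have "1 - cnj z = of_real (1 - x)" by (simp add: x)
    thus "root_number * completed z - conj_refl completed z = 0"
      using completed_real[OF prim np x(2,3)] unfolding conj_refl_def x(1) by simp
  qed (use s in \<open>simp add: S_def\<close>)
  thus ?thesis by simp
qed

lemma norm_root_number:
  assumes prim: "primitive_dirichlet_character N chi" and np: "chi \<noteq> principal_character N"
  shows "norm root_number = 1"
proof -
  define S where "S = {s. 0 < Re s} \<inter> {s. Re s < 1}"
  \<comment> \<open>A nonzero value to cancel by. Without one, the identity theorem would carry the
    zero to s = 2, inside the region of the Euler product.\<close>
  have "\<exists>s\<in>S. completed s \<noteq> 0"
  proof (rule ccontr)
    assume "\<not> ?thesis"
    hence z: "completed s = 0" if "s \<in> S" for s using that by blast
    have "completed 2 = 0"
    proof (rule analytic_continuation_open[where s=S and s'="{s. Re s > 0}" and f=completed and g="\<lambda>_. 0" and z=2])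
      show "open S" unfolding S_def by (intro open_Int open_halfspace_Re_gt open_halfspace_Re_lt)
      have "1 / 2 \<in> S" by (simp add: S_def)
      thus "S \<noteq> {}" by blast
      show "connected {s. Re s > 0}" by (intro convex_connected convex_halfspace_Re_gt)
    qed (use z completed_holomorphic[OF np] in \<open>auto simp: S_def open_halfspace_Re_gt\<close>)
    moreover have "completed 2 \<noteq> 0"
      using gamma_factor_nonzero[of 2] L_nonzero_right[of 2] by (simp add: completed_def)
    ultimately show False by blast
  qed
  then obtain s where s: "s \<in> S" "completed s \<noteq> 0" by blast
  have 1: "root_number * completed s = cnj (completed (1 - cnj s))"
    using completed_strip[OF prim np, of s] s by (simp add: S_def conj_refl_def)
  have 2: "root_number * completed (1 - cnj s) = cnj (completed s)"
    using completed_strip[OF prim np, of "1 - cnj s"] s by (simp add: S_def conj_refl_def)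
  have "(norm root_number * norm root_number) * norm (completed s) = norm root_number * norm (root_number * completed s)"
    by (simp add: norm_mult)
  also have "\<dots> = norm (root_number * completed (1 - cnj s))" unfolding 1 by (simp add: norm_mult)
  also have "\<dots> = norm (completed s)" unfolding 2 by simp
  finally have "(norm root_number)\<^sup>2 = 1" using s(2) by (simp add: power2_eq_square)
  thus ?thesis by (simp add: power2_eq_1_iff) (metis norm_ge_zero neg_0_le_iff_le not_one_le_zero)
qed

text \<open>On the left half-plane the functional equation serves as the definition; the two halves
  agree on the critical strip.\<close>

definition entire_completed :: "complex \<Rightarrow> complex" where
  "entire_completed s = (if Re s > 0 then completed s else conj_refl completed s / root_number)"

lemma entire_completed_holomorphic:
  assumes prim: "primitive_dirichlet_character N chi" and np: "chi \<noteq> principal_character N"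
  shows "entire_completed holomorphic_on UNIV"
proof -
  have w: "root_number \<noteq> 0" using norm_root_number[OF assms] by auto
  have "entire_completed holomorphic_on {s. Re s > 0}"
    using completed_holomorphic[OF np] by (rule holomorphic_transform) (simp add: entire_completed_def)
  moreover have "entire_completed holomorphic_on {s. Re s < 1}"
  proof (rule holomorphic_transform)
    show "(\<lambda>s. conj_refl completed s / root_number) holomorphic_on {s. Re s < 1}"
      by (intro holomorphic_intros holomorphic_conj_refl[OF completed_holomorphic[OF np] open_halfspace_Re_gt])
         (use w in auto)
    show "conj_refl completed s / root_number = entire_completed s" if "s \<in> {s. Re s < 1}" for s
      using completed_strip[OF assms, of s] that w by (auto simp: entire_completed_def field_simps)
  qed
  ultimately have "entire_completed holomorphic_on ({s. Re s > 0} \<union> {s. Re s < 1})"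
    by (intro holomorphic_on_Un open_halfspace_Re_gt open_halfspace_Re_lt)
  moreover have "{s. Re s > 0} \<union> {s. Re s < 1} = UNIV" by auto
  ultimately show ?thesis by simp
qed

lemma entire_completed_reflection:
  assumes prim: "primitive_dirichlet_character N chi" and np: "chi \<noteq> principal_character N"
  shows "conj_refl entire_completed s = root_number * entire_completed s"
proof -
  have n1: "norm root_number = 1" by (rule norm_root_number[OF assms])
  hence w: "root_number \<noteq> 0" by auto
  consider "Re s \<le> 0" | "0 < Re s" "Re s < 1" | "Re s \<ge> 1" by linarith
  thus ?thesis
  proof cases
    case 1
    thus ?thesis using w by (simp add: entire_completed_def conj_refl_def)
  next
    case 2
    thus ?thesis using completed_strip[OF assms, of s] by (simp add: entire_completed_def conj_refl_def)
  next
    case 3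
    \<comment> \<open>The mirror point lies in the left half-plane, where the definition divides by
      the root number; after conjugation, modulus 1 turns this into multiplication.\<close>
    have "cnj root_number * root_number = 1" using n1 complex_norm_square[of root_number] by (simp add: mult.commute)
    hence "x / cnj root_number = root_number * x" for x
      using w by (simp add: divide_eq_eq mult_ac)
    thus ?thesis using 3 by (simp add: entire_completed_def conj_refl_def)
  qed
qed

text \<open>Removing the Gamma factor through \<open>rGamma\<close>, which is entire, yields an
  entire function with the trivial zeros built in.\<close>

definition entire_L :: "complex \<Rightarrow> complex" where
  "entire_L s = entire_completed s * (of_real (pi / real N) powr ((s + kap) / 2) * rGamma ((s + kap) / 2))"

lemma gamma_factor_inverse:
  assumes "(s + kap) / 2 \<notin> \<int>\<^sub>\<le>\<^sub>0"
  shows "gamma_factor s * (of_real (pi / real N) powr ((s + kap) / 2) * rGamma ((s + kap) / 2)) = 1"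
proof -
  define z where "z = (s + kap) / 2"
  have "complex_of_real (pi / real N) \<noteq> 0" using N_pos by simp
  hence "of_real (pi / real N) powr (- z) * of_real (pi / real N) powr z = (1::complex)"
    by (simp only: powr_add[symmetric]) simp
  moreover have "Gamma z * rGamma z = 1"
    using assms by (simp add: z_def rGamma_inverse_Gamma Gamma_eq_zero_iff)
  ultimately show ?thesis unfolding gamma_factor_def z_def[symmetric]
    by (metis (no_types, opaque_lifting) mult.assoc mult.left_commute mult_1_right)
qed

lemma entire_L_eq: "Re s > 0 \<Longrightarrow> entire_L s = L s"
  unfolding entire_L_def using gamma_factor_inverse[OF gamma_arg[of s]]
  by (simp add: entire_completed_def completed_def mult_ac)

text \<open>\<open>entire_L\<close> shows that the choice is not empty; any admissible function
  agrees with it on the connected punctured plane, and the value at 1 is filled in by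
  continuity.\<close>

lemma dirichlet_L_eq:
  assumes prim: "primitive_dirichlet_character N chi" and np: "chi \<noteq> principal_character N"
  shows "dirichlet_L chi = entire_L"
proof -
  let ?P = "\<lambda>f. f holomorphic_on (UNIV - {1}) \<and>
     (\<forall>s. Re s > 1 \<longrightarrow> f s = (\<Sum>n. chi (int (Suc n)) / of_nat (Suc n) powr s))"
  have hol: "entire_L holomorphic_on UNIV" unfolding entire_L_def
    by (intro holomorphic_intros entire_completed_holomorphic[OF assms]) (use N_pos in auto)
  have series: "entire_L s = (\<Sum>n. chi (int (Suc n)) / of_nat (Suc n) powr s)" if "Re s > 1" for s
    using entire_L_eq[of s] that by (simp add: L_def dseries_def dterm_def powr_minus divide_inverse)
  have "?P entire_L" using hol series by (auto intro: holomorphic_on_subset)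
  hence P: "?P (SOME f. ?P f)" by (rule someI[of ?P])
  define f where "f = (SOME f. ?P f)"
  have f: "f holomorphic_on (UNIV - {1})" "\<And>s. Re s > 1 \<Longrightarrow> f s = (\<Sum>n. chi (int (Suc n)) / of_nat (Suc n) powr s)"
    using P unfolding f_def by blast+
  have eq: "f s = entire_L s" if "s \<noteq> 1" for s
  proof (rule analytic_continuation_open[where s="{s. Re s > 1}" and s'="UNIV - {1}" and f=f and g=entire_L and z=s])
    have "2 \<in> {s. Re s > 1}" by simp
    thus "{s. Re s > 1} \<noteq> {}" by blast
    show "connected (UNIV - {1::complex})"
      using connected_punctured_universe[of "1::complex"] by (simp add: Compl_eq_Diff_UNIV)
  qed (use f series hol that in \<open>auto simp: open_halfspace_Re_gt intro: holomorphic_on_subset\<close>)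
  have "remove_sings f s = entire_L s" for s
  proof (rule remove_sings_eqI)
    have "entire_L \<midarrow>s\<rightarrow> entire_L s"
      using hol by (metis holomorphic_on_imp_continuous_on continuous_on_eq_continuous_at open_UNIV UNIV_I isContD)
    moreover have "eventually (\<lambda>z. entire_L z = f z) (at s)"
    proof -
      have "eventually (\<lambda>z. z \<noteq> 1) (at s)" by (rule eventually_neq_at_within)
      thus ?thesis by eventually_elim (simp add: eq)
    qed
    ultimately show "f \<midarrow>s\<rightarrow> entire_L s" by (simp cong: tendsto_cong)
  qed
  thus ?thesis unfolding dirichlet_L_def f_def[symmetric] by (rule ext)
qed

text \<open>The poles of Gamma are isolated, so near every point, the point itself excepted, the
  product is \<open>entire_completed\<close>. Removing singularities corrects the conventional value
  0 at the poles.\<close>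

lemma xi_eq:
  assumes prim: "primitive_dirichlet_character N chi" and np: "chi \<noteq> principal_character N"
  shows "xi N chi = entire_completed"
proof -
  have xi: "xi N chi = remove_sings (\<lambda>s. gamma_factor s * entire_L s)"
    unfolding xi_def dirichlet_L_eq[OF assms] gamma_factor_def ..
  have "remove_sings (\<lambda>s. gamma_factor s * entire_L s) s = entire_completed s" for s
  proof (rule remove_sings_eqI)
    have "entire_completed \<midarrow>s\<rightarrow> entire_completed s"
      using entire_completed_holomorphic[OF assms]
      by (metis holomorphic_on_imp_continuous_on continuous_on_eq_continuous_at open_UNIV UNIV_I isContD)
    moreover have "eventually (\<lambda>z. entire_completed z = gamma_factor z * entire_L z) (at s)"
    proof -
      have "eventually (\<lambda>z. rGamma ((z + kap) / 2) \<noteq> 0 \<and> z \<in> UNIV) (at s)"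
      proof (rule non_zero_neighbour_alt[where \<beta>=2])
        show "rGamma ((2 + kap) / 2) \<noteq> 0" using gamma_arg[of 2] by (simp add: rGamma_eq_zero_iff)
      qed (auto intro!: holomorphic_intros)
      thus ?thesis
      proof eventually_elim
        case (elim z)
        hence "(z + kap) / 2 \<notin> \<int>\<^sub>\<le>\<^sub>0" by (simp add: rGamma_eq_zero_iff)
        from gamma_factor_inverse[OF this] show ?case by (simp add: entire_L_def mult_ac)
      qed
    qed
    ultimately show "(\<lambda>s. gamma_factor s * entire_L s) \<midarrow>s\<rightarrow> entire_completed s" by (simp cong: tendsto_cong)
  qed
  thus ?thesis unfolding xi by (rule ext)
qed

end

section \<open>Growth\<close>

lemma Re_csqrt_ge:
  assumes "Re z \<ge> 0"
  shows "Re (csqrt z) \<ge> sqrt (norm z / 2)"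
  using assms by (simp add: real_sqrt_le_mono)

lemma phragmen_lindelof_half_plane:
  fixes K :: nat
  assumes hol: "F holomorphic_on S" and S: "open S" "{s. Re s \<ge> 1/2} \<subseteq> S"
    and bd: "\<And>s. Re s = 1/2 \<Longrightarrow> norm (F s) \<le> 1"
    and growth: "\<And>s. Re s \<ge> 1/2 \<Longrightarrow> norm (F s) \<le> C * (1 + norm s) ^ K"
    and s0: "Re s0 \<ge> 1/2"
  shows "norm (F s0) \<le> 1"
proof -
  have C: "C \<ge> 0"
  proof (rule ccontr)
    assume "\<not> C \<ge> 0"
    hence "C * (1 + norm (1::complex)) ^ K < 0" by (intro mult_neg_pos) auto
    moreover have "norm (F 1) \<le> C * (1 + norm (1::complex)) ^ K" by (rule growth) simp
    ultimately show False using norm_ge_zero[of "F 1"] by linarith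
  qed
  have eps: "norm (F s0) \<le> exp (\<epsilon> * Re (csqrt (s0 + 1/2)))" if \<epsilon>: "\<epsilon> > 0" for \<epsilon>
  proof -
    \<comment> \<open>The damping factor has modulus at most exp (- \<epsilon> sqrt (|s| / 2)) on
      the half-plane, which beats any polynomial; afterwards \<epsilon> tends to 0. The shift by 1/2
      keeps the argument off the branch cut.\<close>
    define G where "G = (\<lambda>s. F s * exp (- (of_real \<epsilon> * csqrt (s + 1/2))))"
    have nG: "norm (G s) = norm (F s) * exp (- (\<epsilon> * Re (csqrt (s + 1/2))))" for s
      by (simp add: G_def norm_mult del: csqrt.simps)
    have "((\<lambda>x::real. C * (1 + x) ^ K * exp (- (\<epsilon> * sqrt (x / 2)))) \<longlongrightarrow> 0) at_top"
      using \<epsilon> by real_asymp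
    hence "eventually (\<lambda>x::real. C * (1 + x) ^ K * exp (- (\<epsilon> * sqrt (x / 2))) < 1) at_top"
      by (rule order_tendstoD(2)) simp
    then obtain R0 where R0: "\<And>x. x \<ge> R0 \<Longrightarrow> C * (1 + x) ^ K * exp (- (\<epsilon> * sqrt (x / 2))) < 1"
      by (auto simp: eventually_at_top_linorder)
    have far: "norm (G s) \<le> 1" if s: "Re s \<ge> 1/2" "norm s \<ge> R0" for s
    proof -
      have "norm s \<le> norm (s + 1/2)"
      proof -
        have "(norm s)\<^sup>2 \<le> (norm (s + 1/2))\<^sup>2"
          unfolding cmod_power2 using s power_mono[of "Re s" "Re s + 1/2" 2] by simp
        thus ?thesis by (rule power2_le_imp_le) simp
      qed
      hence "sqrt (norm s / 2) \<le> sqrt (norm (s + 1/2) / 2)" by (intro real_sqrt_le_mono) simp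
      also have "\<dots> \<le> Re (csqrt (s + 1/2))" by (rule Re_csqrt_ge) (use s in simp)
      finally have "exp (- (\<epsilon> * Re (csqrt (s + 1/2)))) \<le> exp (- (\<epsilon> * sqrt (norm s / 2)))"
        using \<epsilon> by (simp del: csqrt.simps)
      hence "norm (G s) \<le> (C * (1 + norm s) ^ K) * exp (- (\<epsilon> * sqrt (norm s / 2)))"
        unfolding nG using growth[OF s(1)] C by (intro mult_mono) auto
      also have "\<dots> \<le> 1" using R0[OF s(2)] by simp
      finally show ?thesis .
    qed
    have line: "norm (G s) \<le> 1" if s: "Re s = 1/2" for s
    proof -
      have "0 \<le> sqrt (norm (s + 1/2) / 2)" by simp
      also have "\<dots> \<le> Re (csqrt (s + 1/2))" by (rule Re_csqrt_ge) (use s in simp)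
      finally have "exp (- (\<epsilon> * Re (csqrt (s + 1/2)))) \<le> 1" using \<epsilon> by (simp del: csqrt.simps)
      thus ?thesis unfolding nG using bd[OF s] by (intro mult_le_one) auto
    qed
    have "norm (G s0) \<le> 1"
    proof (cases "Re s0 = 1/2")
      case True thus ?thesis by (rule line)
    next
      case False
      define R where "R = max R0 (norm s0 + 1)"
      define D where "D = {s. Re s > 1/2} \<inter> ball 0 R"
      have clD: "closure D \<subseteq> {s. Re s \<ge> 1/2} \<inter> cball 0 R"
        by (intro closure_minimal closed_Int closed_halfspace_Re_ge closed_cball) (auto simp: D_def)
      have opD: "open D" unfolding D_def by (intro open_Int open_halfspace_Re_gt open_ball)
      have holG: "G holomorphic_on {s. Re s \<ge> 1/2}" unfolding G_def
        by (intro holomorphic_intros holomorphic_on_subset[OF hol S(2)])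
           (auto simp: complex_nonpos_Reals_iff)
      show ?thesis
      proof (rule maximum_modulus_frontier[where S=D and f=G and \<xi>=s0])
        show "G holomorphic_on interior D" using opD
          by (simp add: interior_open) (rule holomorphic_on_subset[OF holG], auto simp: D_def)
        show "continuous_on (closure D) G"
          using holomorphic_on_imp_continuous_on[OF holG] by (rule continuous_on_subset) (use clD in auto)
        show "bounded D" unfolding D_def by (rule bounded_subset[OF bounded_ball]) auto
        show "s0 \<in> D" using s0 False by (auto simp: D_def R_def)
        fix z assume z: "z \<in> frontier D"
        hence z1: "z \<in> closure D" "z \<notin> D" using opD by (auto simp: frontier_def interior_open)
        hence z2: "Re z \<ge> 1/2" "norm z \<le> R" using clD by auto
        show "norm (G z) \<le> 1"
        proof (cases "Re z = 1/2")
          case True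
          thus ?thesis by (rule line)
        next
          case False
          hence "norm z \<ge> R" using z1(2) z2 by (auto simp: D_def)
          thus ?thesis using far z2 by (simp add: R_def)
        qed
      qed
    qed
    thus ?thesis unfolding nG by (simp add: exp_minus field_simps del: csqrt.simps)
  qed
  define r where "r = Re (csqrt (s0 + 1/2))"
  have "((\<lambda>\<epsilon>::real. exp (\<epsilon> * r)) \<longlongrightarrow> exp (0 * r)) (at_right 0)"
    by (intro tendsto_intros)
  moreover have "eventually (\<lambda>\<epsilon>::real. norm (F s0) \<le> exp (\<epsilon> * r)) (at_right 0)"
    using eps unfolding r_def[symmetric] by (auto simp: eventually_at_filter)
  ultimately show ?thesis by (intro tendsto_lowerbound[where F="at_right (0::real)" and f="\<lambda>\<epsilon>. exp (\<epsilon> * r)"]) auto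
qed

text \<open>|Gamma (u + i y)| / Gamma u is the limit of the products of (u + k) / |u + k + i y|, and
  each factor increases with u.\<close>

lemma norm_Gamma_ratio:
  fixes x x' y :: real
  assumes x: "0 < x" "x \<le> x'"
  shows "norm (Gamma (Complex x y)) * Gamma x' \<le> norm (Gamma (Complex x' y)) * Gamma x"
proof -
  define Q where "Q = (\<lambda>u n. \<Prod>k\<le>n. (u + real k) / norm (Complex (u + real k) y))"
  have GS: "norm (Gamma_series (Complex u y) n) = Gamma_series u n * Q u n" if u: "u > 0" for u n
  proof -
    have ek: "Complex u y + of_nat k = Complex (u + real k) y" for k by (simp add: complex_eq_iff)
    have pos: "u + real k > 0" for k using u by simp
    have p: "pochhammer u (n + 1) = (\<Prod>k\<le>n. u + real k)"
      by (simp add: pochhammer_prod lessThan_Suc_atMost[symmetric] atLeast0LessThan)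
    have pc: "norm (pochhammer (Complex u y) (n + 1)) = (\<Prod>k\<le>n. norm (Complex (u + real k) y))"
      by (simp add: pochhammer_prod lessThan_Suc_atMost[symmetric] atLeast0LessThan ek prod_norm[symmetric] norm_mult)
    have nz: "(\<Prod>k\<le>n. u + real k) \<noteq> 0" using pos by (auto simp: less_imp_neq[symmetric])
    have e: "norm (exp (Complex u y * of_real (ln (real n)))) = exp (u * ln (real n))" by simp
    have "norm (Gamma_series (Complex u y) n) = fact n * exp (u * ln (real n)) / (\<Prod>k\<le>n. norm (Complex (u + real k) y))"
      unfolding Gamma_series_def norm_divide norm_mult pc e by simp
    also have "\<dots> = fact n * exp (u * ln (real n)) / (\<Prod>k\<le>n. u + real k) * Q u n"
      unfolding Q_def prod_dividef using nz by simp
    also have "fact n * exp (u * ln (real n)) / (\<Prod>k\<le>n. u + real k) = Gamma_series u n"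
      unfolding Gamma_series_def p by simp
    finally show ?thesis .
  qed
  have Q: "0 \<le> Q x n" "Q x n \<le> Q x' n" for n
  proof -
    show "0 \<le> Q x n" unfolding Q_def using x by (intro prod_nonneg) auto
    show "Q x n \<le> Q x' n" unfolding Q_def
    proof (rule prod_mono, intro conjI)
      fix k
      define a b where "a = x + real k" and "b = x' + real k"
      have ab: "0 < a" "a \<le> b" using x by (auto simp: a_def b_def)
      have na: "norm (Complex a y) > 0" "norm (Complex b y) > 0" using ab by (auto simp: complex_eq_iff)
      have "(a * norm (Complex b y))\<^sup>2 \<le> (b * norm (Complex a y))\<^sup>2"
      proof -
        have "a\<^sup>2 * y\<^sup>2 \<le> b\<^sup>2 * y\<^sup>2" using ab by (intro mult_right_mono power_mono) auto
        thus ?thesis by (simp add: power_mult_distrib cmod_power2 algebra_simps)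
      qed
      hence "a * norm (Complex b y) \<le> b * norm (Complex a y)"
        by (rule power2_le_imp_le) (use ab in auto)
      thus "a / norm (Complex a y) \<le> b / norm (Complex b y)" using na by (simp add: divide_le_eq mult.commute pos_le_divide_eq)
      show "0 \<le> a / norm (Complex a y)" using ab by simp
    qed
  qed
  have le: "norm (Gamma_series (Complex x y) n) * Gamma_series x' n \<le> norm (Gamma_series (Complex x' y) n) * Gamma_series x n" for n
  proof -
    have x': "x' > 0" using x by simp
    have GSp: "Gamma_series u n \<ge> 0" if "u > 0" for u :: real
      unfolding Gamma_series_def using that by (intro divide_nonneg_nonneg pochhammer_nonneg) auto
    have "(Gamma_series x n * Gamma_series x' n) * Q x n \<le> (Gamma_series x n * Gamma_series x' n) * Q x' n"
      by (intro mult_left_mono Q mult_nonneg_nonneg GSp x x')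
    thus ?thesis unfolding GS[OF x(1)] GS[OF x'] by (simp only: mult_ac)
  qed
  have "(\<lambda>n. norm (Gamma_series (Complex x y) n) * Gamma_series x' n) \<longlonglongrightarrow> norm (Gamma (Complex x y)) * Gamma x'"
    "(\<lambda>n. norm (Gamma_series (Complex x' y) n) * Gamma_series x n) \<longlonglongrightarrow> norm (Gamma (Complex x' y)) * Gamma x"
    by (intro tendsto_mult tendsto_norm Gamma_series_LIMSEQ)+
  thus ?thesis by (rule LIMSEQ_le) (use le in blast)
qed

text \<open>Gamma increases from 3/2 on, and below that compactness bounds its values from both
  sides. The start 1/4 is half of the abscissa 1/2.\<close>

lemma Gamma_real_ratio_bounded:
  obtains C where "C > 0" "\<And>x x' :: real. 1/4 \<le> x \<Longrightarrow> x \<le> x' \<Longrightarrow> Gamma x \<le> C * Gamma x'"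
proof -
  have cont: "continuous_on {1/4..3/2} (Gamma :: real \<Rightarrow> real)"
    by (intro continuous_intros) (auto elim!: nonpos_Ints_cases)
  obtain u where u: "u \<in> {1/4..3/2::real}" "\<And>x. x \<in> {1/4..3/2} \<Longrightarrow> Gamma x \<le> Gamma u"
    using continuous_attains_sup[OF compact_Icc _ cont] by auto
  obtain v where v: "v \<in> {1/4..3/2::real}" "\<And>x. x \<in> {1/4..3/2} \<Longrightarrow> Gamma v \<le> Gamma x"
    using continuous_attains_inf[OF compact_Icc _ cont] by auto
  have mono: "Gamma x \<le> Gamma y" if "3/2 \<le> x" "x \<le> y" for x y :: real
    using Gamma_real_strict_mono[OF that(1), of y] that(2) by (cases "x = y") auto
  have pos: "Gamma u > 0" "Gamma v > 0" using u(1) v(1) by auto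
  have vu: "Gamma v \<le> Gamma u" using u v by blast
  define C where "C = Gamma u / Gamma v"
  have C: "C \<ge> 1" using pos vu by (simp add: C_def)
  have "0 < C" using C by linarith
  moreover have "Gamma x \<le> C * Gamma x'" if x: "1/4 \<le> x" "x \<le> x'" for x x' :: real
  proof (cases "x \<le> 3/2")
    case True
    have "Gamma v \<le> Gamma x'"
    proof (cases "x' \<le> 3/2")
      case False
      have "Gamma v \<le> Gamma (3/2)" by (rule v(2)) simp
      also have "\<dots> \<le> Gamma x'" using False by (intro mono) auto
      finally show ?thesis .
    qed (use v(2) x in simp)
    have "Gamma x \<le> Gamma u" using u(2) x True by simp
    also have "\<dots> = C * Gamma v" using pos by (simp add: C_def)
    also have "\<dots> \<le> C * Gamma x'" using C \<open>Gamma v \<le> Gamma x'\<close> by (intro mult_left_mono) auto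
    finally show ?thesis .
  next
    case False
    have "Gamma x \<le> Gamma x'" using False x by (intro mono) auto
    also have "\<dots> \<le> C * Gamma x'"
    proof -
      have "Gamma x' > 0" using x by (intro Gamma_real_pos) simp
      thus ?thesis using C mult_right_mono[of 1 C "Gamma x'"] by simp
    qed
    finally show ?thesis .
  qed
  ultimately show ?thesis using that by blast
qed

context dchar
begin

text \<open>3/4 is 1/4 for the term at 2 plus 1/2 for the later ones, majorised by a telescoping
  series.\<close>

lemma L_near_one:
  assumes s: "Re s \<ge> 2"
  shows "norm (L s - 1) \<le> 3/4"
proof -
  have s1: "Re s > 1" using s by simp
  define b where "b = (\<lambda>n::nat. if n = 0 then 1/4 else 1 / (real n + 1) - 1 / (real n + 2))"
  have "(\<lambda>n. 1 / (real (n + 1) + 1)) \<longlonglongrightarrow> 0" by real_asymp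
  hence "(\<lambda>n. 1 / (real n + 1 + 1) - 1 / (real (Suc n) + 1 + 1)) sums (1 / (real 0 + 1 + 1) - 0)"
    by (intro telescope_sums') (simp add: add_ac)
  hence "(\<lambda>n. b (Suc n)) sums (1/2)" by (simp add: b_def add_ac)
  hence b: "b sums (3/4)" by (subst (asm) sums_Suc_iff) (simp add: b_def)
  have le: "norm (chi (int (Suc (Suc n))) * dterm s (Suc n)) \<le> b n" for n
  proof -
    have "norm (chi (int (Suc (Suc n))) * dterm s (Suc n)) \<le> 1 * real (Suc (Suc n)) powr (- Re s)"
      unfolding norm_mult norm_dterm by (intro mult_mono norm_chi_le) auto
    also have "\<dots> \<le> real (Suc (Suc n)) powr (- 2)" using s by (simp add: powr_mono)
    also have "\<dots> = 1 / (real n + 2)\<^sup>2" by (simp add: powr_minus divide_inverse add_ac)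
    also have "\<dots> \<le> b n"
    proof (cases "n = 0")
      case False
      hence "1 / (real n + 2)\<^sup>2 \<le> 1 / ((real n + 1) * (real n + 2))"
        by (intro divide_left_mono) (auto simp: power2_eq_square intro!: mult_right_mono mult_pos_pos)
      also have "\<dots> = b n" using False by (simp add: b_def divide_simps)
      finally show ?thesis .
    qed (simp add: b_def)
    finally show ?thesis .
  qed
  have "(\<lambda>n. chi (int (Suc n)) * dterm s n) sums L s"
    unfolding L_def dseries_def by (rule summable_sums[OF summable_norm_cancel[OF summable_chi_dterm[OF s1]]])
  hence "(\<lambda>n. chi (int (Suc (Suc n))) * dterm s (Suc n)) sums (L s - chi (int (Suc 0)) * dterm s 0)"
    by (subst sums_Suc_iff) simp
  hence "L s - 1 = (\<Sum>n. chi (int (Suc (Suc n))) * dterm s (Suc n))"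
    by (simp add: sums_iff chi_1 dterm_def)
  also have "norm \<dots> \<le> (\<Sum>n. b n)" by (rule norm_suminf_le[OF le sums_summable[OF b]])
  also have "\<dots> = 3/4" using b by (simp add: sums_iff)
  finally show ?thesis .
qed

lemma L_bounds_right:
  assumes "Re s \<ge> 2"
  shows "norm (L s) \<ge> 1/4" "norm (L s) \<le> 7/4"
  using L_near_one[OF assms] norm_triangle_ineq2[of 1 "1 - L s"] norm_triangle_ineq2[of "L s" 1]
  by (simp_all add: norm_minus_commute)

text \<open>Harnack's inequality for \<open>ln M - log L\<close> on discs centred on the line \<open>Re s = 2\<close>, where \<open>M\<close> bounds \<open>L\<close>.\<close>

lemma L_lower_bound:
  assumes np: "chi \<noteq> principal_character N" and c: "1/2 \<le> c" "c \<le> 1" and \<delta>: "\<delta> > 0"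
    and nz: "\<And>s. Re s > c \<Longrightarrow> L s \<noteq> 0"
  obtains C and K :: nat where "C > 0" "\<And>s. Re s \<ge> c + \<delta> \<Longrightarrow> 1 \<le> C * (1 + norm s) ^ K * norm (L s)"
proof -
  obtain C1 where C1: "C1 > 0" "\<And>s. Re s \<ge> 1/2 \<Longrightarrow> norm (L s) \<le> C1 * norm s"
    using L_growth[OF np, of "1/2"] by auto
  \<comment> \<open>3 / \<delta> bounds Harnack's factor: R + dist is at most 3 and R - dist = Re s
    - c is at least \<delta>.\<close>
  define K where "K = nat \<lceil>3 / \<delta>\<rceil>"
  \<comment> \<open>Chosen so that 4 M \<le> B (1 + |s|); the outer 4 comes from |L| \<ge> 1/4 at
    the centre of the disc.\<close>
  define B where "B = 4 * (4 * C1 + 1)"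
  have B: "B \<ge> 4" using C1(1) by (simp add: B_def)
  have "1 \<le> B ^ K * (1 + norm s) ^ K * norm (L s)" if s: "Re s \<ge> c + \<delta>" "Re s < 2" for s
  proof -
    define z0 where "z0 = Complex 2 (Im s)"
    define R where "R = 2 - c"
    define M where "M = C1 * (norm s + 4) + 1"
    have "C1 * (norm s + 4) > 0" using C1(1) by (intro mult_pos_pos add_nonneg_pos) auto
    hence M1: "M > 1" by (simp add: M_def)
    have in_ball: "Re z > c" "norm z \<le> norm s + 4" if "z \<in> ball z0 R" for z
    proof -
      have d: "norm (z0 - z) < R" using that by (simp add: dist_norm)
      have "2 - Re z < R" using abs_Re_le_cmod[of "z0 - z"] d by (simp add: z0_def)
      thus "Re z > c" by (simp add: R_def)
      have "norm z0 \<le> 2 + norm s" using cmod_le[of z0] abs_Im_le_cmod[of s] by (simp add: z0_def)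
      moreover have "norm z \<le> norm z0 + norm (z0 - z)" using norm_triangle_ineq4[of z0 "z0 - z"] by simp
      ultimately show "norm z \<le> norm s + 4" using d c by (simp add: R_def)
    qed
    have hol: "L holomorphic_on ball z0 R"
      by (rule holomorphic_on_subset[OF L_holomorphic[OF np]]) (use in_ball(1) c in force)
    have R: "R > 0" using c by (simp add: R_def)
    obtain g where g: "g holomorphic_on ball z0 R" "\<And>z. z \<in> ball z0 R \<Longrightarrow> exp (g z) = L z"
      using holomorphic_logarithm_exists[of "ball z0 R" L z0] hol nz in_ball(1) R by auto
    define p where "p = (\<lambda>z. of_real (ln M) - g z)"
    have Rep: "Re (p z) = ln M - ln (norm (L z))" if "z \<in> ball z0 R" for z
      using arg_cong[OF g(2)[OF that], of norm] by (simp add: p_def ln_unique)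
    have pos: "Re (p z) > 0" if z: "z \<in> ball z0 R" for z
    proof -
      have "norm (L z) \<le> C1 * norm z" using C1(2)[of z] in_ball(1)[OF z] c by simp
      also have "\<dots> < M" using in_ball(2)[OF z] C1(1) unfolding M_def
        by (metis add_strict_increasing2 less_add_one mult_left_mono less_imp_le order.strict_trans1)
      finally have "norm (L z) < M" .
      moreover have "norm (L z) > 0" using nz in_ball(1)[OF z] by simp
      ultimately show ?thesis unfolding Rep[OF z] using M1 by simp
    qed
    have holp: "p holomorphic_on ball z0 R" unfolding p_def by (intro holomorphic_intros g)
    have dist: "dist z0 s = 2 - Re s"
    proof -
      have "z0 - s = of_real (2 - Re s)" by (simp add: z0_def complex_eq_iff)
      thus ?thesis using s(2) by (simp only: dist_norm norm_of_real)
    qed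
    have sB: "s \<in> ball z0 R" using s(1) \<delta> by (simp add: dist R_def)
    have zB: "z0 \<in> ball z0 R" using R by simp
    have "Re (p s) * (R - (2 - Re s)) \<le> Re (p z0) * (R + (2 - Re s))"
      using Harnack_half_plane(2)[OF holp pos sB] by (simp add: dist)
    moreover have "Re (p s) * \<delta> \<le> Re (p s) * (R - (2 - Re s))"
      using pos[OF sB] s(1) by (intro mult_left_mono) (auto simp: R_def)
    moreover have "Re (p z0) * (R + (2 - Re s)) \<le> Re (p z0) * 3"
      using pos[OF zB] s(1) \<delta> c by (intro mult_left_mono) (auto simp: R_def)
    ultimately have "Re (p s) * \<delta> \<le> Re (p z0) * 3" by linarith
    hence 1: "Re (p s) \<le> 3 / \<delta> * Re (p z0)" using \<delta> by (simp add: field_simps)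
    have Lz0: "norm (L z0) \<ge> 1/4" by (rule L_bounds_right) (simp add: z0_def)
    have "Re (p z0) \<le> ln M - ln (1/4)" unfolding Rep[OF zB] using Lz0 by (intro diff_left_mono ln_mono) auto
    also have "\<dots> = ln (4 * M)" using M1 by (simp add: ln_mult ln_div)
    finally have 2: "Re (p z0) \<le> ln (4 * M)" .
    have l0: "ln (4 * M) > 0" using M1 by simp
    have "Re (p s) \<le> 3 / \<delta> * ln (4 * M)"
      using 1 2 \<delta> by (meson divide_nonneg_pos mult_left_mono order.trans zero_le_numeral)
    also have "\<dots> \<le> real K * ln (4 * M)"
      using l0 by (intro mult_right_mono) (auto simp: K_def real_nat_ceiling_ge)
    also have "\<dots> = ln ((4 * M) ^ K)" by (rule ln_realpow[symmetric])
    finally have "ln M - ln (norm (L s)) \<le> ln ((4 * M) ^ K)" unfolding Rep[OF sB] .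
    moreover have "ln M > 0" using M1 by simp
    ultimately have "0 \<le> ln ((4 * M) ^ K) + ln (norm (L s))" by linarith
    moreover have Ls: "norm (L s) > 0" using nz in_ball(1)[OF sB] by simp
    moreover have M4: "(4 * M) ^ K > 0" using M1 by simp
    ultimately have "0 \<le> ln ((4 * M) ^ K * norm (L s))" by (simp only: ln_mult_pos)
    hence "1 \<le> (4 * M) ^ K * norm (L s)" using Ls M4 by (simp add: ln_ge_zero_iff)
    also have "4 * M \<le> B * (1 + norm s)" using C1(1) by (simp add: M_def B_def algebra_simps)
    hence "(4 * M) ^ K * norm (L s) \<le> (B * (1 + norm s)) ^ K * norm (L s)"
      using M1 by (intro mult_right_mono power_mono) auto
    finally show ?thesis by (simp add: power_mult_distrib)
  qed
  moreover have "1 \<le> 4 * (1 + norm s) ^ K * norm (L s)" if "Re s \<ge> 2" for s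
  proof -
    have "1 * 1 \<le> (1 + norm s) ^ K * (4 * norm (L s))"
      using L_bounds_right(1)[OF that] by (intro mult_mono) (auto simp: one_le_power)
    thus ?thesis by (simp add: mult_ac)
  qed
  ultimately have "1 \<le> (B ^ K + 4) * (1 + norm s) ^ K * norm (L s)" if "Re s \<ge> c + \<delta>" for s
  proof -
    define w where "w = (1 + norm s) ^ K * norm (L s)"
    have w: "w \<ge> 0" by (simp add: w_def)
    have Bw: "0 \<le> B ^ K * w" "0 \<le> 4 * w" using B w by auto
    have "1 \<le> B ^ K * w \<or> 1 \<le> 4 * w"
      using \<open>\<And>s. c + \<delta> \<le> Re s \<Longrightarrow> Re s < 2 \<Longrightarrow> 1 \<le> B ^ K * (1 + norm s) ^ K * norm (L s)\<close>[OF that]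
        \<open>\<And>s. Re s \<ge> 2 \<Longrightarrow> 1 \<le> 4 * (1 + norm s) ^ K * norm (L s)\<close>[of s]
      unfolding w_def by (cases "Re s < 2") (auto simp: mult.assoc)
    hence "1 \<le> B ^ K * w + 4 * w" using Bw by linarith
    thus ?thesis by (simp add: w_def distrib_right mult.assoc)
  qed
  moreover have "B ^ K + 4 > 0" using B by (intro add_nonneg_pos) auto
  ultimately show ?thesis using that by blast
qed

end

section \<open>Comparison of moduli on both sides of the critical line\<close>

locale primitive_nonprincipal = dchar +
  assumes prim: "primitive_dirichlet_character N chi" and np: "chi \<noteq> principal_character N"
begin

abbreviation Xi :: "complex \<Rightarrow> complex" where "Xi \<equiv> entire_completed"

lemma Xi_holomorphic: "Xi holomorphic_on A"
  using entire_completed_holomorphic[OF prim np] holomorphic_on_subset by blast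

lemma isCont_Xi: "isCont Xi s"
  by (metis Xi_holomorphic UNIV_I continuous_on_eq_continuous_at holomorphic_on_imp_continuous_on open_UNIV)

lemma norm_Xi_reflection: "norm (Xi (1 - cnj s)) = norm (Xi s)"
  using arg_cong[OF entire_completed_reflection[OF prim np, of s], of norm] norm_root_number[OF prim np]
  by (simp add: conj_refl_def norm_mult)

lemma Xi_eq: "Re s > 0 \<Longrightarrow> Xi s = gamma_factor s * L s"
  by (simp add: entire_completed_def completed_def)

lemma L_nonzero: "Re s \<ge> 1 \<Longrightarrow> L s \<noteq> 0"
proof (cases "Re s = 1")
  case True
  hence "s = Complex 1 (Im s)" by (simp add: complex_eq_iff)
  thus ?thesis using L_nonzero_line[OF np, of "Im s"] by metis
next
  case False
  assume "Re s \<ge> 1"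
  thus ?thesis using L_nonzero_right[of s] False by simp
qed

lemma norm_gamma_factor:
  assumes "Re s > 0"
  shows "norm (gamma_factor s) = (pi / N) powr (- ((Re s + real (parity chi)) / 2)) *
    norm (Gamma (Complex ((Re s + real (parity chi)) / 2) (Im s / 2)))"
proof -
  have e: "(s + kap) / 2 = Complex ((Re s + real (parity chi)) / 2) (Im s / 2)"
    by (simp add: complex_eq_iff)
  show ?thesis unfolding gamma_factor_def norm_mult e
    by (subst norm_powr_real_powr) auto
qed

text \<open>Equal imaginary parts let the vertical decay of Gamma cancel, which reduces the
  comparison to real arguments. The bound on the horizontal distance controls the powers of pi / N,
  which may lie on either side of 1.\<close>

lemma gamma_factor_ratio:
  assumes h: "h > 0"
  obtains C where "C > 0"
    "\<And>z w. 1/2 \<le> Re z \<Longrightarrow> Re z \<le> Re w \<Longrightarrow> Re w \<le> Re z + 2 * h \<Longrightarrow> Im z = Im w \<Longrightarrow>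
       norm (gamma_factor z) \<le> C * norm (gamma_factor w)"
proof -
  obtain C where C: "C > 0" "\<And>x x' :: real. 1/4 \<le> x \<Longrightarrow> x \<le> x' \<Longrightarrow> Gamma x \<le> C * Gamma x'"
    using Gamma_real_ratio_bounded by blast
  define y where "y = pi / N"
  have y: "y > 0" using N_pos by (simp add: y_def)
  define Y where "Y = max 1 y powr h"
  have Y: "Y > 0" by (simp add: Y_def)
  have "norm (gamma_factor z) \<le> (Y * C) * norm (gamma_factor w)"
    if zw: "1/2 \<le> Re z" "Re z \<le> Re w" "Re w \<le> Re z + 2 * h" "Im z = Im w" for z w
  proof -
    define x x' v where "x = (Re z + real (parity chi)) / 2" and "x' = (Re w + real (parity chi)) / 2"
      and "v = Im w / 2"
    have x: "1/4 \<le> x" "x \<le> x'" "x' - x \<le> h" using zw by (auto simp: x_def x'_def diff_divide_distrib[symmetric])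
    have nz: "norm (gamma_factor z) = y powr (- x) * norm (Gamma (Complex x v))"
      and nw: "norm (gamma_factor w) = y powr (- x') * norm (Gamma (Complex x' v))"
      using norm_gamma_factor[of z] norm_gamma_factor[of w] zw by (auto simp: x_def x'_def y_def v_def)
    have G: "norm (Gamma (Complex x v)) \<le> C * norm (Gamma (Complex x' v))"
    proof -
      have g: "Gamma x' > 0" using x by (intro Gamma_real_pos) auto
      have "norm (Gamma (Complex x v)) * Gamma x' \<le> norm (Gamma (Complex x' v)) * Gamma x"
        using x by (intro norm_Gamma_ratio) auto
      also have "\<dots> \<le> norm (Gamma (Complex x' v)) * (C * Gamma x')"
        using C(2)[OF x(1,2)] by (intro mult_left_mono) auto
      finally have "norm (Gamma (Complex x v)) * Gamma x' \<le> (C * norm (Gamma (Complex x' v))) * Gamma x'"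
        by (simp only: mult_ac)
      thus ?thesis using g by simp
    qed
    have P: "y powr (- x) \<le> Y * y powr (- x')"
    proof -
      have "y powr (- x) = y powr (x' - x) * y powr (- x')" by (simp add: powr_add[symmetric])
      moreover have "y powr (x' - x) \<le> max 1 y powr (x' - x)" using y x by (intro powr_mono2) auto
      moreover have "max 1 y powr (x' - x) \<le> Y" unfolding Y_def using x by (intro powr_mono) auto
      ultimately show ?thesis using mult_right_mono[of "y powr (x' - x)" Y "y powr (- x')"] by simp
    qed
    have "norm (gamma_factor z) \<le> (Y * y powr (- x')) * (C * norm (Gamma (Complex x' v)))"
      unfolding nz using P G Y C(1) by (intro mult_mono) auto
    thus ?thesis unfolding nw by (simp only: mult_ac)
  qed
  moreover have "Y * C > 0" using Y C(1) by simp
  ultimately show ?thesis using that by blast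
qed

text \<open>The excess of h over c - 1/2 keeps s + h at distance \<delta> from the possible zeros of
  L, so the denominator has a polynomial lower bound, and the quotient is holomorphic past the
  critical line.\<close>

lemma Xi_quotient_le:
  assumes c: "1/2 \<le> c" "c \<le> 1" and h: "h > c - 1/2"
    and nz: "\<And>s. Re s > c \<Longrightarrow> L s \<noteq> 0" and s: "Re s \<ge> 1/2"
  shows "norm (Xi (s - of_real h)) \<le> norm (Xi (s + of_real h))"
proof -
  have h0: "h > 0" using c h by simp
  have Xnz: "Xi z \<noteq> 0" if "Re z > c" for z
    using that c nz[OF that] Xi_eq[of z] gamma_factor_nonzero[of z] by simp
  define F where "F = (\<lambda>s. Xi (s - of_real h) / Xi (s + of_real h))"
  define \<delta> where "\<delta> = h - (c - 1/2)"
  have \<delta>: "\<delta> > 0" using h by (simp add: \<delta>_def)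
  obtain C1 where C1: "C1 > 0"
    "\<And>z w. 1/2 \<le> Re z \<Longrightarrow> Re z \<le> Re w \<Longrightarrow> Re w \<le> Re z + 2 * h \<Longrightarrow> Im z = Im w \<Longrightarrow>
       norm (gamma_factor z) \<le> C1 * norm (gamma_factor w)"
    using gamma_factor_ratio[OF h0] by blast
  obtain C2 where C2: "C2 > 0" "\<And>s. Re s \<ge> 1/2 \<Longrightarrow> norm (L s) \<le> C2 * norm s"
    using L_growth[OF np, of "1/2"] by auto
  obtain C3 and K :: nat where C3: "C3 > 0" "\<And>s. Re s \<ge> c + \<delta> \<Longrightarrow> 1 \<le> C3 * (1 + norm s) ^ K * norm (L s)"
    using L_lower_bound[OF np c \<delta> nz] by blast
  define H where "H = 1 + h"
  have H: "H \<ge> 1" using h0 by (simp add: H_def)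
  define C where "C = C1 * C2 * C3 * H ^ Suc K"
  have "norm (F s) \<le> 1"
  proof (rule phragmen_lindelof_half_plane[where S="{s. Re s > c - h}" and F=F])
    show "F holomorphic_on {s. Re s > c - h}" unfolding F_def
      by (intro holomorphic_intros holomorphic_on_compose_gen[OF _ Xi_holomorphic[of UNIV], unfolded o_def])
         (use Xnz in auto)
    show "open {s. Re s > c - h}" by (rule open_halfspace_Re_gt)
    show "{s. 1/2 \<le> Re s} \<subseteq> {s. Re s > c - h}" using h by auto
    show "norm (F z) \<le> 1" if z: "Re z = 1/2" for z
    proof -
      have "1 - cnj (z - of_real h) = z + of_real h" using z by (simp add: complex_eq_iff)
      hence "norm (Xi (z - of_real h)) = norm (Xi (z + of_real h))"
        using norm_Xi_reflection[of "z - of_real h"] by metis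
      thus ?thesis by (simp add: F_def norm_divide)
    qed
    show "norm (F u) \<le> C * (1 + norm u) ^ Suc K" if u: "Re u \<ge> 1/2" for u
    proof -
      define w where "w = u + of_real h"
      \<comment> \<open>If u - h lies left of the line it is replaced by its mirror image, where Xi
        has the same modulus. Then z and w lie in Re \<ge> 1/2 at equal height and at most 2 h
        apart.\<close>
      define z where "z = (if Re (u - of_real h) \<ge> 1/2 then u - of_real h else 1 - cnj (u - of_real h))"
      have z: "1/2 \<le> Re z" "Re z \<le> Re w" "Re w \<le> Re z + 2 * h" "Im z = Im w"
        using u h0 by (auto simp: z_def w_def)
      have nz1: "norm (Xi (u - of_real h)) = norm (Xi z)"
        using norm_Xi_reflection[of "u - of_real h"] by (auto simp: z_def)
      have nn: "norm z \<le> H * (1 + norm u)" "norm w \<le> norm u + h"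
      proof -
        show "norm w \<le> norm u + h" using norm_triangle_ineq[of u "of_real h"] h0 by (simp add: w_def)
        have "norm z \<le> 1 + norm (u - of_real h)"
          using norm_triangle_ineq4[of 1 "cnj (u - of_real h)"] complex_mod_cnj[of "u - of_real h"]
          by (auto simp: z_def simp del: complex_cnj_diff)
        also have "norm (u - of_real h) \<le> norm u + h" using norm_triangle_ineq4[of u "of_real h"] h0 by simp
        also have "1 + (norm u + h) \<le> H * (1 + norm u)" using h0 by (simp add: H_def algebra_simps)
        finally show "norm z \<le> H * (1 + norm u)" by simp
      qed
      have "H * (1 + norm u) = 1 + h + norm u + h * norm u" by (simp add: H_def algebra_simps)
      moreover have "0 \<le> h * norm u" using h0 by simp
      ultimately have w1: "1 + norm w \<le> H * (1 + norm u)" using nn(2) by linarith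
      have wc: "Re w \<ge> c + \<delta>" using u by (simp add: w_def \<delta>_def)
      have wnz: "gamma_factor w \<noteq> 0" "L w \<noteq> 0"
        using gamma_factor_nonzero[of w] nz[of w] wc \<delta> c by auto
      have "norm (Xi z) = norm (gamma_factor z) * norm (L z)" using Xi_eq[of z] z by (simp add: norm_mult)
      also have "\<dots> \<le> (C1 * norm (gamma_factor w)) * (C2 * (H * (1 + norm u)))"
        using C1(2)[OF z] C2(2)[OF z(1)] C1(1) C2(1) nn(1)
        by (intro mult_mono order.trans[OF C2(2)[OF z(1)]] mult_left_mono) auto
      also have "\<dots> = (C1 * norm (gamma_factor w)) * (C2 * (H * (1 + norm u))) * 1" by simp
      also have "\<dots> \<le> (C1 * norm (gamma_factor w)) * (C2 * (H * (1 + norm u))) * (C3 * (H * (1 + norm u)) ^ K * norm (L w))"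
      proof (rule mult_left_mono)
        have "1 \<le> C3 * (1 + norm w) ^ K * norm (L w)" by (rule C3(2)[OF wc])
        also have "\<dots> \<le> C3 * (H * (1 + norm u)) ^ K * norm (L w)"
          using w1 C3(1) by (intro mult_right_mono mult_left_mono power_mono) auto
        finally show "1 \<le> C3 * (H * (1 + norm u)) ^ K * norm (L w)" .
      qed (use C1(1) C2(1) H in auto)
      also have "\<dots> = C * (1 + norm u) ^ Suc K * (norm (gamma_factor w) * norm (L w))"
        by (simp add: C_def power_mult_distrib mult_ac)
      also have "norm (gamma_factor w) * norm (L w) = norm (Xi w)"
        using Xi_eq[of w] wc \<delta> c by (simp add: norm_mult)
      finally have le: "norm (Xi z) \<le> C * (1 + norm u) ^ Suc K * norm (Xi w)" .
      have "norm (Xi w) > 0" using Xnz[of w] wc \<delta> by simp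
      hence "norm (Xi z) / norm (Xi w) \<le> C * (1 + norm u) ^ Suc K" using le by (subst pos_divide_le_eq) auto
      thus ?thesis unfolding F_def norm_divide nz1 w_def[symmetric] .
    qed
  qed (rule s)
  moreover have "norm (Xi (s + of_real h)) > 0" using Xnz[of "s + of_real h"] s h by simp
  ultimately show ?thesis unfolding F_def norm_divide by (subst (asm) divide_le_eq_1_pos) auto
qed

text \<open>h is approached from the right, as h = 1/2 itself leaves no room beyond c = 1.\<close>

lemma Xi_quotient_le_half:
  assumes h: "h \<ge> 1/2" and s: "Re s \<ge> 1/2"
  shows "norm (Xi (s - of_real h)) \<le> norm (Xi (s + of_real h))"
proof -
  have "((\<lambda>h. norm (Xi (s - of_real h))) \<longlongrightarrow> norm (Xi (s - of_real h))) (at_right h)"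
    "((\<lambda>h. norm (Xi (s + of_real h))) \<longlongrightarrow> norm (Xi (s + of_real h))) (at_right h)"
    by (intro tendsto_norm isCont_tendsto_compose[OF isCont_Xi] tendsto_intros)+
  moreover have "eventually (\<lambda>h. norm (Xi (s - of_real h)) \<le> norm (Xi (s + of_real h))) (at_right h)"
    using eventually_at_right_less[of h]
  proof eventually_elim
    case (elim h')
    thus ?case using h L_nonzero s by (intro Xi_quotient_le[of 1]) auto
  qed
  ultimately show ?thesis by (intro tendsto_le[of "at_right h"]) auto
qed

text \<open>The modulus of the completed function is not periodic in the real direction, because the Gamma
  factor outgrows every exponential.\<close>

lemma Xi_not_periodic:
  assumes h: "h > 0" and per: "\<And>s. Re s > 1 \<Longrightarrow> norm (Xi (s + of_real h)) = norm (Xi s)"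
  shows False
proof -
  have per_n: "norm (Xi (s + of_real (real n * h))) = norm (Xi s)" if "Re s > 1" for s n
  proof (induction n)
    case (Suc n)
    have "Re (s + of_real (real n * h)) > 1" using that mult_nonneg_nonneg[OF of_nat_0_le_iff[of n] less_imp_le[OF h]] by simp
    from per[OF this] have "norm (Xi (s + of_real (real n * h) + of_real h)) = norm (Xi s)" using Suc by simp
    moreover have "s + of_real (real n * h) + of_real h = s + of_real (real (Suc n) * h)" by (simp add: algebra_simps)
    ultimately show ?case by metis
  qed simp
  \<comment> \<open>A multiple of the period large enough for d \<ge> 1: the shift m h = 2 d moves
    the Gamma argument by d, at least one full step of Gamma (x + 1) = x Gamma x.\<close>
  define m where "m = nat \<lceil>2 / h\<rceil>"
  define d where "d = real m * h / 2"
  have "2 / h \<le> real m" by (simp add: m_def real_nat_ceiling_ge)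
  hence d: "d \<ge> 1" using h by (simp add: d_def field_simps)
  define \<kappa> where "\<kappa> = real (parity chi)"
  define y where "y = pi / N"
  have y: "y > 0" using N_pos by (simp add: y_def)
  \<comment> \<open>7 is the ratio of the bounds 7/4 and 1/4 for |L| on Re s \<ge> 2. The right side
    does not depend on x, which is absurd for large x.\<close>
  have bound: "x \<le> 7 * y powr d" if x: "x \<ge> 2" for x
  proof -
    define \<sigma> where "\<sigma> = 2 * x - \<kappa>"
    have \<sigma>: "\<sigma> \<ge> 2" "(\<sigma> + \<kappa>) / 2 = x" "(\<sigma> + 2 * d + \<kappa>) / 2 = x + d"
      using x by (auto simp: \<sigma>_def \<kappa>_def parity_def add_divide_distrib)
    have C0: "Complex u 0 = of_real u" for u by (simp add: complex_eq_iff)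
    have X: "norm (Xi (of_real u)) = y powr (- ((u + \<kappa>) / 2)) * Gamma ((u + \<kappa>) / 2) * norm (L (of_real u))" if "u \<ge> 2" for u
    proof -
      have "Gamma ((u + \<kappa>) / 2) > 0" using that by (intro Gamma_real_pos) (simp add: \<kappa>_def add_pos_nonneg)
      thus ?thesis using that norm_gamma_factor[of "of_real u"] Xi_eq[of "of_real u"]
        by (simp add: norm_mult C0 Gamma_complex_of_real y_def \<kappa>_def del: of_real_divide of_real_add)
    qed
    have "norm (Xi (of_real \<sigma> + of_real (real m * h))) = norm (Xi (of_real \<sigma>))"
      by (rule per_n) (use \<sigma> in simp)
    moreover have "complex_of_real \<sigma> + of_real (real m * h) = of_real (\<sigma> + 2 * d)" by (simp add: d_def)
    ultimately have "norm (Xi (of_real (\<sigma> + 2 * d))) = norm (Xi (of_real \<sigma>))" by simp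
    hence eq: "y powr (- (x + d)) * Gamma (x + d) * norm (L (of_real (\<sigma> + 2 * d))) =
        y powr (- x) * Gamma x * norm (L (of_real \<sigma>))"
      using X[of \<sigma>] X[of "\<sigma> + 2 * d"] \<sigma> d by simp
    have Gp: "Gamma x > 0" using x by (intro Gamma_real_pos) simp
    have G: "x * Gamma x \<le> Gamma (x + d)"
    proof -
      have "x \<notin> \<int>\<^sub>\<le>\<^sub>0" using x by (auto elim!: nonpos_Ints_cases)
      hence "x * Gamma x = Gamma (x + 1)" by (simp add: Gamma_plus1)
      also have "\<dots> \<le> Gamma (x + d)"
        using Gamma_real_strict_mono[of "x + 1" "x + d"] x d by (cases "d = 1") auto
      finally show ?thesis .
    qed
    have "(y powr (- (x + d)) * Gamma x) * (x * (1/4)) = y powr (- (x + d)) * (x * Gamma x) * (1/4)" by simp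
    also have "\<dots> \<le> y powr (- (x + d)) * Gamma (x + d) * norm (L (of_real (\<sigma> + 2 * d)))"
      using L_bounds_right(1)[of "of_real (\<sigma> + 2 * d)"] \<sigma> d G x Gp
      by (intro mult_mono mult_left_mono) (auto intro!: mult_nonneg_nonneg)
    also have "\<dots> = y powr (- x) * Gamma x * norm (L (of_real \<sigma>))" by (rule eq)
    also have "\<dots> \<le> y powr (- x) * Gamma x * (7/4)"
      using L_bounds_right(2)[of "of_real \<sigma>"] \<sigma> Gp by (intro mult_left_mono) auto
    also have "y powr (- x) = y powr (- (x + d)) * y powr d" by (simp add: powr_add[symmetric])
    finally have "(y powr (- (x + d)) * Gamma x) * (x * (1/4)) \<le> (y powr (- (x + d)) * Gamma x) * (y powr d * (7/4))"
      by (simp only: mult_ac)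
    moreover have "y powr (- (x + d)) * Gamma x > 0" using y Gp by simp
    ultimately have "x * (1/4) \<le> y powr d * (7/4)" by (rule mult_left_le_imp_le)
    thus ?thesis by simp
  qed
  have "7 * y powr d + 2 \<le> 7 * y powr d" by (rule bound) simp
  thus False by simp
qed

text \<open>By the maximum principle an interior equality makes the quotient a constant of modulus
  1, so that |Xi| would have the period 2 h to the right of Re = 1.\<close>

lemma Xi_quotient_less:
  assumes h: "h > 0" and le: "\<And>s. Re s \<ge> 1/2 \<Longrightarrow> norm (Xi (s - of_real h)) \<le> norm (Xi (s + of_real h))"
    and nz: "\<And>s. Re s > 1/2 \<Longrightarrow> Xi (s + of_real h) \<noteq> 0" and s: "Re s > 1/2"
  shows "norm (Xi (s - of_real h)) < norm (Xi (s + of_real h))"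
proof (rule ccontr)
  assume "\<not> ?thesis"
  hence eq: "norm (Xi (s - of_real h)) = norm (Xi (s + of_real h))" using le[of s] s by simp
  define F where "F = (\<lambda>s. Xi (s - of_real h) / Xi (s + of_real h))"
  define S where "S = {s. Re s > 1/2}"
  have F1: "norm (F z) \<le> 1" if "z \<in> S" for z
    using le[of z] nz[of z] that by (simp add: S_def F_def norm_divide)
  have Fs: "norm (F s) = 1" using eq nz[OF s] by (simp add: F_def norm_divide)
  have opS: "open S" unfolding S_def by (rule open_halfspace_Re_gt)
  have "F constant_on S"
  proof (rule maximum_modulus_principle[of F S S s])
    show "F holomorphic_on S" unfolding F_def
      by (intro holomorphic_intros holomorphic_on_compose_gen[OF _ Xi_holomorphic[of UNIV], unfolded o_def])
         (use nz in \<open>auto simp: S_def\<close>)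
    show "open S" by (rule opS)
    show "connected S" unfolding S_def by (intro convex_connected convex_halfspace_Re_gt)
    show "norm (F z) \<le> norm (F s)" if "z \<in> S" for z using F1[OF that] Fs by simp
    show "s \<in> S" using s by (simp add: S_def)
  qed (use opS in auto)
  then obtain c where c: "\<And>z. z \<in> S \<Longrightarrow> F z = c" unfolding constant_on_def by blast
  hence "norm c = 1" using Fs s by (auto simp: S_def)
  hence per: "norm (Xi (z - of_real h)) = norm (Xi (z + of_real h))" if "z \<in> S" for z
    using c[OF that] nz[of z] that by (auto simp: S_def F_def norm_divide[symmetric] divide_eq_eq norm_mult)
  have "norm (Xi (z + of_real (2 * h))) = norm (Xi z)" if "Re z > 1" for z
    using per[of "z + of_real h"] that h by (simp add: S_def algebra_simps)
  thus False using Xi_not_periodic[of "2 * h"] h by simp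
qed

text \<open>The sign of h only decides which alternative of \<open>Hermite_Biehler\<close> holds.
  Nonvanishing is required on the critical line too, so that \<open>E\<close> has a phase there; for
  |h| = 1/2 this is the line of abscissa 1.\<close>

lemma E_zeros_interlace:
  assumes h: "h \<noteq> 0"
    and le: "\<And>s. Re s \<ge> 1/2 \<Longrightarrow> norm (Xi (s - of_real \<bar>h\<bar>)) \<le> norm (Xi (s + of_real \<bar>h\<bar>))"
    and nz: "\<And>s. Re s \<ge> 1/2 \<Longrightarrow> Xi (s + of_real \<bar>h\<bar>) \<noteq> 0"
  shows "A_fun N chi h \<theta> holomorphic_on UNIV \<and> B_fun N chi h \<theta> holomorphic_on UNIV \<and>
    zeros_on_critical_line (A_fun N chi h \<theta>) \<and> zeros_on_critical_line (B_fun N chi h \<theta>) \<and>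
    all_zeros_simple (A_fun N chi h \<theta>) \<and> all_zeros_simple (B_fun N chi h \<theta>) \<and>
    zeros_interlace (A_fun N chi h \<theta>) (B_fun N chi h \<theta>)"
proof -
  define E where "E = E_fun N chi h \<theta>"
  have E: "E s = exp (\<i> * of_real \<theta>) * Xi (s + of_real h)" for s
    by (simp add: E_def E_fun_def xi_eq[OF prim np])
  have nE: "norm (E s) = norm (Xi (s + of_real h))" for s by (simp add: E norm_mult)
  have nR: "norm (conj_refl E s) = norm (Xi (s - of_real h))" for s
    using norm_Xi_reflection[of "s - of_real h"] by (simp add: conj_refl_def nE algebra_simps)
  have A: "A_fun N chi h \<theta> = even_part E"
    by (rule ext) (simp add: A_fun_def even_part_def conj_refl_def E_def)
  have B: "B_fun N chi h \<theta> = odd_part E"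
    by (rule ext) (simp add: B_fun_def odd_part_def conj_refl_def E_def)
  have less: "norm (Xi (s - of_real \<bar>h\<bar>)) < norm (Xi (s + of_real \<bar>h\<bar>))" if "Re s > 1/2" for s
    using h le nz that by (intro Xi_quotient_less) auto
  show ?thesis unfolding A B
  proof (rule Hermite_Biehler)
    show "E holomorphic_on UNIV" unfolding E[abs_def]
      by (intro holomorphic_intros holomorphic_on_compose_gen[OF _ Xi_holomorphic[of UNIV], unfolded o_def]) auto
    show "E (Complex (1/2) t) \<noteq> 0" for t
    proof -
      define s where "s = Complex (1/2) t"
      have "norm (Xi (s + of_real \<bar>h\<bar>)) > 0" using nz[of s] by (simp add: s_def)
      moreover have "norm (Xi (s - of_real \<bar>h\<bar>)) = norm (Xi (s + of_real \<bar>h\<bar>))"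
      proof -
        have "1 - cnj (s - of_real \<bar>h\<bar>) = s + of_real \<bar>h\<bar>" by (simp add: s_def complex_eq_iff)
        thus ?thesis using norm_Xi_reflection[of "s - of_real \<bar>h\<bar>"] by metis
      qed
      ultimately have "norm (E s) > 0" unfolding nE by (cases "h \<ge> 0") auto
      thus ?thesis by (simp add: s_def)
    qed
    show "(\<forall>s. 1/2 < Re s \<longrightarrow> norm (conj_refl E s) < norm (E s)) \<or>
      (\<forall>s. 1/2 < Re s \<longrightarrow> norm (E s) < norm (conj_refl E s))"
      unfolding nE nR using less by (cases "h \<ge> 0") auto
  qed
qed

lemma Xi_nonzero: "Re s \<ge> 1 \<Longrightarrow> Xi s \<noteq> 0"
  using Xi_eq[of s] gamma_factor_nonzero[of s] L_nonzero[of s] by simp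

lemma L_nonzero_RH:
  assumes "riemann_hypothesis_L chi" "Re s > 1/2"
  shows "L s \<noteq> 0"
proof (cases "Re s \<ge> 1")
  case False
  hence "0 < Re s \<and> Re s < 1" "Re s \<noteq> 1/2" using assms(2) by auto
  hence "dirichlet_L chi s \<noteq> 0" using assms(1) unfolding riemann_hypothesis_L_def by blast
  thus ?thesis using entire_L_eq[of s] assms(2) by (simp add: dirichlet_L_eq[OF prim np])
qed (rule L_nonzero)

end

theorem theorem5p1:
  fixes N :: nat and chi :: "int \<Rightarrow> complex"
  assumes "primitive_dirichlet_character N chi"
    and "chi \<noteq> principal_character N"
  shows "(\<forall>h \<theta> :: real. \<bar>h\<bar> \<ge> 1/2 \<and> 0 \<le> \<theta> \<and> \<theta> < 2 * pi \<longrightarrow>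
            A_fun N chi h \<theta> holomorphic_on UNIV \<and> B_fun N chi h \<theta> holomorphic_on UNIV \<and>
            zeros_on_critical_line (A_fun N chi h \<theta>) \<and> zeros_on_critical_line (B_fun N chi h \<theta>) \<and>
            all_zeros_simple (A_fun N chi h \<theta>) \<and> all_zeros_simple (B_fun N chi h \<theta>) \<and>
            zeros_interlace (A_fun N chi h \<theta>) (B_fun N chi h \<theta>)) \<and>
         (riemann_hypothesis_L chi \<longrightarrow>
          (\<forall>h \<theta> :: real. 0 < \<bar>h\<bar> \<and> \<bar>h\<bar> < 1/2 \<and> 0 \<le> \<theta> \<and> \<theta> < 2 * pi \<longrightarrow>
            A_fun N chi h \<theta> holomorphic_on UNIV \<and> B_fun N chi h \<theta> holomorphic_on UNIV \<and>
            zeros_on_critical_line (A_fun N chi h \<theta>) \<and> zeros_on_critical_line (B_fun N chi h \<theta>) \<and>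
            all_zeros_simple (A_fun N chi h \<theta>) \<and> all_zeros_simple (B_fun N chi h \<theta>) \<and>
            zeros_interlace (A_fun N chi h \<theta>) (B_fun N chi h \<theta>)))"
proof -
  have "dchar N chi"
    using assms(1) by unfold_locales (simp add: primitive_dirichlet_character_def)
  then interpret primitive_nonprincipal N chi
    by (intro primitive_nonprincipal.intro primitive_nonprincipal_axioms.intro assms)
  show ?thesis
  proof (intro conjI[of "\<forall>h \<theta>. \<bar>h\<bar> \<ge> 1/2 \<and> 0 \<le> \<theta> \<and> \<theta> < 2 * pi \<longrightarrow> _ h \<theta>"] allI impI)
    fix h \<theta> :: real assume "\<bar>h\<bar> \<ge> 1/2 \<and> 0 \<le> \<theta> \<and> \<theta> < 2 * pi"
    hence h: "\<bar>h\<bar> \<ge> 1/2" ..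
    show "A_fun N chi h \<theta> holomorphic_on UNIV \<and> B_fun N chi h \<theta> holomorphic_on UNIV \<and>
            zeros_on_critical_line (A_fun N chi h \<theta>) \<and> zeros_on_critical_line (B_fun N chi h \<theta>) \<and>
            all_zeros_simple (A_fun N chi h \<theta>) \<and> all_zeros_simple (B_fun N chi h \<theta>) \<and>
            zeros_interlace (A_fun N chi h \<theta>) (B_fun N chi h \<theta>)"
      using h by (intro E_zeros_interlace Xi_quotient_le_half Xi_nonzero) auto
  next
    fix h \<theta> :: real
    assume RH: "riemann_hypothesis_L chi" and "0 < \<bar>h\<bar> \<and> \<bar>h\<bar> < 1/2 \<and> 0 \<le> \<theta> \<and> \<theta> < 2 * pi"
    hence h: "\<bar>h\<bar> > 0" by blast
    show "A_fun N chi h \<theta> holomorphic_on UNIV \<and> B_fun N chi h \<theta> holomorphic_on UNIV \<and>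
            zeros_on_critical_line (A_fun N chi h \<theta>) \<and> zeros_on_critical_line (B_fun N chi h \<theta>) \<and>
            all_zeros_simple (A_fun N chi h \<theta>) \<and> all_zeros_simple (B_fun N chi h \<theta>) \<and>
            zeros_interlace (A_fun N chi h \<theta>) (B_fun N chi h \<theta>)"
    proof (rule E_zeros_interlace)
      \<comment> \<open>The Riemann hypothesis allows c = 1/2, so every positive |h| exceeds c -
        1/2.\<close>
      show "norm (Xi (s - of_real \<bar>h\<bar>)) \<le> norm (Xi (s + of_real \<bar>h\<bar>))" if "Re s \<ge> 1/2" for s
        using h that L_nonzero_RH[OF RH] by (intro Xi_quotient_le[of "1/2"]) auto
      show "Xi (s + of_real \<bar>h\<bar>) \<noteq> 0" if "Re s \<ge> 1/2" for s
        using h that L_nonzero_RH[OF RH] Xi_eq[of "s + of_real \<bar>h\<bar>"] gamma_factor_nonzero[of "s + of_real \<bar>h\<bar>"]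
        by simp
    qed (use h in simp)
  qed
qed

end
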